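(* Let $X$ be a spectrally negative Lévy process with Lévy measure $\Pi$ and paths of bounded variation. Suppose that the tail $\overline\Pi(x)=\Pi(-\infty,-x)$, $x>0$, is differentiable on $(0,\infty)$ and that, writing $\pi(x)=-\overline\Pi{}'(x)\ge 0$, there exist $\alpha<1$ and $C>0$ such that $\pi(x)\le Cx^{-1-\alpha}$ for all $x>0$ in a neighbourhood of the origin. Then for each $q\ge 0$ and each $n=1,2,\dots$, the $q$-scale function $W^{(q)}$, restricted to $(0,\infty)$, belongs to $C^{n+1}(0,\infty)$ if and only if $\overline\Pi\in C^n(0,\infty)$.
   Context: A spectrally negative Lévy process $X=\{X_t:t\ge 0\}$ is a real-valued process, started from $0$ under the probability $P$, with almost surely right-continuous paths with left limits, stationary independent increments and no positive jumps; as usual it is assumed not to have monotone decreasing paths. Its Laplace exponent $\psi$ is defined by $E(e^{\theta X_t})=e^{t\psi(\theta)}$ and is finite for all $\theta\ge 0$, with $\psi(0+)=0$ and $\psi(\infty)=\infty$. It has the form $$\psi(\theta)=a\theta+\tfrac12\sigma^2\theta^2+\int_{(-\infty,0)}\bigl(e^{\theta x}-1-\theta x\mathbf 1_{(x>-1)}\bigr)\,\Pi(\mathrm dx),$$ where $a\in\mathbb R$, $\sigma\ge 0$ is the Gaussian coefficient, and $\Pi$ is the Lévy measure, a measure on $(-\infty,0)$ with $\int_{(-\infty,0)}(1\wedge x^2)\,\Pi(\mathrm dx)<\infty$. The paths have bounded variation if and only if $\sigma=0$ and $\int_{(-\infty,0)}(1\wedge|x|)\,\Pi(\mathrm dx)<\infty$.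 For $q\ge 0$, $\Phi(q)$ denotes the largest root in $[0,\infty)$ of $\psi(\theta)=q$. The $q$-scale function $W^{(q)}:\mathbb R\to[0,\infty)$ is the function with $W^{(q)}(x)=0$ for $x<0$, continuous on $[0,\infty)$, with $$\int_0^\infty e^{-\theta x}W^{(q)}(x)\,\mathrm dx=\frac{1}{\psi(\theta)-q}\qquad\text{for }\theta>\Phi(q).$$ *)

theory Defs
  imports "HOL-Probability.Probability"
begin

text \<open>
  The time index is \<^typ>\<open>real\<close>; only times \<open>t \<ge> 0\<close> are ever referred to.
\<close>

locale spectrally_negative_levy = prob_space M
  for M :: "'a measure" and X :: "real \<Rightarrow> 'a \<Rightarrow> real" +
  assumes random_variable_X: "\<And>t. 0 \<le> t \<Longrightarrow> random_variable borel (X t)"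
    and start_zero: "AE \<omega> in M. X 0 \<omega> = 0"
    and right_continuous: "AE \<omega> in M. \<forall>t\<ge>0. continuous (at_right t) (\<lambda>s. X s \<omega>)"
    and left_limits: "AE \<omega> in M. \<forall>t>0. \<exists>l. ((\<lambda>s. X s \<omega>) \<longlongrightarrow> l) (at_left t)"
    and stationary_increments:
      "\<And>s t. 0 \<le> s \<Longrightarrow> 0 \<le> t \<Longrightarrow>
        distr M borel (\<lambda>\<omega>. X (s + t) \<omega> - X s \<omega>) = distr M borel (X t)"
    and independent_increments:
      "\<And>(ts :: nat \<Rightarrow> real) n. mono ts \<Longrightarrow> 0 \<le> ts 0 \<Longrightarrow>
        indep_vars (\<lambda>_. borel) (\<lambda>i \<omega>. X (ts (Suc i)) \<omega> - X (ts i) \<omega>) {..<n}"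
    and no_positive_jumps:
      "AE \<omega> in M. \<forall>t>0. \<forall>l. ((\<lambda>s. X s \<omega>) \<longlongrightarrow> l) (at_left t) \<longrightarrow> X t \<omega> \<le> l"
    and not_monotone_decreasing: "\<not> (AE \<omega> in M. antimono_on {0..} (\<lambda>t. X t \<omega>))"

definition bounded_variation_on :: "(real \<Rightarrow> real) \<Rightarrow> real set \<Rightarrow> bool" where
  "bounded_variation_on f S \<longleftrightarrow>
    (\<exists>B. \<forall>(ts :: nat \<Rightarrow> real) n. mono ts \<and> range ts \<subseteq> S \<longrightarrow>
      (\<Sum>i<n. \<bar>f (ts (Suc i)) - f (ts i)\<bar>) \<le> B)"

definition bounded_variation_paths :: "'a measure \<Rightarrow> (real \<Rightarrow> 'a \<Rightarrow> real) \<Rightarrow> bool" where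
  "bounded_variation_paths M X \<longleftrightarrow>
    (AE \<omega> in M. \<forall>T\<ge>0. bounded_variation_on (\<lambda>t. X t \<omega>) {0..T})"

definition has_laplace_exponent ::
  "'a measure \<Rightarrow> (real \<Rightarrow> 'a \<Rightarrow> real) \<Rightarrow> (real \<Rightarrow> real) \<Rightarrow> bool" where
  "has_laplace_exponent M X \<psi> \<longleftrightarrow>
    (\<forall>\<theta>\<ge>0. \<forall>t\<ge>0. integrable M (\<lambda>\<omega>. exp (\<theta> * X t \<omega>)) \<and>
      (\<integral>\<omega>. exp (\<theta> * X t \<omega>) \<partial>M) = exp (t * \<psi> \<theta>))"

text \<open>
  A measure on \<open>(-\<infinity>, 0)\<close> is represented as a Borel measure on the line that
  gives no mass to \<open>[0, \<infinity>)\<close>.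
\<close>

definition levy_measure :: "real measure \<Rightarrow> bool" where
  "levy_measure \<nu> \<longleftrightarrow> sets \<nu> = sets borel \<and> emeasure \<nu> {0..} = 0 \<and>
    (\<integral>\<^sup>+x\<in>{..<0}. ennreal (min 1 (x\<^sup>2)) \<partial>\<nu>) < \<infinity>"

definition levy_khintchine ::
  "(real \<Rightarrow> real) \<Rightarrow> real \<Rightarrow> real \<Rightarrow> real measure \<Rightarrow> bool" where
  "levy_khintchine \<psi> a \<sigma> \<nu> \<longleftrightarrow> 0 \<le> \<sigma> \<and> levy_measure \<nu> \<and>
    (\<forall>\<theta>\<ge>0. \<psi> \<theta> = a * \<theta> + 1 / 2 * \<sigma>\<^sup>2 * \<theta>\<^sup>2 +
      (LINT x:{..<0}|\<nu>. exp (\<theta> * x) - 1 - \<theta> * x * indicator {-1<..} x))"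

definition levy_tail :: "real measure \<Rightarrow> real \<Rightarrow> real" where
  "levy_tail \<nu> x = measure \<nu> {..<-x}"

definition largest_root :: "(real \<Rightarrow> real) \<Rightarrow> real \<Rightarrow> real" where
  "largest_root \<psi> q = (GREATEST \<theta>. 0 \<le> \<theta> \<and> \<psi> \<theta> = q)"

definition is_scale_function :: "(real \<Rightarrow> real) \<Rightarrow> real \<Rightarrow> (real \<Rightarrow> real) \<Rightarrow> bool" where
  "is_scale_function \<psi> q W \<longleftrightarrow>
    (\<forall>x. 0 \<le> W x) \<and> (\<forall>x<0. W x = 0) \<and> continuous_on {0..} W \<and>
    (\<forall>\<theta>>largest_root \<psi> q.
      set_integrable lborel {0..} (\<lambda>x. exp (- \<theta> * x) * W x) \<and>
      (LBINT x:{0..}. exp (- \<theta> * x) * W x) = 1 / (\<psi> \<theta> - q))"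

text \<open>
  Only meant for open \<open>S\<close>: \<^const>\<open>deriv\<close> is the two-sided derivative, so it depends
  only on the restriction of the function to \<open>S\<close> at points of an open \<open>S\<close>.
\<close>

definition C_k_on :: "nat \<Rightarrow> (real \<Rightarrow> real) \<Rightarrow> real set \<Rightarrow> bool" where
  "C_k_on k f S \<longleftrightarrow>
    (\<forall>i<k. (deriv ^^ i) f differentiable_on S) \<and> continuous_on S ((deriv ^^ k) f)"

end

theory Submission
  imports Defs
begin

text \<open>
  Write \<open>T\<close> for the tail of the Levy measure. For paths of bounded variation the Laplace exponent
  is \<open>\<psi>(\<theta>) = \<theta> (\<delta> - L T(\<theta>))\<close> with drift \<open>\<delta> > 0\<close>, where \<open>L\<close> denotes the Laplace transform. Hence,
  with \<open>g = (T + q) / \<delta>\<close>,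
  \<open>L W(\<theta>) = 1 / (\<psi>(\<theta>) - q) = \<delta>\<^bsup>-1\<^esup> \<theta>\<^bsup>-1\<^esup> / (1 - L g(\<theta>))\<close>,
  which says that \<open>W\<close> is a renewal function: \<open>W(x) = \<delta>\<^bsup>-1\<^esup> (1 + \<integral>\<^sub>0\<^sup>x U)\<close> where \<open>U = g + g*g + \<dots>\<close>. So the
  claim is that the renewal density \<open>U\<close> is \<open>C\<^sup>n\<close> on \<open>(0,\<infinity>)\<close> if and only if its kernel \<open>g\<close> is.

  The difficulty is the singularity of \<open>g\<close> at \<open>0\<close>: \<open>g'\<close> and \<open>U'\<close> may fail to be integrable there, so the
  renewal equation \<open>U = g + g*U\<close> cannot simply be differentiated. The way around it is that
  multiplication by \<open>x\<close> is a derivation of the convolution algebra. Applied to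
  \<open>\<epsilon> + U = (\<epsilon> - g)\<^bsup>-1\<^esup>\<close>, with \<open>\<epsilon>\<close> the unit, it gives \<open>x U = (\<epsilon> + U) * (x g) * (\<epsilon> + U)\<close>. Here \<open>x g\<close> is
  harmless: since \<open>g\<close> is decreasing and integrable, \<open>p = - x g'\<close> is integrable at \<open>0\<close> as well
  (\<open>p_integrable\<close>), and \<open>(x g)' = g - p\<close>. Therefore
  \<open>(x U)' = U * (\<epsilon> + U) - p * (\<epsilon> + U) * (\<epsilon> + U)\<close>
  (\<open>continuous_renewal_density\<close>), and symmetrically \<open>p\<close> can be recovered from \<open>x U'\<close> and \<open>g\<close>. As
  convolution preserves \<open>C\<^sup>m\<close> regularity on \<open>(0,\<infinity>)\<close> for functions integrable at \<open>0\<close>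
  (\<open>C_k_on_conv\<close>), each of these identities gains one derivative per application, and iterating
  them proves the two implications (\<open>renewal_density_smooth_iff\<close>). The identities themselves, and
  the identification of \<open>W\<close>, are checked on the Laplace side, where they are identities between
  rational functions of \<open>L g\<close> and \<open>L p\<close>; Lerch's uniqueness theorem (\<open>laplace_inject\<close>) brings
  them back.

  The form of \<open>\<psi>\<close> used above is derived from the process (\<open>laplace_exponent_bounded_variation\<close>).
  The bound on the density of the Levy measure makes \<open>T\<close> integrable at \<open>0\<close>, so the jump part of \<open>\<psi>\<close>
  needs no compensation. There is no Gaussian part, because the total variation over a grid is a
  sum of independent terms and its boundedness in probability forces \<open>E (1 - e\<^bsup>-\<theta>\<bar>X\<bar>\<^esup>)\<close> at
  time \<open>t\<close> to be of order \<open>t\<close>, with a constant growing only linearly in \<open>\<theta>\<close>. And \<open>\<delta> > 0\<close>, because otherwise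
  \<open>\<psi> \<le> 0\<close> and the paths would be decreasing.
\<close>

section \<open>Laplace transforms and convolution on the half-line\<close>

text \<open>
  Membership in \<open>L\<^sup>1(e\<^bsup>-\<theta>x\<^esup> dx)\<close> on the open half-line. All functions below live on
  \<open>(0,\<infinity>)\<close>: their values elsewhere never matter, and a singularity at \<open>0\<close> is allowed.
\<close>
definition exp_integrable :: "real \<Rightarrow> (real \<Rightarrow> real) \<Rightarrow> bool" where
  "exp_integrable \<theta> f \<longleftrightarrow> set_integrable lborel {0<..} (\<lambda>x. exp (- \<theta> * x) * f x)"

definition laplace :: "(real \<Rightarrow> real) \<Rightarrow> real \<Rightarrow> real" where
  "laplace f \<theta> = (LBINT x:{0<..}. exp (- \<theta> * x) * f x)"

definition conv :: "(real \<Rightarrow> real) \<Rightarrow> (real \<Rightarrow> real) \<Rightarrow> real \<Rightarrow> real" where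
  "conv f h x = (LBINT y:{0<..<x}. f (x - y) * h y)"

lemma exp_integrable_measurable:
  assumes "exp_integrable \<theta> f"
  shows "(\<lambda>x. indicator {0<..} x * f x) \<in> borel_measurable borel"
proof -
  have "(\<lambda>x. indicator {0<..} x *\<^sub>R (exp (- \<theta> * x) * f x)) \<in> borel_measurable borel"
    using assms unfolding exp_integrable_def set_integrable_def
    by (auto dest: borel_measurable_integrable)
  then have "(\<lambda>x. exp (\<theta> * x) * (indicator {0<..} x *\<^sub>R (exp (- \<theta> * x) * f x))) \<in> borel_measurable borel"
    by measurable
  also have "(\<lambda>x. exp (\<theta> * x) * (indicator {0<..} x *\<^sub>R (exp (- \<theta> * x) * f x))) = (\<lambda>x. indicator {0<..} x * f x)"
    by (auto simp: fun_eq_iff indicator_def exp_minus field_simps)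
  finally show ?thesis .
qed

text \<open>
  Domination test; the weights of the two sides may differ, which is what trades a factor \<open>x\<close>
  for a slightly larger exponent.
\<close>
lemma exp_integrable_bound:
  assumes f: "exp_integrable \<theta> f"
    and h: "(\<lambda>x. indicator {0<..} x * h x) \<in> borel_measurable borel"
    and le: "\<And>x. 0 < x \<Longrightarrow> exp (- \<theta>' * x) * \<bar>h x\<bar> \<le> c * (exp (- \<theta> * x) * \<bar>f x\<bar>)"
  shows "exp_integrable \<theta>' h"
  unfolding exp_integrable_def set_integrable_def
proof (rule Bochner_Integration.integrable_bound)
  show "integrable lborel (\<lambda>x. c * (indicator {0<..} x *\<^sub>R (exp (- \<theta> * x) * f x)))"
    using f unfolding exp_integrable_def set_integrable_def by simp
  have "(\<lambda>x. indicator {0<..} x *\<^sub>R (exp (- \<theta>' * x) * h x)) = (\<lambda>x. exp (- \<theta>' * x) * (indicator {0<..} x * h x))"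
    by (auto simp: fun_eq_iff)
  then show "(\<lambda>x. indicator {0<..} x *\<^sub>R (exp (- \<theta>' * x) * h x)) \<in> borel_measurable lborel"
    using h by simp
  show "AE x in lborel. norm (indicator {0<..} x *\<^sub>R (exp (- \<theta>' * x) * h x))
      \<le> norm (c * (indicator {0<..} x *\<^sub>R (exp (- \<theta> * x) * f x)))"
  proof (rule AE_I2)
    fix x :: real
    show "norm (indicator {0<..} x *\<^sub>R (exp (- \<theta>' * x) * h x))
      \<le> norm (c * (indicator {0<..} x *\<^sub>R (exp (- \<theta> * x) * f x)))"
    proof (cases "0 < x")
      case True
      have "exp (- \<theta>' * x) * \<bar>h x\<bar> \<le> \<bar>c\<bar> * (exp (- \<theta> * x) * \<bar>f x\<bar>)"
        using le[OF True] by (smt (verit) abs_ge_self mult_right_mono mult_nonneg_nonneg exp_ge_zero abs_ge_zero)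
      then show ?thesis using True by (simp add: abs_mult)
    qed simp
  qed
qed

lemma exp_integrable_mono:
  assumes "exp_integrable \<theta> f" "\<theta> \<le> \<theta>'"
  shows "exp_integrable \<theta>' f"
proof (rule exp_integrable_bound[OF assms(1) exp_integrable_measurable[OF assms(1)], where c = 1])
  fix x :: real assume "0 < x"
  then show "exp (- \<theta>' * x) * \<bar>f x\<bar> \<le> 1 * (exp (- \<theta> * x) * \<bar>f x\<bar>)"
    using assms(2) by (auto intro!: mult_right_mono)
qed

lemma exp_integrable_add:
  assumes "exp_integrable \<theta> f" "exp_integrable \<theta> h"
  shows "exp_integrable \<theta> (\<lambda>x. f x + h x)" "laplace (\<lambda>x. f x + h x) \<theta> = laplace f \<theta> + laplace h \<theta>"
  using set_integral_add[OF assms[unfolded exp_integrable_def]]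
  by (simp_all add: exp_integrable_def laplace_def distrib_left)

lemma exp_integrable_diff:
  assumes "exp_integrable \<theta> f" "exp_integrable \<theta> h"
  shows "exp_integrable \<theta> (\<lambda>x. f x - h x)" "laplace (\<lambda>x. f x - h x) \<theta> = laplace f \<theta> - laplace h \<theta>"
  using set_integral_diff[OF assms[unfolded exp_integrable_def]]
  by (simp_all add: exp_integrable_def laplace_def right_diff_distrib)

lemma exp_integrable_cmult:
  assumes "exp_integrable \<theta> f"
  shows "exp_integrable \<theta> (\<lambda>x. c * f x)" "laplace (\<lambda>x. c * f x) \<theta> = c * laplace f \<theta>"
proof -
  have *: "exp (- \<theta> * x) * (c * f x) = c * (exp (- \<theta> * x) * f x)" for x by simp
  show "exp_integrable \<theta> (\<lambda>x. c * f x)"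
    unfolding exp_integrable_def *
    using assms unfolding exp_integrable_def by (rule set_integrable_mult_right)
  show "laplace (\<lambda>x. c * f x) \<theta> = c * laplace f \<theta>"
    unfolding laplace_def * by (rule set_integral_mult_right)
qed

lemma exp_integrable_const:
  assumes "0 < \<theta>"
  shows "exp_integrable \<theta> (\<lambda>_. c)" "laplace (\<lambda>_. c) \<theta> = c / \<theta>"
proof -
  have "has_bochner_integral lborel (\<lambda>x. indicator {0..} x * exp (- (x * \<theta>))) (1 / \<theta>)"
  proof (rule has_bochner_integral_nn_integral)
    have "(\<integral>\<^sup>+ x. ennreal (exp (- (x * \<theta>))) * indicator {0..} x \<partial>lborel) = ennreal (0 - (- 1 / \<theta> * exp (- (0 * \<theta>))))"
    proof (rule nn_integral_FTC_atLeast)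
      show "((\<lambda>x. - 1 / \<theta> * exp (- (x * \<theta>))) \<longlongrightarrow> 0) at_top"
      proof -
        have "filterlim (\<lambda>x. x * \<theta>) at_top at_top"
          using assms by (simp add: filterlim_tendsto_pos_mult_at_top[OF tendsto_const] filterlim_ident mult.commute[of _ \<theta>])
        then have "((\<lambda>x. exp (- (x * \<theta>))) \<longlongrightarrow> 0) at_top"
          by (intro filterlim_compose[OF exp_at_bot]) (simp add: filterlim_uminus_at_bot)
        from tendsto_mult[OF tendsto_const[of "- 1 / \<theta>"] this] show ?thesis by simp
      qed
    qed (use assms in \<open>auto intro!: derivative_eq_intros\<close>)
    then show "(\<integral>\<^sup>+ x. ennreal (indicator {0..} x * exp (- (x * \<theta>))) \<partial>lborel) = ennreal (1 / \<theta>)"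
      by (simp add: ennreal_mult'' mult.commute[of "indicator _ _"] ennreal_indicator[symmetric] )
  qed (use assms in auto)
  moreover have "AE x in lborel. indicator {0..} x * exp (- (x * \<theta>)) = indicator {0<..} x *\<^sub>R exp (- (\<theta> * x))"
    using AE_lborel_singleton[of 0] by eventually_elim (auto simp: indicator_def mult.commute)
  ultimately have "has_bochner_integral lborel (\<lambda>x. indicator {0<..} x *\<^sub>R exp (- (\<theta> * x))) (1 / \<theta>)"
    by (subst (asm) has_bochner_integral_cong_AE) auto
  then have 1: "exp_integrable \<theta> (\<lambda>_. 1)" "laplace (\<lambda>_. 1) \<theta> = 1 / \<theta>"
    by (auto simp: exp_integrable_def laplace_def has_bochner_integral_iff set_integrable_def set_lebesgue_integral_def)
  from exp_integrable_cmult[OF 1(1), of c] 1(2)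
  show "exp_integrable \<theta> (\<lambda>_. c)" "laplace (\<lambda>_. c) \<theta> = c / \<theta>" by simp_all
qed

lemma exp_integrable_times_x:
  assumes "exp_integrable \<theta> f" "\<theta> < \<theta>'"
  shows "exp_integrable \<theta>' (\<lambda>x. x * f x)"
proof (rule exp_integrable_bound[OF assms(1), where c = "1 / (\<theta>' - \<theta>)"])
  have "(\<lambda>x. x * (indicator {0<..} x * f x)) \<in> borel_measurable borel"
    using exp_integrable_measurable[OF assms(1)] by measurable
  then show "(\<lambda>x. indicator {0<..} x * (x * f x)) \<in> borel_measurable borel"
    by (simp add: mult.left_commute)
  fix x :: real assume x: "0 < x"
  have "(\<theta>' - \<theta>) * x \<le> exp ((\<theta>' - \<theta>) * x)"
    using exp_ge_add_one_self[of "(\<theta>' - \<theta>) * x"] by linarith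
  then have "x \<le> exp ((\<theta>' - \<theta>) * x) / (\<theta>' - \<theta>)"
    using assms(2) by (simp add: field_simps)
  then have "exp (- \<theta>' * x) * x \<le> exp (- \<theta>' * x) * (exp ((\<theta>' - \<theta>) * x) / (\<theta>' - \<theta>))"
    by (rule mult_left_mono) simp
  also have "\<dots> = 1 / (\<theta>' - \<theta>) * exp (- \<theta> * x)"
    by (simp add: exp_add[symmetric] algebra_simps)
  finally have "exp (- \<theta>' * x) * x * \<bar>f x\<bar> \<le> 1 / (\<theta>' - \<theta>) * exp (- \<theta> * x) * \<bar>f x\<bar>"
    by (rule mult_right_mono) simp
  then show "exp (- \<theta>' * x) * \<bar>x * f x\<bar> \<le> 1 / (\<theta>' - \<theta>) * (exp (- \<theta> * x) * \<bar>f x\<bar>)"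
    using x by (simp add: abs_mult mult.assoc)
qed

lemma AE_eq_imp_exp_integrable_cong:
  assumes f: "exp_integrable \<theta> f" and ae: "AE x in lborel. 0 < x \<longrightarrow> f x = h x"
    and h: "(\<lambda>x. indicator {0<..} x * h x) \<in> borel_measurable borel"
  shows "exp_integrable \<theta> h" "laplace h \<theta> = laplace f \<theta>"
proof -
  have ae': "AE x in lborel. indicator {0<..} x *\<^sub>R (exp (- \<theta> * x) * f x) = indicator {0<..} x *\<^sub>R (exp (- \<theta> * x) * h x)"
    using ae by eventually_elim (auto simp: indicator_def)
  have m: "(\<lambda>x. indicator {0<..} x *\<^sub>R (exp (- \<theta> * x) * h x)) \<in> borel_measurable lborel"
  proof -
    have "(\<lambda>x. exp (- \<theta> * x) * (indicator {0<..} x * h x)) \<in> borel_measurable lborel"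
      using h by simp
    then show ?thesis by (simp add: mult.left_commute)
  qed
  show "exp_integrable \<theta> h"
    using f integrable_cong_AE[OF _ m ae'] unfolding exp_integrable_def set_integrable_def
    by (auto dest: borel_measurable_integrable)
  show "laplace h \<theta> = laplace f \<theta>"
    using integral_cong_AE[OF _ m ae'] f unfolding laplace_def set_lebesgue_integral_def exp_integrable_def set_integrable_def
    by (auto dest: borel_measurable_integrable)
qed

text \<open>
  The positive and the negative part of \<open>\<phi>\<close> are densities of two finite measures that agree on
  all half-lines, hence of the same measure, hence they agree almost everywhere; being parts of
  one function they then both vanish.
\<close>
lemma AE_eq_0_if_tail_integrals_eq_0:
  fixes \<phi> :: "real \<Rightarrow> real"
  assumes int: "integrable lborel \<phi>" and zero: "\<And>c. (LBINT x:{c<..}. \<phi> x) = 0"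
  shows "AE x in lborel. \<phi> x = 0"
proof -
  have [measurable]: "\<phi> \<in> borel_measurable borel" using int by (auto dest: borel_measurable_integrable)
  let ?P = "density lborel (\<lambda>x. ennreal (\<phi> x))" and ?N = "density lborel (\<lambda>x. ennreal (- \<phi> x))"
  have em: "emeasure (density lborel (\<lambda>x. ennreal (h x))) {c<..} = ennreal (LBINT x:{c<..}. max 0 (h x))"
    if h: "integrable lborel h" for h :: "real \<Rightarrow> real" and c
  proof -
    have [measurable]: "h \<in> borel_measurable borel" using h by (auto dest: borel_measurable_integrable)
    have "emeasure (density lborel (\<lambda>x. ennreal (h x))) {c<..} = (\<integral>\<^sup>+x. ennreal (indicator {c<..} x *\<^sub>R max 0 (h x)) \<partial>lborel)"
      by (auto simp: emeasure_density max_def ennreal_neg indicator_def intro!: nn_integral_cong)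
    also have "\<dots> = ennreal (LBINT x:{c<..}. max 0 (h x))"
      unfolding set_lebesgue_integral_def
      by (intro nn_integral_eq_integral integrable_mult_indicator) (use h in auto)
    finally show ?thesis .
  qed
  have "?P = ?N"
  proof (rule measure_eqI_lessThan)
    fix c
    show "emeasure ?P {c<..} < \<infinity>" using em[OF int] by simp
    have si: "set_integrable lborel {c<..} (\<lambda>x. max 0 (\<phi> x))" "set_integrable lborel {c<..} (\<lambda>x. max 0 (- \<phi> x))"
      unfolding set_integrable_def by (intro integrable_mult_indicator; use int in auto)+
    have "(LBINT x:{c<..}. max 0 (\<phi> x)) - (LBINT x:{c<..}. max 0 (- \<phi> x)) = (LBINT x:{c<..}. max 0 (\<phi> x) - max 0 (- \<phi> x))"
      using set_integral_diff[OF si] by simp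
    also have "\<dots> = (LBINT x:{c<..}. \<phi> x)" by (intro set_lebesgue_integral_cong) auto
    finally show "emeasure ?P {c<..} = emeasure ?N {c<..}"
      using em[OF int, of c] em[of "\<lambda>x. - \<phi> x" c] int zero[of c] by simp
  qed auto
  then have "AE x in lborel. ennreal (\<phi> x) = ennreal (- \<phi> x)"
    by (intro sigma_finite_measure.density_unique[OF sigma_finite_lborel]) auto
  then show ?thesis
    by eventually_elim (metis ennreal_eq_0_iff ennreal_neg linorder_le_cases neg_le_0_iff_le order_antisym)
qed

text \<open>
  After the substitution \<open>u = e\<^bsup>-x\<^esup>\<close>, the transform at \<open>\<theta> + n\<close> is the \<open>n\<close>-th moment of a finite signed
  measure on \<open>[0,1]\<close>. If all moments vanish, then by Weierstrass approximation so does the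
  integral of every continuous function.
\<close>
lemma lerch_continuous:
  assumes f: "exp_integrable \<theta> f" and zero: "\<And>n. laplace f (\<theta> + real n) = 0"
    and \<phi>: "continuous_on UNIV \<phi>"
  shows "(LBINT x:{0<..}. \<phi> (exp (- x)) * (exp (- \<theta> * x) * f x)) = 0"
proof -
  define F where "F x = indicator {0<..} x * (exp (- \<theta> * x) * f x)" for x
  have F: "integrable lborel F"
    using f by (simp add: exp_integrable_def set_integrable_def F_def[abs_def])
  have [measurable]: "F \<in> borel_measurable borel" using F by (auto dest: borel_measurable_integrable)
  have [measurable]: "\<phi> \<in> borel_measurable borel" using \<phi> by (rule borel_measurable_continuous_onI)
  have int: "integrable lborel (\<lambda>x. \<eta> (exp (- x)) * F x)" if \<eta>: "continuous_on UNIV \<eta>" for \<eta> :: "real \<Rightarrow> real"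
  proof -
    have [measurable]: "\<eta> \<in> borel_measurable borel" using \<eta> by (rule borel_measurable_continuous_onI)
    have "bounded (\<eta> ` {0..1})"
      by (intro compact_imp_bounded compact_continuous_image continuous_on_subset[OF \<eta>]) auto
    then obtain B where B: "\<And>u. u \<in> {0..1} \<Longrightarrow> \<bar>\<eta> u\<bar> \<le> B" by (fastforce simp: bounded_iff)
    have B': "\<bar>\<eta> u\<bar> \<le> \<bar>B\<bar>" if "u \<in> {0..1}" for u using B[OF that] by linarith
    show ?thesis
    proof (rule Bochner_Integration.integrable_bound)
      show "integrable lborel (\<lambda>x. \<bar>B\<bar> * F x)" using F by simp
      show "AE x in lborel. norm (\<eta> (exp (- x)) * F x) \<le> norm (\<bar>B\<bar> * F x)"
        by (intro AE_I2) (auto simp: F_def abs_mult indicator_def intro!: mult_right_mono B')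
    qed simp
  qed
  have mono: "(\<integral>x. exp (- x) ^ i * F x \<partial>lborel) = 0" for i :: nat
  proof -
    have "laplace f (\<theta> + real i) = (\<integral>x. exp (- x) ^ i * F x \<partial>lborel)"
      unfolding laplace_def set_lebesgue_integral_def F_def
      by (intro Bochner_Integration.integral_cong) (auto simp: algebra_simps exp_add[symmetric] exp_of_nat_mult[symmetric])
    then show ?thesis using zero by simp
  qed
  have small: "\<bar>\<integral>x. \<phi> (exp (- x)) * F x \<partial>lborel\<bar> \<le> e * (\<integral>x. \<bar>F x\<bar> \<partial>lborel)" if e: "0 < e" for e
  proof -
    obtain P where P: "real_polynomial_function P" "\<And>u. u \<in> {0..1} \<Longrightarrow> \<bar>\<phi> u - P u\<bar> < e"
      using Stone_Weierstrass_real_polynomial_function[of "{0..1}" \<phi> e] e continuous_on_subset[OF \<phi>] by auto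
    obtain a n where Pa: "P = (\<lambda>x. \<Sum>i\<le>n::nat. a i * x ^ i)"
      using P(1) unfolding real_polynomial_function_iff_sum by auto
    have intP: "integrable lborel (\<lambda>x. exp (- x) ^ i * F x)" for i
      by (rule int[of "\<lambda>u. u ^ i"]) (auto intro!: continuous_intros)
    have "(\<integral>x. P (exp (- x)) * F x \<partial>lborel) = (\<integral>x. (\<Sum>i\<le>n. a i * (exp (- x) ^ i * F x)) \<partial>lborel)"
      by (simp add: Pa sum_distrib_right mult.assoc)
    also have "\<dots> = 0" by (subst Bochner_Integration.integral_sum) (auto simp: intP mono)
    finally have P0: "(\<integral>x. P (exp (- x)) * F x \<partial>lborel) = 0" .
    have cP: "continuous_on UNIV P" unfolding Pa by (intro continuous_intros)
    have "(\<integral>x. \<phi> (exp (- x)) * F x \<partial>lborel) = (\<integral>x. (\<phi> (exp (- x)) - P (exp (- x))) * F x \<partial>lborel)"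
      using P0 Bochner_Integration.integral_diff[OF int[OF \<phi>] int[OF cP]] by (simp add: left_diff_distrib)
    also have "\<bar>\<dots>\<bar> \<le> (\<integral>x. \<bar>(\<phi> (exp (- x)) - P (exp (- x))) * F x\<bar> \<partial>lborel)"
      by (rule integral_abs_bound)
    also have "\<dots> \<le> (\<integral>x. e * \<bar>F x\<bar> \<partial>lborel)"
    proof (rule integral_mono)
      show "integrable lborel (\<lambda>x. \<bar>(\<phi> (exp (- x)) - P (exp (- x))) * F x\<bar>)"
        by (intro integrable_abs int continuous_intros \<phi> cP)
      show "\<bar>(\<phi> (exp (- x)) - P (exp (- x))) * F x\<bar> \<le> e * \<bar>F x\<bar>" for x
        using P(2)[of "exp (- x)"] by (auto simp: F_def abs_mult indicator_def intro!: mult_right_mono)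
    qed (use F in simp)
    finally show ?thesis by simp
  qed
  have "\<bar>\<integral>x. \<phi> (exp (- x)) * F x \<partial>lborel\<bar> \<le> 0"
  proof (rule field_le_epsilon)
    fix e :: real assume "0 < e"
    have I: "0 \<le> (\<integral>x. \<bar>F x\<bar> \<partial>lborel)" by simp
    have "\<bar>\<integral>x. \<phi> (exp (- x)) * F x \<partial>lborel\<bar> \<le> e / ((\<integral>x. \<bar>F x\<bar> \<partial>lborel) + 1) * (\<integral>x. \<bar>F x\<bar> \<partial>lborel)"
      using I \<open>0 < e\<close> by (intro small) (auto intro!: divide_pos_pos add_nonneg_pos)
    also have "\<dots> \<le> e"
    proof -
      have "e * (\<integral>x. \<bar>F x\<bar> \<partial>lborel) \<le> e * ((\<integral>x. \<bar>F x\<bar> \<partial>lborel) + 1)"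
        using \<open>0 < e\<close> by (intro mult_left_mono) auto
      moreover have "0 < (\<integral>x. \<bar>F x\<bar> \<partial>lborel) + 1" using I by linarith
      ultimately show ?thesis by (simp add: divide_le_eq)
    qed
    finally show "\<bar>\<integral>x. \<phi> (exp (- x)) * F x \<partial>lborel\<bar> \<le> 0 + e" by simp
  qed
  then show ?thesis
    unfolding set_lebesgue_integral_def by (simp add: F_def mult.left_commute)
qed

text \<open>
  Continuous ramps in \<open>e\<^bsup>-x\<^esup>\<close> increase to the indicator of \<open>(c,\<infinity>)\<close>, so the previous lemma kills
  all tail integrals.
\<close>
theorem lerch:
  assumes f: "exp_integrable \<theta> f" and zero: "\<And>t. \<theta> \<le> t \<Longrightarrow> laplace f t = 0"
  shows "AE x in lborel. 0 < x \<longrightarrow> f x = 0"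
proof -
  define F where "F x = indicator {0<..} x * (exp (- \<theta> * x) * f x)" for x
  have F: "integrable lborel F"
    using f by (simp add: exp_integrable_def set_integrable_def F_def[abs_def])
  have [measurable]: "F \<in> borel_measurable borel" using F by (auto dest: borel_measurable_integrable)
  have "AE x in lborel. F x = 0"
  proof (rule AE_eq_0_if_tail_integrals_eq_0[OF F])
    fix c :: real
    \<comment> \<open>As a function of \<open>u = e\<^bsup>-x\<^esup>\<close> this is a ramp of slope \<open>- k\<close>, equal to \<open>0\<close> for \<open>x \<le> c\<close>.\<close>
    define \<phi> where "\<phi> k u = max 0 (min 1 (real k * (exp (- c) - u)))" for k u
    have "(\<lambda>k. \<integral>x. \<phi> k (exp (- x)) * F x \<partial>lborel) \<longlonglongrightarrow> (\<integral>x. indicator {c<..} x *\<^sub>R F x \<partial>lborel)"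
    proof (rule integral_dominated_convergence)
      show "integrable lborel (\<lambda>x. \<bar>F x\<bar>)" using F by simp
      show "AE x in lborel. (\<lambda>k. \<phi> k (exp (- x)) * F x) \<longlonglongrightarrow> indicator {c<..} x *\<^sub>R F x"
      proof (rule AE_I2)
        fix x :: real
        have "(\<lambda>k. \<phi> k (exp (- x))) \<longlonglongrightarrow> indicator {c<..} x"
        proof (cases "c < x")
          case True
          then have d: "0 < exp (- c) - exp (- x)" by simp
          obtain k0 where k0: "1 / (exp (- c) - exp (- x)) \<le> real k0" using real_arch_simple by blast
          have "\<forall>\<^sub>F k in sequentially. \<phi> k (exp (- x)) = indicator {c<..} x"
            unfolding eventually_sequentially
          proof (intro exI[of _ k0] allI impI)
            fix k assume "k0 \<le> k"
            then have "1 / (exp (- c) - exp (- x)) \<le> real k" using k0 by linarith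
            then have "1 \<le> real k * (exp (- c) - exp (- x))" using d by (simp add: field_simps)
            then show "\<phi> k (exp (- x)) = indicator {c<..} x" using True by (simp add: \<phi>_def)
          qed
          then show ?thesis by (rule tendsto_eventually)
        next
          case False
          then have "real k * (exp (- c) - exp (- x)) \<le> 0" for k
            by (intro mult_nonneg_nonpos) auto
          then have "\<phi> k (exp (- x)) = 0" for k
            unfolding \<phi>_def by (intro max_absorb1 min.coboundedI2)
          then show ?thesis using False by simp
        qed
        then show "(\<lambda>k. \<phi> k (exp (- x)) * F x) \<longlonglongrightarrow> indicator {c<..} x *\<^sub>R F x"
          by (auto intro!: tendsto_intros)
      qed
      show "AE x in lborel. norm (\<phi> k (exp (- x)) * F x) \<le> \<bar>F x\<bar>" for k
        by (intro AE_I2) (auto simp: \<phi>_def abs_mult intro!: mult_left_le_one_le)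
    qed (auto simp: \<phi>_def)
    moreover have "(\<integral>x. \<phi> k (exp (- x)) * F x \<partial>lborel) = 0" for k
    proof -
      have "continuous_on UNIV (\<phi> k)" unfolding \<phi>_def by (intro continuous_intros)
      from lerch_continuous[OF f zero this] show ?thesis
        unfolding set_lebesgue_integral_def by (simp add: F_def mult.left_commute)
    qed
    ultimately have "(\<lambda>k. 0) \<longlonglongrightarrow> (\<integral>x. indicator {c<..} x *\<^sub>R F x \<partial>lborel)" by simp
    then show "(LBINT x:{c<..}. F x) = 0"
      unfolding set_lebesgue_integral_def using LIMSEQ_unique tendsto_const by blast
  qed
  then show ?thesis by eventually_elim (auto simp: F_def indicator_def)
qed

text \<open>
  This is the tool that turns identities between convolutions into rational identities
  between numbers.
\<close>
corollary laplace_inject: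
  assumes "exp_integrable \<theta> f" "exp_integrable \<theta> h" "\<And>t. \<theta> \<le> t \<Longrightarrow> laplace f t = laplace h t"
  shows "AE x in lborel. 0 < x \<longrightarrow> f x = h x"
proof -
  have "AE x in lborel. 0 < x \<longrightarrow> f x - h x = 0"
  proof (rule lerch)
    show "exp_integrable \<theta> (\<lambda>x. f x - h x)" using assms by (intro exp_integrable_diff)
    show "laplace (\<lambda>x. f x - h x) t = 0" if "\<theta> \<le> t" for t
      using exp_integrable_diff(2)[OF exp_integrable_mono[OF assms(1) that] exp_integrable_mono[OF assms(2) that]] assms(3)[OF that]
      by simp
  qed
  then show ?thesis by eventually_elim auto
qed

lemma tendsto_integral_dominated:
  fixes f :: "real \<Rightarrow> 'b \<Rightarrow> real" and g w :: "'b \<Rightarrow> real"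
  assumes meas: "\<And>t. t \<in> S \<Longrightarrow> f t \<in> borel_measurable M" "g \<in> borel_measurable M"
    and w: "integrable M w"
    and lim: "AE x in M. ((\<lambda>t. f t x) \<longlongrightarrow> g x) (at t0 within S)"
    and bound: "\<And>t. t \<in> S \<Longrightarrow> AE x in M. \<bar>f t x\<bar> \<le> w x"
  shows "((\<lambda>t. \<integral>x. f t x \<partial>M) \<longlongrightarrow> (\<integral>x. g x \<partial>M)) (at t0 within S)"
  unfolding tendsto_at_iff_sequentially comp_def
proof (intro allI impI)
  fix T :: "nat \<Rightarrow> real" assume T: "\<forall>i. T i \<in> S - {t0}" "T \<longlonglongrightarrow> t0"
  show "(\<lambda>i. \<integral>x. f (T i) x \<partial>M) \<longlonglongrightarrow> (\<integral>x. g x \<partial>M)"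
  proof (rule integral_dominated_convergence[OF meas(2) _ w])
    show "AE x in M. (\<lambda>i. f (T i) x) \<longlonglongrightarrow> g x"
      using lim by eventually_elim (use T in \<open>auto simp: tendsto_at_iff_sequentially comp_def\<close>)
  qed (use T in \<open>auto intro: meas bound\<close>)
qed

lemma exp_integrable_local:
  assumes "exp_integrable \<theta> f"
  shows "set_integrable lborel {0<..<b} f"
  unfolding set_integrable_def
proof (rule Bochner_Integration.integrable_bound)
  show "integrable lborel (\<lambda>x. exp (\<bar>\<theta>\<bar> * \<bar>b\<bar>) * (indicator {0<..} x *\<^sub>R (exp (- \<theta> * x) * f x)))"
    using assms by (simp add: exp_integrable_def set_integrable_def)
  have "(\<lambda>x. indicator {..<b} x * (indicator {0<..} x * f x)) \<in> borel_measurable lborel"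
    using exp_integrable_measurable[OF assms] by simp
  also have "(\<lambda>x. indicator {..<b} x * (indicator {0<..} x * f x)) = (\<lambda>x. indicator {0<..<b} x *\<^sub>R f x)"
    by (auto simp: fun_eq_iff indicator_def)
  finally show "(\<lambda>x. indicator {0<..<b} x *\<^sub>R f x) \<in> borel_measurable lborel" .
  show "AE x in lborel. norm (indicator {0<..<b} x *\<^sub>R f x)
    \<le> norm (exp (\<bar>\<theta>\<bar> * \<bar>b\<bar>) * (indicator {0<..} x *\<^sub>R (exp (- \<theta> * x) * f x)))"
  proof (rule AE_I2)
    fix x :: real
    show "norm (indicator {0<..<b} x *\<^sub>R f x)
      \<le> norm (exp (\<bar>\<theta>\<bar> * \<bar>b\<bar>) * (indicator {0<..} x *\<^sub>R (exp (- \<theta> * x) * f x)))"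
    proof (cases "0 < x \<and> x < b")
      case True
      have "\<theta> * x \<le> \<bar>\<theta>\<bar> * \<bar>b\<bar>" using True by (intro mult_mono) auto
      then have "1 \<le> exp (\<bar>\<theta>\<bar> * \<bar>b\<bar>) * exp (- \<theta> * x)" by (simp add: exp_add[symmetric])
      from mult_right_mono[OF this, of "\<bar>f x\<bar>"] show ?thesis using True by (simp add: abs_mult mult.assoc)
    qed auto
  qed
qed

text \<open>
  With the weight \<open>e\<^bsup>-\<theta>x\<^esup>\<close> absorbed into the factors and extension by zero to the whole line, this
  is Fubini together with translation invariance.
\<close>
lemma conv_laplace:
  assumes f: "exp_integrable \<theta> f" and h: "exp_integrable \<theta> h"
  shows "exp_integrable \<theta> (conv f h)" "laplace (conv f h) \<theta> = laplace f \<theta> * laplace h \<theta>"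
proof -
  define F where "F x = indicator {0<..} x * (exp (- \<theta> * x) * f x)" for x
  define H where "H x = indicator {0<..} x * (exp (- \<theta> * x) * h x)" for x
  have F: "integrable lborel F" and H: "integrable lborel H"
    using f h by (simp_all add: exp_integrable_def set_integrable_def F_def[abs_def] H_def[abs_def])
  have [measurable]: "F \<in> borel_measurable borel" "H \<in> borel_measurable borel"
    using F H by (auto dest: borel_measurable_integrable)
  have shift: "(\<integral>x. \<phi> (x - y) \<partial>lborel) = (\<integral>x. \<phi> x \<partial>lborel)" for \<phi> :: "real \<Rightarrow> real" and y
    using lborel_integral_real_affine[of 1 \<phi> "- y"] by simp
  have shift_int: "integrable lborel (\<lambda>x. F (x - y))" for y
    using lborel_integrable_real_affine[OF F, of 1 "- y"] by simp
  have G: "integrable (lborel \<Otimes>\<^sub>M lborel) (case_prod (\<lambda>y x. H y * F (x - y)))"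
  proof (rule lborel_pair.Fubini_integrable)
    show "case_prod (\<lambda>y x. H y * F (x - y)) \<in> borel_measurable (lborel \<Otimes>\<^sub>M lborel)" by measurable
    have "(\<integral>x. norm (H y * F (x - y)) \<partial>lborel) = \<bar>H y\<bar> * (\<integral>x. \<bar>F x\<bar> \<partial>lborel)" for y
      using shift[of "\<lambda>x. \<bar>F x\<bar>" y] by (simp add: abs_mult)
    then show "integrable lborel (\<lambda>y. \<integral>x. norm (case (y, x) of (y, x) \<Rightarrow> H y * F (x - y)) \<partial>lborel)"
      using H by simp
    show "AE y in lborel. integrable lborel (\<lambda>x. case (y, x) of (y, x) \<Rightarrow> H y * F (x - y))"
      using shift_int by simp
  qed
  have eq: "indicator {0<..} x *\<^sub>R (exp (- \<theta> * x) * conv f h x) = (\<integral>y. H y * F (x - y) \<partial>lborel)" for x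
  proof (cases "0 < x")
    case True
    have "(\<integral>y. H y * F (x - y) \<partial>lborel) = (\<integral>y. exp (- \<theta> * x) * (indicator {0<..<x} y *\<^sub>R (f (x - y) * h y)) \<partial>lborel)"
    proof (rule Bochner_Integration.integral_cong)
      fix y :: real
      have "exp (- \<theta> * y) * exp (- \<theta> * (x - y)) = exp (- \<theta> * x)"
        by (simp add: exp_add[symmetric] right_diff_distrib)
      then have "H y * F (x - y) = exp (- \<theta> * x) * (f (x - y) * h y)" if "0 < y" "y < x"
        using that by (simp add: F_def H_def)
      then show "H y * F (x - y) = exp (- \<theta> * x) * (indicator {0<..<x} y *\<^sub>R (f (x - y) * h y))"
        by (cases "0 < y \<and> y < x") (auto simp: F_def H_def)
    qed simp
    then show ?thesis using True by (simp add: conv_def set_lebesgue_integral_def)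
  next
    case False
    then have "(\<lambda>y. H y * F (x - y)) = (\<lambda>_. 0)" by (auto simp: F_def H_def indicator_def fun_eq_iff)
    then show ?thesis using False by simp
  qed
  show "exp_integrable \<theta> (conv f h)"
    unfolding exp_integrable_def set_integrable_def eq
    using lborel_pair.integrable_snd[OF G] .
  have "laplace (conv f h) \<theta> = (\<integral>x. (\<integral>y. H y * F (x - y) \<partial>lborel) \<partial>lborel)"
    unfolding laplace_def set_lebesgue_integral_def eq ..
  also have "\<dots> = (\<integral>y. (\<integral>x. H y * F (x - y) \<partial>lborel) \<partial>lborel)"
    using lborel_pair.Fubini_integral[OF G] .
  also have "\<dots> = (\<integral>y. H y * (\<integral>x. F x \<partial>lborel) \<partial>lborel)"
    using shift[of F] by simp
  also have "\<dots> = laplace f \<theta> * laplace h \<theta>"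
    by (simp add: laplace_def set_lebesgue_integral_def F_def[abs_def] H_def[abs_def])
  finally show "laplace (conv f h) \<theta> = laplace f \<theta> * laplace h \<theta>" .
qed

text \<open>
  The difference quotients of \<open>e\<^bsup>-\<theta>x\<^esup>\<close> are bounded by \<open>x e\<^bsup>-(\<theta>-\<eta>)x\<^esup>\<close>; half of the distance to
  \<open>\<theta>0\<close> is spent on the increment and the other half on the factor \<open>x\<close>.
\<close>
lemma has_derivative_laplace:
  assumes f: "exp_integrable \<theta>0 f" and less: "\<theta>0 < \<theta>"
  shows "(laplace f has_real_derivative - laplace (\<lambda>x. x * f x) \<theta>) (at \<theta>)"
proof -
  let ?d = "\<lambda>h x. (exp (- (\<theta> + h) * x) - exp (- \<theta> * x)) / h"
  define \<eta> where "\<eta> = (\<theta> - \<theta>0) / 2"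
  have \<eta>: "0 < \<eta>" "\<theta>0 < \<theta> - \<eta>" using less by (auto simp: \<eta>_def field_simps)
  define F where "F x = indicator {0<..} x * f x" for x
  have [measurable]: "F \<in> borel_measurable borel"
    using exp_integrable_measurable[OF f] by (simp add: F_def[abs_def])
  have E: "exp_integrable (\<theta> - \<eta>) (\<lambda>x. x * f x)" by (rule exp_integrable_times_x[OF f \<eta>(2)])
  have F_int: "integrable lborel (\<lambda>x. exp (- t * x) * F x)" if "\<theta>0 \<le> t" for t
    using exp_integrable_mono[OF f that] unfolding exp_integrable_def set_integrable_def
    by (simp add: F_def mult.left_commute)
  have lap: "laplace f t = (\<integral>x. exp (- t * x) * F x \<partial>lborel)" for t
    by (simp add: laplace_def set_lebesgue_integral_def F_def mult.left_commute)
  have "((\<lambda>h. \<integral>x. ?d h x * F x \<partial>lborel)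
      \<longlongrightarrow> (\<integral>x. - x * exp (- \<theta> * x) * F x \<partial>lborel)) (at 0 within {- \<eta><..<\<eta>})"
  proof (rule tendsto_integral_dominated)
    show "integrable lborel (\<lambda>x. exp (- (\<theta> - \<eta>) * x) * \<bar>x * F x\<bar>)"
      using integrable_norm[OF E[unfolded exp_integrable_def set_integrable_def]]
      by (simp add: F_def abs_mult mult_ac)
    show "AE x in lborel. ((\<lambda>h. ?d h x * F x)
        \<longlongrightarrow> - x * exp (- \<theta> * x) * F x) (at 0 within {- \<eta><..<\<eta>})"
    proof (rule AE_I2)
      fix x :: real
      have "((\<lambda>t. exp (- t * x)) has_real_derivative - x * exp (- \<theta> * x)) (at \<theta>)"
        by (auto intro!: derivative_eq_intros)
      then have "((\<lambda>h. ?d h x) \<longlongrightarrow> - x * exp (- \<theta> * x)) (at 0)"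
        unfolding DERIV_def .
      then have "((\<lambda>h. ?d h x * F x)
        \<longlongrightarrow> - x * exp (- \<theta> * x) * F x) (at 0)" by (rule tendsto_mult_right)
      then show "((\<lambda>h. ?d h x * F x)
        \<longlongrightarrow> - x * exp (- \<theta> * x) * F x) (at 0 within {- \<eta><..<\<eta>})"
        by (rule tendsto_within_subset) auto
    qed
    show "AE x in lborel. \<bar>?d h x * F x\<bar> \<le> exp (- (\<theta> - \<eta>) * x) * \<bar>x * F x\<bar>"
      if h: "h \<in> {- \<eta><..<\<eta>}" for h
    proof (rule AE_I2)
      fix x :: real
      show "\<bar>?d h x * F x\<bar> \<le> exp (- (\<theta> - \<eta>) * x) * \<bar>x * F x\<bar>"
      proof (cases "0 < x")
        case True
        have *: "\<bar>exp (- (\<theta> + h) * x) - exp (- \<theta> * x)\<bar> \<le> \<bar>x\<bar> * exp (- (\<theta> - \<eta>) * x) * \<bar>h\<bar>"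
        proof -
          have "norm (exp (- (\<theta> + h) * x) - exp (- \<theta> * x)) \<le> \<bar>x\<bar> * exp (- (\<theta> - \<eta>) * x) * norm ((\<theta> + h) - \<theta>)"
          proof (rule field_differentiable_bound[of "{\<theta> - \<eta>..\<theta> + \<eta>}" "\<lambda>t. exp (- t * x)" "\<lambda>t. - x * exp (- t * x)"])
            show "((\<lambda>t. exp (- t * x)) has_field_derivative - x * exp (- t * x)) (at t within {\<theta> - \<eta>..\<theta> + \<eta>})" for t
              by (auto intro!: derivative_eq_intros)
            show "norm (- x * exp (- t * x)) \<le> \<bar>x\<bar> * exp (- (\<theta> - \<eta>) * x)" if "t \<in> {\<theta> - \<eta>..\<theta> + \<eta>}" for t
            proof -
              have "- t * x \<le> - (\<theta> - \<eta>) * x" using that True by (intro mult_right_mono) auto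
              then have "exp (- t * x) \<le> exp (- (\<theta> - \<eta>) * x)" by simp
              then have "\<bar>x\<bar> * exp (- t * x) \<le> \<bar>x\<bar> * exp (- (\<theta> - \<eta>) * x)" by (rule mult_left_mono) simp
              then show ?thesis by (simp add: abs_mult)
            qed
          qed (use h \<eta> in auto)
          then show ?thesis by simp
        qed
        have "\<bar>?d h x\<bar> \<le> \<bar>x\<bar> * exp (- (\<theta> - \<eta>) * x)"
          using * by (cases "h = 0") (auto simp: field_simps abs_divide)
        from mult_right_mono[OF this, of "\<bar>F x\<bar>"] show ?thesis by (simp add: abs_mult mult_ac)
      qed (simp add: F_def)
    qed
  qed simp_all
  moreover have "\<forall>\<^sub>F h in at 0 within {- \<eta><..<\<eta>}. (\<integral>x. ?d h x * F x \<partial>lborel)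
      = (laplace f (\<theta> + h) - laplace f \<theta>) / h"
    unfolding eventually_at_filter
  proof (intro always_eventually allI impI)
    fix h :: real assume h: "h \<noteq> 0" "h \<in> {- \<eta><..<\<eta>}"
    have "(\<integral>x. ?d h x * F x \<partial>lborel)
      = (\<integral>x. (exp (- (\<theta> + h) * x) * F x - exp (- \<theta> * x) * F x) / h \<partial>lborel)"
      by (intro Bochner_Integration.integral_cong) (auto simp: field_simps)
    also have "\<dots> = (laplace f (\<theta> + h) - laplace f \<theta>) / h"
      using h \<eta> less unfolding lap integral_divide_zero
      by (subst Bochner_Integration.integral_diff[OF F_int F_int]) auto
    finally show "(\<integral>x. ?d h x * F x \<partial>lborel)
      = (laplace f (\<theta> + h) - laplace f \<theta>) / h" .
  qed
  ultimately have "((\<lambda>h. (laplace f (\<theta> + h) - laplace f \<theta>) / h)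
      \<longlongrightarrow> (\<integral>x. - x * exp (- \<theta> * x) * F x \<partial>lborel)) (at 0 within {- \<eta><..<\<eta>})"
    by (rule Lim_transform_eventually)
  moreover have "at 0 within {- \<eta><..<\<eta>} = at 0" using \<eta> by (intro at_within_open) auto
  moreover have "(\<integral>x. - x * exp (- \<theta> * x) * F x \<partial>lborel) = - laplace (\<lambda>x. x * f x) \<theta>"
    unfolding laplace_def set_lebesgue_integral_def integral_minus[symmetric]
    by (intro Bochner_Integration.integral_cong) (auto simp: F_def)
  ultimately show ?thesis unfolding DERIV_def by simp
qed

text \<open>
  Convolution with the constant \<open>1\<close> serves as the notation for the primitive that vanishes
  at \<open>0\<close>, so that the convolution theorem applies to it.
\<close>
lemma conv_one: "conv (\<lambda>_. 1) f x = (LBINT y:{0<..<x}. f y)"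
  by (simp add: conv_def)

lemma continuous_on_primitive:
  assumes f: "exp_integrable \<theta> f"
  shows "continuous_on {0..} (conv (\<lambda>_. 1) f)"
proof -
  have "continuous_on {0..b} (conv (\<lambda>_. 1) f)" for b
    unfolding continuous_on_def
  proof
    fix x assume x: "x \<in> {0..b}"
    have int: "integrable lborel (\<lambda>y. indicator {0<..<c} y *\<^sub>R f y)" for c
      using exp_integrable_local[OF f] by (simp add: set_integrable_def)
    show "(conv (\<lambda>_. 1) f \<longlongrightarrow> conv (\<lambda>_. 1) f x) (at x within {0..b})"
      unfolding conv_one[abs_def] set_lebesgue_integral_def
    proof (rule tendsto_integral_dominated)
      show "integrable lborel (\<lambda>y. \<bar>indicator {0<..<b} y *\<^sub>R f y\<bar>)" using int by (rule integrable_abs)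
      show "(\<lambda>y. indicator {0<..<t} y *\<^sub>R f y) \<in> borel_measurable lborel" for t
        using int by (rule borel_measurable_integrable)
      then show "(\<lambda>y. indicator {0<..<x} y *\<^sub>R f y) \<in> borel_measurable lborel" .
      show "AE y in lborel. \<bar>indicator {0<..<t} y *\<^sub>R f y\<bar> \<le> \<bar>indicator {0<..<b} y *\<^sub>R f y\<bar>" if "t \<in> {0..b}" for t
        using that by (intro AE_I2) (auto simp: indicator_def)
      show "AE y in lborel. ((\<lambda>t. indicator {0<..<t} y *\<^sub>R f y) \<longlongrightarrow> indicator {0<..<x} y *\<^sub>R f y) (at x within {0..b})"
        using AE_lborel_singleton[of x]
      proof eventually_elim
        fix y assume "y \<noteq> x"
        have "\<forall>\<^sub>F t in at x. indicator {0<..<t} y *\<^sub>R f y = indicator {0<..<x} y *\<^sub>R f y"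
        proof (cases "y < x")
          case True
          have "\<forall>\<^sub>F t in at x. y < t" using True by (rule order_tendstoD[OF tendsto_ident_at])
          then show ?thesis by (rule eventually_mono) (use True in \<open>auto simp: indicator_def\<close>)
        next
          case False
          with \<open>y \<noteq> x\<close> have "\<forall>\<^sub>F t in at x. t < y" by (intro order_tendstoD[OF tendsto_ident_at]) auto
          then show ?thesis by (rule eventually_mono) (use False in \<open>auto simp: indicator_def\<close>)
        qed
        from tendsto_eventually[OF this] show "((\<lambda>t. indicator {0<..<t} y *\<^sub>R f y) \<longlongrightarrow> indicator {0<..<x} y *\<^sub>R f y) (at x within {0..b})"
          by (rule tendsto_within_subset) auto
      qed
    qed
  qed
  note * = this
  show ?thesis
    unfolding continuous_on_eq_continuous_within
  proof
    fix x :: real assume x: "x \<in> {0..}"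
    have "continuous (at x within {0..x + 1}) (conv (\<lambda>_. 1) f)"
      using *[of "x + 1"] x by (auto simp: continuous_on_eq_continuous_within)
    moreover have "at x within {0..x + 1} = at x within {0..}"
      by (rule at_within_nhd[of _ "{..<x + 1}"]) (use x in auto)
    ultimately show "continuous (at x within {0..}) (conv (\<lambda>_. 1) f)" by (simp add: continuous_within)
  qed
qed

lemma primitive_diff:
  assumes f: "exp_integrable \<theta> f" and ab: "0 < a" "a \<le> b"
  shows "set_integrable lborel {a..b} f" "conv (\<lambda>_. 1) f b - conv (\<lambda>_. 1) f a = (LBINT y:{a..b}. f y)"
proof -
  have si: "set_integrable lborel {0<..<b + 1} f" by (rule exp_integrable_local[OF f])
  show iab: "set_integrable lborel {a..b} f"
    by (rule set_integrable_subset[OF si]) (use ab in auto)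
  have ia: "set_integrable lborel {0<..<a} f" by (rule exp_integrable_local[OF f])
  have "(LBINT y:{0<..<a} \<union> {a..b}. f y) = (LBINT y:{0<..<a}. f y) + (LBINT y:{a..b}. f y)"
    by (rule set_integral_Un[OF _ ia iab]) auto
  moreover have "(LBINT y:{0<..<b}. f y) = (LBINT y:{0<..<a} \<union> {a..b}. f y)"
  proof (rule set_integral_cong_set)
    show "AE x in lborel. (x \<in> {0<..<a} \<union> {a..b}) = (x \<in> {0<..<b})"
      using AE_lborel_singleton[of b] by eventually_elim (use ab in auto)
    show "set_borel_measurable lborel {0<..<b} f"
      using exp_integrable_local[OF f, of b] unfolding set_integrable_def set_borel_measurable_def by auto
    have "set_integrable lborel ({0<..<a} \<union> {a..b}) f" by (rule set_integrable_Un[OF ia iab]) auto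
    then show "set_borel_measurable lborel ({0<..<a} \<union> {a..b}) f"
      unfolding set_integrable_def set_borel_measurable_def by auto
  qed
  ultimately show "conv (\<lambda>_. 1) f b - conv (\<lambda>_. 1) f a = (LBINT y:{a..b}. f y)"
    by (simp add: conv_one)
qed

lemma has_derivative_primitive:
  assumes f: "exp_integrable \<theta> f" and c: "continuous_on {0<..} f" and x: "0 < x"
  shows "(conv (\<lambda>_. 1) f has_real_derivative f x) (at x)"
proof -
  define a b where "a = x / 2" and "b = x + 1"
  have ab: "0 < a" "a < x" "x < b" using x by (auto simp: a_def b_def)
  have "((\<lambda>z. integral {a..z} f) has_real_derivative f x) (at x within {a..b})"
    by (rule integral_has_real_derivative[OF continuous_on_subset[OF c]]) (use ab in auto)
  then have "((\<lambda>z. conv (\<lambda>_. 1) f a + integral {a..z} f) has_real_derivative f x) (at x within {a..b})"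
    by (auto intro!: derivative_eq_intros)
  then have "((\<lambda>z. conv (\<lambda>_. 1) f a + integral {a..z} f) has_real_derivative f x) (at x)"
    using at_within_Icc_at[OF ab(2,3)] by simp
  then show ?thesis
  proof (rule has_field_derivative_transform_within)
    show "0 < x - a" using ab by simp
    show "x \<in> UNIV" by simp
    fix z assume "dist z x < x - a"
    then have z: "a \<le> z" by (auto simp: dist_real_def)
    have "(LBINT y:{a..z}. f y) = integral {a..z} f"
      by (rule set_borel_integral_eq_integral) (rule primitive_diff(1)[OF f ab(1) z])
    then show "conv (\<lambda>_. 1) f a + integral {a..z} f = conv (\<lambda>_. 1) f z"
      using primitive_diff(2)[OF f ab(1) z] by simp
  qed
qed

lemma laplace_nonneg:
  assumes "\<And>x. 0 < x \<Longrightarrow> 0 \<le> f x"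
  shows "0 \<le> laplace f \<theta>"
  unfolding laplace_def set_lebesgue_integral_def
  using assms by (intro integral_nonneg_AE AE_I2) (auto simp: indicator_def)

lemma laplace_antimono:
  assumes "exp_integrable \<theta> f" "\<And>x. 0 < x \<Longrightarrow> 0 \<le> f x" "\<theta> \<le> \<theta>'"
  shows "laplace f \<theta>' \<le> laplace f \<theta>"
  unfolding laplace_def
proof (rule set_integral_mono)
  show "exp (- \<theta>' * x) * f x \<le> exp (- \<theta> * x) * f x" if "x \<in> {0<..}" for x
    using that assms by (intro mult_right_mono) auto
qed (use assms exp_integrable_mono[OF assms(1,3)] in \<open>auto simp: exp_integrable_def\<close>)

lemma laplace_tendsto_0:
  assumes f: "exp_integrable \<theta> f"
  shows "(laplace f \<longlongrightarrow> 0) at_top"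
proof -
  have F: "integrable lborel (\<lambda>x. indicator {0<..} x *\<^sub>R (exp (- \<theta> * x) * f x))"
    using f by (simp add: exp_integrable_def set_integrable_def)
  have "((\<lambda>t. \<integral>x. indicator {0<..} x *\<^sub>R (exp (- t * x) * f x) \<partial>lborel) \<longlongrightarrow> (integral\<^sup>L (lborel :: real measure) (\<lambda>_. 0))) at_top"
  proof (rule integral_dominated_convergence_at_top[where f = "\<lambda>x. 0 :: real" and s = "\<lambda>t x. indicator {0<..} x *\<^sub>R (exp (- t * x) * f x)" and M = lborel and w = "\<lambda>x. \<bar>indicator {0<..} x *\<^sub>R (exp (- \<theta> * x) * f x)\<bar>"])
    show "integrable lborel (\<lambda>x. \<bar>indicator {0<..} x *\<^sub>R (exp (- \<theta> * x) * f x)\<bar>)"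
      using F by (rule integrable_abs)
    show "(\<lambda>x. indicator {0<..} x *\<^sub>R (exp (- t * x) * f x)) \<in> borel_measurable lborel" for t
    proof -
      have "(\<lambda>x. exp (- t * x) * (indicator {0<..} x * f x)) \<in> borel_measurable lborel"
        using exp_integrable_measurable[OF f] by simp
      then show ?thesis by (simp add: mult.left_commute)
    qed
    show "\<forall>\<^sub>F t in at_top. AE x in lborel. norm (indicator {0<..} x *\<^sub>R (exp (- t * x) * f x))
        \<le> \<bar>indicator {0<..} x *\<^sub>R (exp (- \<theta> * x) * f x)\<bar>"
      using eventually_ge_at_top[of \<theta>]
      by eventually_elim (auto simp: abs_mult indicator_def intro!: mult_right_mono)
    show "AE x in lborel. ((\<lambda>t. indicator {0<..} x *\<^sub>R (exp (- t * x) * f x)) \<longlongrightarrow> 0) at_top"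
    proof (rule AE_I2)
      fix x :: real
      show "((\<lambda>t. indicator {0<..} x *\<^sub>R (exp (- t * x) * f x)) \<longlongrightarrow> 0) at_top"
      proof (cases "0 < x")
        case True
        have "((\<lambda>t. exp (- t * x)) \<longlongrightarrow> 0) at_top"
          using True by (intro filterlim_compose[OF exp_at_bot])
            (simp add: filterlim_uminus_at_bot filterlim_tendsto_pos_mult_at_top[OF tendsto_const _ filterlim_ident] mult.commute[of _ x])
        from tendsto_mult_right[OF this, of "f x"] show ?thesis using True by simp
      qed simp
    qed
  qed simp
  then show ?thesis by (simp add: laplace_def[abs_def] set_lebesgue_integral_def)
qed

text \<open>
  The renewal density is the Neumann series \<open>U = g + g*g + g*g*g + \<dots>\<close>. Its terms are nonnegative and
  their transforms form a geometric series, so it converges almost everywhere.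
\<close>
lemma renewal_density_exists:
  assumes g: "exp_integrable \<theta> g" and nonneg: "\<And>x. 0 < x \<Longrightarrow> 0 \<le> g x" and less: "laplace g \<theta> < 1"
  shows "\<exists>U. \<forall>t\<ge>\<theta>. exp_integrable t U \<and> laplace U t = laplace g t / (1 - laplace g t)"
proof -
  define G where "G k = (conv g ^^ k) g" for k
  have G: "exp_integrable t (G k) \<and> laplace (G k) t = laplace g t ^ Suc k" if "\<theta> \<le> t" for t k
    using exp_integrable_mono[OF g that] by (induction k) (auto simp: G_def conv_laplace)
  have G_nonneg: "0 < x \<Longrightarrow> 0 \<le> G k x" for k x
  proof (induction k arbitrary: x)
    case (Suc k)
    have "0 \<le> conv g (G k) x"
      unfolding conv_def set_lebesgue_integral_def
      using Suc nonneg by (intro integral_nonneg_AE AE_I2) (auto simp: indicator_def)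
    then show ?case by (simp add: G_def)
  qed (auto simp: G_def nonneg)
  define F where "F t k x = indicator {0<..} x *\<^sub>R (exp (- t * x) * G k x)" for t k x
  have F_nonneg: "0 \<le> F t k x" for t k x using G_nonneg by (auto simp: F_def indicator_def)
  have F_int: "integrable lborel (F t k)" "(\<integral>x. F t k x \<partial>lborel) = laplace g t ^ Suc k" if "\<theta> \<le> t" for t k
    using G[OF that, of k]
    by (auto simp: F_def[abs_def] exp_integrable_def laplace_def set_integrable_def set_lebesgue_integral_def)
  have [measurable]: "F t k \<in> borel_measurable borel" if "\<theta> \<le> t" for t :: real and k :: nat
    using F_int(1)[OF that, of k] by (auto dest: borel_measurable_integrable)
  have lap: "0 \<le> laplace g t" "laplace g t < 1" if "\<theta> \<le> t" for t
    using laplace_antimono[OF g nonneg that] less laplace_nonneg[where f = g and \<theta> = t] nonneg by auto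
  have sums: "(\<lambda>k. laplace g t ^ Suc k) sums (laplace g t / (1 - laplace g t))" if "\<theta> \<le> t" for t
    using sums_mult[OF geometric_sums[of "laplace g t"], of "laplace g t"] lap[OF that] by simp
  have AE_sum: "AE x in lborel. summable (\<lambda>k. F t k x)" if t: "\<theta> \<le> t" for t
  proof -
    have "(\<integral>\<^sup>+x. (\<Sum>k. ennreal (F t k x)) \<partial>lborel) = (\<Sum>k. \<integral>\<^sup>+x. ennreal (F t k x) \<partial>lborel)"
      using t by (intro nn_integral_suminf) auto
    also have "\<dots> = (\<Sum>k. ennreal (laplace g t ^ Suc k))"
      using F_int[OF t] F_nonneg by (subst nn_integral_eq_integral) auto
    finally have eq: "(\<integral>\<^sup>+x. (\<Sum>k. ennreal (F t k x)) \<partial>lborel) = (\<Sum>k. ennreal (laplace g t ^ Suc k))" .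
    have "(\<integral>\<^sup>+x. (\<Sum>k. ennreal (F t k x)) \<partial>lborel) \<noteq> \<infinity>"
      unfolding eq infinity_ennreal_def
      by (rule ennreal_suminf_neq_top[OF sums_summable[OF sums[OF t]]]) (use lap[OF t] in simp)
    then have "AE x in lborel. (\<Sum>k. ennreal (F t k x)) \<noteq> \<infinity>"
      using t by (intro nn_integral_PInf_AE) auto
    then show ?thesis by eventually_elim (auto intro!: summable_suminf_not_top F_nonneg)
  qed
  define U where "U x = (\<Sum>k. G k x)" for x
  show ?thesis
  proof (intro exI[of _ U] allI impI)
    fix t assume t: "\<theta> \<le> t"
    have norm_sum: "summable (\<lambda>k. \<integral>x. norm (F t k x) \<partial>lborel)"
      using F_nonneg F_int(2)[OF t] sums_summable[OF sums[OF t]] by simp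
    have AE: "AE x in lborel. summable (\<lambda>k. norm (F t k x))" using AE_sum[OF t] F_nonneg by simp
    have eq: "(\<Sum>k. F t k x) = indicator {0<..} x *\<^sub>R (exp (- t * x) * U x)" if s: "summable (\<lambda>k. F t k x)" for x
    proof (cases "0 < x")
      case True
      have "summable (\<lambda>k. exp (t * x) * F t k x)" using s by (rule summable_mult)
      then have "summable (\<lambda>k. G k x)" using True by (simp add: F_def exp_minus)
      then show ?thesis using True by (simp add: F_def U_def suminf_mult)
    qed (simp add: F_def)
    have AE_eq: "AE x in lborel. (\<Sum>k. F t k x) = indicator {0<..} x *\<^sub>R (exp (- t * x) * U x)"
      using AE_sum[OF t] by eventually_elim (rule eq)
    have Ui: "integrable lborel (\<lambda>x. \<Sum>k. F t k x)" by (rule integrable_suminf[OF F_int(1)[OF t] AE norm_sum])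
    have Um: "(\<lambda>x. indicator {0<..} x *\<^sub>R (exp (- t * x) * U x)) \<in> borel_measurable lborel"
    proof -
      have [measurable]: "(\<lambda>x. indicator {0<..} x * G k x) \<in> borel_measurable borel" for k
        using G[OF t, of k] exp_integrable_measurable by blast
      have "(\<lambda>x. exp (- t * x) * (\<Sum>k. indicator {0<..} x * G k x)) \<in> borel_measurable borel" by measurable
      also have "(\<lambda>x. exp (- t * x) * (\<Sum>k. indicator {0<..} x * G k x)) = (\<lambda>x. indicator {0<..} x *\<^sub>R (exp (- t * x) * U x))"
        by (auto simp: fun_eq_iff U_def indicator_def)
      finally show ?thesis by simp
    qed
    have "integrable lborel (\<lambda>x. indicator {0<..} x *\<^sub>R (exp (- t * x) * U x))"
      using integrable_cong_AE[OF borel_measurable_integrable[OF Ui] Um AE_eq] Ui by simp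
    moreover have "laplace U t = (\<integral>x. (\<Sum>k. F t k x) \<partial>lborel)"
      using integral_cong_AE[OF borel_measurable_integrable[OF Ui] Um AE_eq] by (simp add: laplace_def set_lebesgue_integral_def)
    moreover have "(\<lambda>k. \<integral>x. F t k x \<partial>lborel) sums (\<integral>x. (\<Sum>k. F t k x) \<partial>lborel)"
      by (rule sums_integral[OF F_int(1)[OF t] AE norm_sum])
    ultimately show "exp_integrable t U \<and> laplace U t = laplace g t / (1 - laplace g t)"
      using sums_unique2[OF sums[OF t]] F_int(2)[OF t] by (auto simp: exp_integrable_def set_integrable_def)
  qed
qed

section \<open>Functions of class \<open>C\<^sup>k\<close> and their convolutions\<close>

lemma C_k_on_0: "C_k_on 0 f S \<longleftrightarrow> continuous_on S f"
  by (simp add: C_k_on_def)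

lemma C_k_on_Suc: "C_k_on (Suc k) f S \<longleftrightarrow> f differentiable_on S \<and> C_k_on k (deriv f) S"
proof -
  have "(deriv ^^ Suc i) f = (deriv ^^ i) (deriv f)" for i by (simp only: funpow_Suc_right comp_apply)
  then show ?thesis unfolding C_k_on_def All_less_Suc2 by (simp del: funpow.simps(2))
qed

lemma has_real_derivative_deriv:
  fixes f :: "real \<Rightarrow> real"
  assumes "open S" "f differentiable_on S" "x \<in> S"
  shows "(f has_real_derivative deriv f x) (at x)"
  using assms differentiable_on_eq_differentiable_at real_differentiableE DERIV_imp_deriv
  by (metis DERIV_deriv_iff_real_differentiable)

lemma C_k_on_SucD:
  assumes "open S" "C_k_on (Suc k) f S"
  shows "\<And>x. x \<in> S \<Longrightarrow> (f has_real_derivative deriv f x) (at x)" "C_k_on k (deriv f) S"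
  using assms has_real_derivative_deriv[of S f] by (auto simp: C_k_on_Suc)

lemma C_k_on_cong:
  assumes S: "open S" and eq: "\<And>x. x \<in> S \<Longrightarrow> f x = g x" and f: "C_k_on k f S"
  shows "C_k_on k g S"
  using eq f
proof (induction k arbitrary: f g)
  case 0
  then show ?case using continuous_on_cong[of S S f g] by (auto simp: C_k_on_0)
next
  case (Suc k)
  have d: "(g has_real_derivative deriv f x) (at x)" if x: "x \<in> S" for x
    by (rule has_field_derivative_transform_within_open[OF C_k_on_SucD(1)[OF S Suc.prems(2) x] S x Suc.prems(1)])
  have "C_k_on k (deriv g) S"
    by (rule Suc.IH[OF _ C_k_on_SucD(2)[OF S Suc.prems(2)]]) (simp add: DERIV_imp_deriv[OF d])
  moreover have "g differentiable_on S"
    using d by (auto simp: differentiable_on_def real_differentiable_def intro: has_field_derivative_at_within)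
  ultimately show ?case by (simp add: C_k_on_Suc)
qed

text \<open>
  Together with \<open>C_k_on_SucD\<close> this turns statements about iterated derivatives into inductions
  on \<open>k\<close> that mention a single derivative.
\<close>
lemma C_k_on_SucI:
  assumes S: "open S" and d: "\<And>x. x \<in> S \<Longrightarrow> (f has_real_derivative f' x) (at x)" and f': "C_k_on k f' S"
  shows "C_k_on (Suc k) f S"
proof -
  have "C_k_on k (deriv f) S"
    by (rule C_k_on_cong[OF S _ f']) (simp add: DERIV_imp_deriv[OF d])
  moreover have "f differentiable_on S"
    using d by (auto simp: differentiable_on_def real_differentiable_def intro: has_field_derivative_at_within)
  ultimately show ?thesis by (simp add: C_k_on_Suc)
qed

lemma C_k_on_lower:
  assumes S: "open S" and "C_k_on (Suc k) f S"
  shows "C_k_on k f S"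
  using assms(2)
proof (induction k arbitrary: f)
  case 0
  then show ?case using differentiable_imp_continuous_on by (auto simp: C_k_on_Suc C_k_on_0)
next
  case (Suc k)
  have "C_k_on k (deriv f) S" using Suc.IH[OF C_k_on_SucD(2)[OF S Suc.prems]] .
  then show ?case using Suc.prems by (simp add: C_k_on_Suc)
qed

lemma C_k_on_le:
  assumes S: "open S" and "C_k_on k f S" "m \<le> k"
  shows "C_k_on m f S"
  using assms(3,2) by (induction k rule: dec_induct) (auto dest: C_k_on_lower[OF S])

lemma C_k_on_imp_continuous_on: "open S \<Longrightarrow> C_k_on k f S \<Longrightarrow> continuous_on S f"
  using C_k_on_le[of S k f 0] by (simp add: C_k_on_0)

lemma C_k_on_const: "open S \<Longrightarrow> C_k_on k (\<lambda>_. c) S"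
proof (induction k arbitrary: c)
  case (Suc k)
  show ?case by (rule C_k_on_SucI[OF Suc.prems _ Suc.IH[OF Suc.prems]]) (rule DERIV_const)
qed (simp add: C_k_on_0)

lemma C_k_on_ident: "open S \<Longrightarrow> C_k_on k (\<lambda>x. x) S"
proof (induction k)
  case (Suc k)
  show ?case by (rule C_k_on_SucI[OF Suc.prems _ C_k_on_const[OF Suc.prems]]) (rule DERIV_ident)
qed (simp add: C_k_on_0)

lemma C_k_on_add:
  assumes S: "open S" and "C_k_on k f S" "C_k_on k g S"
  shows "C_k_on k (\<lambda>x. f x + g x) S"
  using assms(2,3)
proof (induction k arbitrary: f g)
  case (Suc k)
  note f = C_k_on_SucD[OF S Suc.prems(1)] and g = C_k_on_SucD[OF S Suc.prems(2)]
  show ?case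
    by (rule C_k_on_SucI[OF S DERIV_add[OF f(1) g(1)] Suc.IH[OF f(2) g(2)]])
qed (auto simp: C_k_on_0 intro: continuous_intros)

lemma C_k_on_mult:
  assumes S: "open S" and "C_k_on k f S" "C_k_on k g S"
  shows "C_k_on k (\<lambda>x. f x * g x) S"
  using assms(2,3)
proof (induction k arbitrary: f g)
  case (Suc k)
  note f = C_k_on_SucD[OF S Suc.prems(1)] and g = C_k_on_SucD[OF S Suc.prems(2)]
  show ?case
    by (rule C_k_on_SucI[OF S DERIV_mult[OF f(1) g(1)]
          C_k_on_add[OF S Suc.IH[OF f(2) C_k_on_lower[OF S Suc.prems(2)]] Suc.IH[OF g(2) C_k_on_lower[OF S Suc.prems(1)]]]])
qed (auto simp: C_k_on_0 intro: continuous_intros)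

lemma C_k_on_cmult: "open S \<Longrightarrow> C_k_on k f S \<Longrightarrow> C_k_on k (\<lambda>x. c * f x) S"
  by (intro C_k_on_mult C_k_on_const)

lemma C_k_on_diff:
  assumes S: "open S" and "C_k_on k f S" "C_k_on k g S"
  shows "C_k_on k (\<lambda>x. f x - g x) S"
  using C_k_on_add[OF S assms(2) C_k_on_cmult[OF S assms(3), of "- 1"]] by simp

lemma C_k_on_inverse: "C_k_on k (\<lambda>x::real. 1 / x) {0<..}"
proof (induction k)
  case 0
  show ?case by (auto simp: C_k_on_0 intro!: continuous_intros)
next
  case (Suc k)
  show ?case
  proof (rule C_k_on_SucI)
    show "C_k_on k (\<lambda>x::real. - 1 * (1 / x * (1 / x))) {0<..}"
      by (intro C_k_on_cmult C_k_on_mult Suc.IH) auto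
    show "((\<lambda>x. 1 / x) has_real_derivative - 1 * (1 / x * (1 / x))) (at x)" if "x \<in> {0<..}" for x :: real
      using that by (auto intro!: derivative_eq_intros simp: power2_eq_square)
  qed simp
qed

lemma C_k_on_half: "C_k_on k f {0<..} \<Longrightarrow> C_k_on k (\<lambda>x. f (x / 2)) {0<..}"
proof (induction k arbitrary: f)
  case 0
  then show ?case unfolding C_k_on_0
    by (rule continuous_on_compose2) (auto intro!: continuous_intros)
next
  case (Suc k)
  note f = C_k_on_SucD[OF open_greaterThan Suc.prems]
  show ?case
  proof (rule C_k_on_SucI)
    show "C_k_on k (\<lambda>x. 1 / 2 * deriv f (x / 2)) {0<..}"
      by (intro C_k_on_cmult Suc.IH f(2)) auto
    fix x :: real assume "x \<in> {0<..}"
    then have "(f has_real_derivative deriv f (x / 2)) (at (x / 2))" by (intro f(1)) auto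
    then have "((\<lambda>x. f (x / 2)) has_real_derivative deriv f (x / 2) * (1 / 2)) (at x)"
      by (rule DERIV_chain2) (auto intro!: derivative_eq_intros)
    then show "((\<lambda>x. f (x / 2)) has_real_derivative 1 / 2 * deriv f (x / 2)) (at x)"
      by (simp add: mult.commute)
  qed simp
qed

text \<open>
  The lower half of a convolution integral. Here \<open>f\<close> is evaluated only on \<open>(x/2, x)\<close>, away from its
  possible singularity at \<open>0\<close>, and the singularity of \<open>h\<close> is not moved by \<open>x\<close>. The other half of
  \<open>f * h\<close> is the same expression with the two factors exchanged.
\<close>
definition half_conv :: "(real \<Rightarrow> real) \<Rightarrow> (real \<Rightarrow> real) \<Rightarrow> real \<Rightarrow> real" where
  "half_conv f h x = (LBINT y:{0<..<x / 2}. f (x - y) * h y)"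

lemma bounded_on_Icc:
  fixes f :: "real \<Rightarrow> real"
  assumes "continuous_on {0<..} f" "0 < lo"
  obtains B where "0 \<le> B" "\<And>z. lo \<le> z \<Longrightarrow> z \<le> hi \<Longrightarrow> \<bar>f z\<bar> \<le> B"
proof -
  have "bounded (f ` {lo..hi})"
    by (intro compact_imp_bounded compact_continuous_image continuous_on_subset[OF assms(1)]) (use assms(2) in auto)
  then obtain B where "\<forall>z\<in>{lo..hi}. \<bar>f z\<bar> \<le> B" unfolding bounded_iff by fastforce
  then show ?thesis by (intro that[of "\<bar>B\<bar>"]) force+
qed

lemma measurable_truncated_product:
  fixes f h :: "real \<Rightarrow> real"
  assumes f: "continuous_on {0<..} f" and h: "\<And>b. set_integrable lborel {0<..<b} h"
    and A: "A \<in> sets borel" "A \<subseteq> {0<..<b}" "\<And>y. y \<in> A \<Longrightarrow> y < x"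
  shows "(\<lambda>y. indicator A y * (f (x - y) * h y)) \<in> borel_measurable borel"
proof -
  have [measurable]: "(\<lambda>x. indicator {0<..} x *\<^sub>R f x) \<in> borel_measurable borel"
    using f by (intro borel_measurable_continuous_on_indicator) auto
  have [measurable]: "(\<lambda>y. indicator {0<..<b} y *\<^sub>R h y) \<in> borel_measurable borel"
    using h[of b] unfolding set_integrable_def by (auto dest: borel_measurable_integrable)
  have "(\<lambda>y. indicator A y * ((indicator {0<..} (x - y) *\<^sub>R f (x - y)) * (indicator {0<..<b} y *\<^sub>R h y))) \<in> borel_measurable borel"
    using A(1) by measurable
  also have "(\<lambda>y. indicator A y * ((indicator {0<..} (x - y) *\<^sub>R f (x - y)) * (indicator {0<..<b} y *\<^sub>R h y)))
     = (\<lambda>y. indicator A y * (f (x - y) * h y))"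
    using A(2,3) by (fastforce simp: indicator_def)
  finally show ?thesis .
qed

lemma integrable_truncated_product:
  fixes f h :: "real \<Rightarrow> real"
  assumes f: "continuous_on {0<..} f" and h: "\<And>b. set_integrable lborel {0<..<b} h"
    and A: "A \<in> sets borel" "A \<subseteq> {0<..<b}" "\<And>y. y \<in> A \<Longrightarrow> lo \<le> x - y" "0 < lo"
  shows "integrable lborel (\<lambda>y. indicator A y * (f (x - y) * h y))"
proof -
  obtain B where B: "0 \<le> B" "\<And>z. lo \<le> z \<Longrightarrow> z \<le> x \<Longrightarrow> \<bar>f z\<bar> \<le> B" using bounded_on_Icc[OF f A(4)] by blast
  show ?thesis
  proof (rule Bochner_Integration.integrable_bound)
    show "integrable lborel (\<lambda>y. B * (indicator {0<..<b} y *\<^sub>R h y))"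
      using h[of b] by (simp add: set_integrable_def)
    show "(\<lambda>y. indicator A y * (f (x - y) * h y)) \<in> borel_measurable lborel"
      using measurable_truncated_product[OF f h A(1,2), of x] A(3,4) by force
    show "AE y in lborel. norm (indicator A y * (f (x - y) * h y)) \<le> norm (B * (indicator {0<..<b} y *\<^sub>R h y))"
    proof (rule AE_I2)
      fix y
      show "norm (indicator A y * (f (x - y) * h y)) \<le> norm (B * (indicator {0<..<b} y *\<^sub>R h y))"
      proof (cases "y \<in> A")
        case True
        then have "\<bar>f (x - y)\<bar> \<le> B" using A(2,3) by (intro B(2)) force+
        then show ?thesis using True A(2) B(1) by (auto simp: abs_mult indicator_def intro!: mult_right_mono)
      qed simp
    qed
  qed
qed

lemma continuous_on_half_conv:
  assumes f: "continuous_on {0<..} f" and h: "\<And>b. set_integrable lborel {0<..<b} h"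
  shows "continuous_on {0<..} (half_conv f h)"
  unfolding continuous_on_eq_continuous_at[OF open_greaterThan] isCont_def
proof
  let ?k = "\<lambda>x y. indicator {0<..<x / 2} y * (f (x - y) * h y)"
  fix x0 :: real assume "x0 \<in> {0<..}"
  then have x0: "0 < x0" by simp
  define S where "S = {x0 / 2<..<2 * x0}"
  obtain B where B: "0 \<le> B" "\<And>z. x0 / 4 \<le> z \<Longrightarrow> z \<le> 2 * x0 \<Longrightarrow> \<bar>f z\<bar> \<le> B"
    using bounded_on_Icc[OF f, of "x0 / 4" "2 * x0"] x0 by auto
  have "((\<lambda>x. \<integral>y. ?k x y \<partial>lborel) \<longlongrightarrow>
     (\<integral>y. ?k x0 y \<partial>lborel)) (at x0 within S)"
  proof (rule tendsto_integral_dominated)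
    have m: "(\<lambda>y. ?k x y) \<in> borel_measurable lborel" if "0 < x" for x
      using measurable_truncated_product[OF f h, of "{0<..<x / 2}" "x / 2" x] that by simp
    then show "(\<lambda>y. ?k x0 y) \<in> borel_measurable lborel" using x0 .
    show "(\<lambda>y. ?k x y) \<in> borel_measurable lborel" if "x \<in> S" for x
      using that x0 by (intro m) (auto simp: S_def)
    show "integrable lborel (\<lambda>y. B * \<bar>indicator {0<..<x0} y *\<^sub>R h y\<bar>)"
      using h[of x0] unfolding set_integrable_def by auto
    show "AE y in lborel. \<bar>?k x y\<bar> \<le> B * \<bar>indicator {0<..<x0} y *\<^sub>R h y\<bar>"
      if x: "x \<in> S" for x
    proof (rule AE_I2)
      fix y
      show "\<bar>?k x y\<bar> \<le> B * \<bar>indicator {0<..<x0} y *\<^sub>R h y\<bar>"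
      proof (cases "0 < y \<and> y < x / 2")
        case True
        then have "\<bar>f (x - y)\<bar> \<le> B" using x by (intro B(2)) (auto simp: S_def)
        then show ?thesis using True x by (auto simp: S_def abs_mult indicator_def intro!: mult_right_mono)
      qed (use B in auto)
    qed
    show "AE y in lborel. ((\<lambda>x. ?k x y) \<longlongrightarrow>
        ?k x0 y) (at x0 within S)"
      using AE_lborel_singleton[of "x0 / 2"]
    proof eventually_elim
      fix y assume y: "y \<noteq> x0 / 2"
      have half: "((\<lambda>x. x / 2) \<longlongrightarrow> x0 / 2) (at x0)" by (intro tendsto_intros) auto
      show "((\<lambda>x. ?k x y) \<longlongrightarrow>
        ?k x0 y) (at x0 within S)"
      proof (rule tendsto_within_subset[OF _ subset_UNIV], cases "y < x0 / 2")
        case True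
        show "((\<lambda>x. ?k x y) \<longlongrightarrow>
          ?k x0 y) (at x0)"
        proof (cases "0 < y")
          case y0: True
          have "isCont f (x0 - y)"
            using f True x0 by (auto simp: continuous_on_eq_continuous_at)
          then have "((\<lambda>x. f (x - y)) \<longlongrightarrow> f (x0 - y)) (at x0)"
            by (rule isCont_tendsto_compose) (auto intro!: tendsto_intros)
          then have "((\<lambda>x. f (x - y) * h y) \<longlongrightarrow> f (x0 - y) * h y) (at x0)" by (rule tendsto_mult_right)
          moreover have "\<forall>\<^sub>F x in at x0. f (x - y) * h y = ?k x y"
            using order_tendstoD(1)[OF half True] by eventually_elim (use y0 in auto)
          ultimately have "((\<lambda>x. ?k x y) \<longlongrightarrow> f (x0 - y) * h y) (at x0)"
            by (rule Lim_transform_eventually)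
          then show ?thesis using True y0 by simp
        qed simp
      next
        case False
        with y have "x0 / 2 < y" by simp
        have "\<forall>\<^sub>F x in at x0. ?k x y = ?k x0 y"
          using order_tendstoD(2)[OF half \<open>x0 / 2 < y\<close>] by eventually_elim (use \<open>x0 / 2 < y\<close> in auto)
        then show "((\<lambda>x. ?k x y) \<longlongrightarrow>
          ?k x0 y) (at x0)" by (rule tendsto_eventually)
      qed
    qed
  qed
  moreover have "at x0 within S = at x0" using x0 by (intro at_within_open) (auto simp: S_def)
  ultimately show "half_conv f h \<midarrow>x0\<rightarrow> half_conv f h x0"
    by (simp add: half_conv_def[abs_def] set_lebesgue_integral_def)
qed

text \<open>
  Leibniz rule: the moving endpoint \<open>x/2\<close> contributes the boundary term, and only \<open>f\<close> is
  differentiated. The difference quotient splits accordingly into an integral over the fixed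
  interval \<open>(0, x0/2)\<close> and one over the short interval between \<open>x0/2\<close> and \<open>(x0+t)/2\<close>; the latter is
  rescaled by \<open>y = x0/2 + t u\<close> to the fixed interval \<open>(0, 1/2)\<close>, for either sign of \<open>t\<close>. Both limits
  are then instances of dominated convergence.
\<close>
lemma has_derivative_half_conv:
  assumes f: "\<And>x. 0 < x \<Longrightarrow> (f has_real_derivative f' x) (at x)" and f': "continuous_on {0<..} f'"
    and hc: "continuous_on {0<..} h" and h: "\<And>b. set_integrable lborel {0<..<b} h" and x0: "0 < x0"
  shows "(half_conv f h has_real_derivative (1 / 2 * (f (x0 / 2) * h (x0 / 2)) + half_conv f' h x0)) (at x0)"
proof -
  have fc: "continuous_on {0<..} f"
    unfolding continuous_on_eq_continuous_at[OF open_greaterThan] using f by (auto intro: DERIV_isCont)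
  \<comment> \<open>For these increments every argument of \<open>f\<close> and \<open>f'\<close> stays in \<open>[x0/4, 2 x0]\<close>.\<close>
  define S where "S = {- (x0 / 4)<..<x0 / 4}"
  obtain B where B: "0 \<le> B" "\<And>z. x0 / 4 \<le> z \<Longrightarrow> z \<le> 2 * x0 \<Longrightarrow> \<bar>f' z\<bar> \<le> B"
    using bounded_on_Icc[OF f', of "x0 / 4" "2 * x0"] x0 by auto
  obtain C where C: "0 \<le> C" "\<And>z. x0 / 4 \<le> z \<Longrightarrow> z \<le> 2 * x0 \<Longrightarrow> \<bar>f z\<bar> \<le> C"
    using bounded_on_Icc[OF fc, of "x0 / 4" "2 * x0"] x0 by auto
  obtain D where D: "0 \<le> D" "\<And>z. x0 / 4 \<le> z \<Longrightarrow> z \<le> 2 * x0 \<Longrightarrow> \<bar>h z\<bar> \<le> D"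
    using bounded_on_Icc[OF hc, of "x0 / 4" "2 * x0"] x0 by auto
  let ?I = "indicator {0<..<x0 / 2} :: real \<Rightarrow> real"
  let ?J = "indicator {0<..<1 / 2 :: real} :: real \<Rightarrow> real"
  let ?P = "\<lambda>t u. f (x0 / 2 + t * (1 - u)) * h (x0 / 2 + t * u)"
  let ?Q = "\<lambda>t y. (f (x0 + t - y) - f (x0 - y)) / t * h y"
  let ?R = "\<lambda>t y. f (x0 + t - y) * h y"
  have lim1: "((\<lambda>t. \<integral>y. ?I y * ?Q t y \<partial>lborel) \<longlongrightarrow>
     (\<integral>y. ?I y * (f' (x0 - y) * h y) \<partial>lborel)) (at 0 within S)"
  proof (rule tendsto_integral_dominated)
    have m: "(\<lambda>y. ?I y * ?R t y) \<in> borel_measurable lborel" if "t \<in> S" for t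
      using measurable_truncated_product[OF fc h, of "{0<..<x0 / 2}" "x0 / 2" "x0 + t"] that by (simp add: S_def)
    have "0 \<in> S" using x0 by (simp add: S_def)
    from m[OF this] have m0: "(\<lambda>y. ?I y * (f (x0 - y) * h y)) \<in> borel_measurable lborel" by simp
    show "(\<lambda>y. ?I y * ?Q t y) \<in> borel_measurable lborel" if "t \<in> S" for t
    proof -
      have "(\<lambda>y. (?I y * ?R t y - ?I y * (f (x0 - y) * h y)) / t) \<in> borel_measurable lborel"
        using m[OF that] m0 by simp
      also have "(\<lambda>y. (?I y * ?R t y - ?I y * (f (x0 - y) * h y)) / t)
        = (\<lambda>y. ?I y * ?Q t y)"
        by (auto simp: fun_eq_iff algebra_simps diff_divide_distrib)
      finally show ?thesis .
    qed
    show "(\<lambda>y. ?I y * (f' (x0 - y) * h y)) \<in> borel_measurable lborel"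
      using measurable_truncated_product[OF f' h, of "{0<..<x0 / 2}" "x0 / 2" x0] x0 by simp
    show "integrable lborel (\<lambda>y. B * \<bar>?I y *\<^sub>R h y\<bar>)"
      using h[of "x0 / 2"] unfolding set_integrable_def by auto
    show "AE y in lborel. \<bar>?I y * ?Q t y\<bar> \<le> B * \<bar>?I y *\<^sub>R h y\<bar>"
      if t: "t \<in> S" for t
    proof (rule AE_I2)
      fix y
      show "\<bar>?I y * ?Q t y\<bar> \<le> B * \<bar>?I y *\<^sub>R h y\<bar>"
      proof (cases "0 < y \<and> y < x0 / 2")
        case True
        have "norm (f (x0 + t - y) - f (x0 - y)) \<le> B * norm ((x0 + t - y) - (x0 - y))"
        proof (rule field_differentiable_bound[of "{x0 / 4..2 * x0}" f f'])
          show "(f has_field_derivative f' z) (at z within {x0 / 4..2 * x0})" if "z \<in> {x0 / 4..2 * x0}" for z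
            using that x0 by (intro DERIV_subset[OF f]) auto
        qed (use True t x0 B in \<open>auto simp: S_def\<close>)
        then have "\<bar>(f (x0 + t - y) - f (x0 - y)) / t\<bar> \<le> B"
          using B(1) by (cases "t = 0") (auto simp: abs_divide divide_le_eq)
        from mult_right_mono[OF this, of "\<bar>h y\<bar>"] show ?thesis using True by (simp add: abs_mult)
      qed (use B in auto)
    qed
    show "AE y in lborel. ((\<lambda>t. ?I y * ?Q t y) \<longlongrightarrow> ?I y * (f' (x0 - y) * h y)) (at 0 within S)"
    proof (rule AE_I2, rule tendsto_within_subset[OF _ subset_UNIV])
      fix y
      show "((\<lambda>t. ?I y * ?Q t y) \<longlongrightarrow> ?I y * (f' (x0 - y) * h y)) (at 0)"
      proof (cases "0 < y \<and> y < x0 / 2")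
        case True
        then have "(f has_real_derivative f' (x0 - y)) (at (x0 - y))" using x0 by (intro f) auto
        then have "((\<lambda>t. (f (x0 - y + t) - f (x0 - y)) / t) \<longlongrightarrow> f' (x0 - y)) (at 0)" unfolding DERIV_def .
        then show ?thesis by (intro tendsto_mult tendsto_const) (simp add: algebra_simps)
      qed auto
    qed
  qed
  have range: "x0 / 4 \<le> x0 / 2 + t * v" "x0 / 2 + t * v \<le> 2 * x0" if "t \<in> S" "0 \<le> v" "v \<le> 1" for t v
  proof -
    have "\<bar>t * v\<bar> \<le> x0 / 4 * 1" unfolding abs_mult using that x0 by (intro mult_mono) (auto simp: S_def)
    then show "x0 / 4 \<le> x0 / 2 + t * v" "x0 / 2 + t * v \<le> 2 * x0" using x0 by linarith+
  qed
  have P_meas: "(\<lambda>u. ?J u * ?P t u) \<in> borel_measurable lborel" if t: "t \<in> S" for t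
  proof -
    have "(\<lambda>u. ?J u *\<^sub>R ?P t u) \<in> borel_measurable borel"
    proof (intro borel_measurable_continuous_on_indicator continuous_intros)
      have "0 < x0 / 2 + t * v" if "0 \<le> v" "v \<le> 1" for v
        using range(1)[OF t that] x0 by linarith
      then show "continuous_on {0<..<1/2} (\<lambda>u. f (x0 / 2 + t * (1 - u)))" "continuous_on {0<..<1/2} (\<lambda>u. h (x0 / 2 + t * u))"
        by (auto intro!: continuous_intros continuous_on_compose2[OF fc] continuous_on_compose2[OF hc])
    qed simp
    then show ?thesis by simp
  qed
  have lim2: "((\<lambda>t. \<integral>u. ?J u * ?P t u \<partial>lborel) \<longlongrightarrow>
     (\<integral>u. ?J u * (f (x0 / 2) * h (x0 / 2)) \<partial>lborel)) (at 0 within S)"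
  proof (rule tendsto_integral_dominated)
    show "(\<lambda>u. ?J u * ?P t u) \<in> borel_measurable lborel" if "t \<in> S" for t
      using that by (rule P_meas)
    show "(\<lambda>u. ?J u * (f (x0 / 2) * h (x0 / 2))) \<in> borel_measurable lborel" by simp
    show "integrable lborel (\<lambda>u. ?J u * (C * D))"
    proof (intro integrable_mult_left integrable_real_indicator)
      show "emeasure lborel {0<..<1 / 2 :: real} < \<infinity>"
        by (subst emeasure_lborel_Ioo) (simp, simp only: ennreal_less_top infinity_ennreal_def)
    qed simp
    show "AE u in lborel. \<bar>?J u * ?P t u\<bar> \<le> ?J u * (C * D)" if t: "t \<in> S" for t
      using C D range[OF t] by (intro AE_I2) (auto simp: indicator_def abs_mult intro!: mult_mono)
    show "AE u in lborel. ((\<lambda>t. ?J u * ?P t u) \<longlongrightarrow>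
       ?J u * (f (x0 / 2) * h (x0 / 2))) (at 0 within S)"
    proof (rule AE_I2, rule tendsto_within_subset[OF _ subset_UNIV])
      fix u
      have "isCont f (x0 / 2)" "isCont h (x0 / 2)"
        using fc hc x0 by (auto simp: continuous_on_eq_continuous_at)
      moreover have "((\<lambda>t. x0 / 2 + t * v) \<longlongrightarrow> x0 / 2) (at 0)" for v by (auto intro!: tendsto_eq_intros)
      ultimately show "((\<lambda>t. ?J u * ?P t u) \<longlongrightarrow>
         ?J u * (f (x0 / 2) * h (x0 / 2))) (at 0)"
        by (intro tendsto_mult tendsto_const) (auto intro: isCont_tendsto_compose)
    qed
  qed
  have eq: "(half_conv f h (x0 + t) - half_conv f h x0) / t =
      (\<integral>y. ?I y * ?Q t y \<partial>lborel)
      + (\<integral>u. ?J u * ?P t u \<partial>lborel)" if t: "t \<in> S" "t \<noteq> 0" for t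
  proof -
    let ?K = "indicator {0<..<(x0 + t) / 2} :: real \<Rightarrow> real"
    have i1: "integrable lborel (\<lambda>y. ?K y * ?R t y)"
      by (rule integrable_truncated_product[OF fc h, of _ "(x0 + t) / 2" "x0 / 4"]) (use t x0 in \<open>auto simp: S_def\<close>)
    have i2: "integrable lborel (\<lambda>y. ?I y * ?R t y)"
      by (rule integrable_truncated_product[OF fc h, of _ "x0 / 2" "x0 / 4"]) (use t x0 in \<open>auto simp: S_def\<close>)
    have i3: "integrable lborel (\<lambda>y. ?I y * (f (x0 - y) * h y))"
      by (rule integrable_truncated_product[OF fc h, of _ "x0 / 2" "x0 / 4"]) (use t x0 in \<open>auto simp: S_def\<close>)
    have "half_conv f h (x0 + t) - half_conv f h x0 = (\<integral>y. ?K y * ?R t y \<partial>lborel) - (\<integral>y. ?I y * (f (x0 - y) * h y) \<partial>lborel)"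
      by (simp add: half_conv_def set_lebesgue_integral_def)
    also have "\<dots> = ((\<integral>y. ?I y * ?R t y \<partial>lborel) - (\<integral>y. ?I y * (f (x0 - y) * h y) \<partial>lborel))
      + ((\<integral>y. ?K y * ?R t y \<partial>lborel) - (\<integral>y. ?I y * ?R t y \<partial>lborel))" by simp
    also have "(\<integral>y. ?I y * ?R t y \<partial>lborel) - (\<integral>y. ?I y * (f (x0 - y) * h y) \<partial>lborel)
      = (\<integral>y. ?I y * ?R t y - ?I y * (f (x0 - y) * h y) \<partial>lborel)"
      by (rule Bochner_Integration.integral_diff[OF i2 i3, symmetric])
    also have "\<dots> = (\<integral>y. t * (?I y * ?Q t y) \<partial>lborel)"
      using t by (intro Bochner_Integration.integral_cong) (auto simp: field_simps)
    also have "\<dots> = t * (\<integral>y. ?I y * ?Q t y \<partial>lborel)" by simp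
    also have "(\<integral>y. ?K y * ?R t y \<partial>lborel) - (\<integral>y. ?I y * ?R t y \<partial>lborel)
      = (\<integral>y. ?K y * ?R t y - ?I y * ?R t y \<partial>lborel)"
      by (rule Bochner_Integration.integral_diff[OF i1 i2, symmetric])
    also have "\<dots> = (\<integral>y. (?K y - ?I y) * ?R t y \<partial>lborel)"
      by (simp add: left_diff_distrib)
    also have "\<dots> = \<bar>t\<bar> * (\<integral>u. (?K (x0 / 2 + t * u) - ?I (x0 / 2 + t * u)) * (f (x0 + t - (x0 / 2 + t * u)) * h (x0 / 2 + t * u)) \<partial>lborel)"
      using lborel_integral_real_affine[OF t(2), of "\<lambda>y. (?K y - ?I y) * ?R t y" "x0 / 2"] by simp
    also have "\<dots> = (\<integral>u. \<bar>t\<bar> * ((?K (x0 / 2 + t * u) - ?I (x0 / 2 + t * u)) * (f (x0 + t - (x0 / 2 + t * u)) * h (x0 / 2 + t * u))) \<partial>lborel)"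
      by simp
    also have "\<dots> = (\<integral>u. t * (?J u * ?P t u) \<partial>lborel)"
    proof -
      \<comment> \<open>The sign lost in the Jacobian \<open>\<bar>t\<bar>\<close> is restored by the order of the two endpoints.\<close>
      have ind: "\<bar>t\<bar> * (?K (x0 / 2 + t * u) - ?I (x0 / 2 + t * u)) = t * ?J u" if u: "u \<noteq> 0" "u \<noteq> 1 / 2" for u
      proof (cases "0 < t")
        case True
        have "?K (x0 / 2 + t * u) - ?I (x0 / 2 + t * u) = ?J u"
        proof -
          have 1: "x0 / 2 + t * u < (x0 + t) / 2 \<longleftrightarrow> u < 1 / 2" using True by (simp add: field_simps)
          have 2: "x0 / 2 + t * u < x0 / 2 \<longleftrightarrow> u < 0" using True by (simp add: mult_less_0_iff)
          have 3: "0 < u \<Longrightarrow> 0 < x0 / 2 + t * u" using True x0 by (simp add: add_pos_pos)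
          show ?thesis using 1 2 3 u by (auto simp: indicator_def)
        qed
        then show ?thesis using True by simp
      next
        case False
        then have neg: "t < 0" using t by simp
        have "?K (x0 / 2 + t * u) - ?I (x0 / 2 + t * u) = - ?J u"
        proof -
          have 1: "x0 / 2 + t * u < (x0 + t) / 2 \<longleftrightarrow> 1 / 2 < u" using neg by (simp add: field_simps)
          have 2: "x0 / 2 + t * u < x0 / 2 \<longleftrightarrow> 0 < u" using neg by (simp add: mult_less_0_iff)
          have 3: "0 < x0 / 2 + t * u" if "u < 1 / 2" "0 < u"
          proof -
            have "- t * u \<le> x0 / 4 * (1 / 2)" using neg t that x0 by (intro mult_mono) (auto simp: S_def)
            then show ?thesis using x0 by simp
          qed
          show ?thesis using 1 2 3 u by (auto simp: indicator_def)
        qed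
        then show ?thesis using neg by simp
      qed
      have arg: "x0 + t - (x0 / 2 + t * u) = x0 / 2 + t * (1 - u)" for u by (simp add: algebra_simps)
      have int1: "integrable lborel (\<lambda>y. (?K y - ?I y) * ?R t y)"
        using Bochner_Integration.integrable_diff[OF i1 i2] by (simp add: left_diff_distrib)
      have int: "integrable lborel (\<lambda>u. \<bar>t\<bar> * ((?K (x0 / 2 + t * u) - ?I (x0 / 2 + t * u)) * (f (x0 + t - (x0 / 2 + t * u)) * h (x0 / 2 + t * u))))"
        by (intro integrable_mult_right lborel_integrable_real_affine[OF int1 t(2)])
      have ae: "AE u in lborel. \<bar>t\<bar> * ((?K (x0 / 2 + t * u) - ?I (x0 / 2 + t * u)) * (f (x0 + t - (x0 / 2 + t * u)) * h (x0 / 2 + t * u)))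
         = t * (?J u * ?P t u)"
        using AE_lborel_singleton[of 0] AE_lborel_singleton[of "1 / 2"]
        by eventually_elim (simp only: arg mult.assoc[symmetric] ind not_False_eq_True)
      show ?thesis
        by (rule integral_cong_AE[OF borel_measurable_integrable[OF int] _ ae]) (use P_meas[OF t(1)] in simp)
    qed
    also have "\<dots> = t * (\<integral>u. ?J u * ?P t u \<partial>lborel)" by simp
    finally show ?thesis using t by (simp add: field_simps)
  qed
  have "((\<lambda>t. (half_conv f h (x0 + t) - half_conv f h x0) / t) \<longlongrightarrow>
     (\<integral>y. ?I y * (f' (x0 - y) * h y) \<partial>lborel) + (\<integral>u. ?J u * (f (x0 / 2) * h (x0 / 2)) \<partial>lborel)) (at 0 within S)"
    by (rule Lim_transform_eventually[OF tendsto_add[OF lim1 lim2]])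
       (auto simp: eventually_at_filter eq intro!: always_eventually)
  moreover have "at 0 within S = at 0" using x0 by (intro at_within_open) (auto simp: S_def)
  ultimately show ?thesis
    unfolding DERIV_def by (simp add: half_conv_def set_lebesgue_integral_def add.commute)
qed

text \<open>
  The boundary term has the regularity of \<open>f h\<close>, and the remaining term is again a half
  convolution, with \<open>f'\<close> in place of \<open>f\<close>. The factor \<open>h\<close> is never differentiated inside the
  integral, so its integrability is all that is used near \<open>0\<close>.
\<close>
lemma C_k_on_half_conv:
  assumes "C_k_on k f {0<..}" "C_k_on k h {0<..}" "\<And>b. set_integrable lborel {0<..<b} h"
  shows "C_k_on k (half_conv f h) {0<..}"
  using assms(1,2)
proof (induction k arbitrary: f)
  case 0
  then show ?case using continuous_on_half_conv[OF _ assms(3)] by (simp add: C_k_on_0)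
next
  case (Suc k)
  note S = open_greaterThan[of "0::real"]
  note f = C_k_on_SucD[OF S Suc.prems(1)]
  note low = C_k_on_lower[OF S Suc.prems(1)] C_k_on_lower[OF S Suc.prems(2)]
  show ?case
  proof (rule C_k_on_SucI[OF S])
    show "(half_conv f h has_real_derivative 1 / 2 * (f (x / 2) * h (x / 2)) + half_conv (deriv f) h x) (at x)"
      if "x \<in> {0<..}" for x
      by (rule has_derivative_half_conv)
         (use that f C_k_on_imp_continuous_on[OF S f(2)] C_k_on_imp_continuous_on[OF S low(2)] assms(3) in auto)
    show "C_k_on k (\<lambda>x. 1 / 2 * (f (x / 2) * h (x / 2)) + half_conv (deriv f) h x) {0<..}"
      using C_k_on_half[OF C_k_on_mult[OF S low]]
      by (intro C_k_on_add C_k_on_cmult S Suc.IH f(2) low(2))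
  qed
qed

lemma conv_eq_half_conv:
  assumes fc: "continuous_on {0<..} f" and hc: "continuous_on {0<..} h"
    and f: "\<And>b. set_integrable lborel {0<..<b} f" and h: "\<And>b. set_integrable lborel {0<..<b} h" and x: "0 < x"
  shows "conv f h x = half_conv f h x + half_conv h f x"
proof -
  let ?L = "\<lambda>y. indicator {0<..<x / 2} y * (f (x - y) * h y)"
  let ?R = "\<lambda>y. indicator {0<..<x / 2} y * (h (x - y) * f y)"
  have L: "integrable lborel ?L"
    by (rule integrable_truncated_product[OF fc h, of _ "x / 2" "x / 2"]) (use x in auto)
  have R: "integrable lborel ?R"
    by (rule integrable_truncated_product[OF hc f, of _ "x / 2" "x / 2"]) (use x in auto)
  have R': "integrable lborel (\<lambda>y. ?R (x - y))" and R_eq: "(\<integral>y. ?R y \<partial>lborel) = (\<integral>y. ?R (x - y) \<partial>lborel)"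
    using lborel_integrable_real_affine[OF R, of "- 1" x] lborel_integral_real_affine[of "- 1" ?R x] by simp_all
  have ae: "AE y in lborel. ?L y + ?R (x - y) = indicator {0<..<x} y *\<^sub>R (f (x - y) * h y)"
    using AE_lborel_singleton[of "x / 2"] by eventually_elim (auto simp: indicator_def)
  have m: "(\<lambda>y. indicator {0<..<x} y *\<^sub>R (f (x - y) * h y)) \<in> borel_measurable lborel"
    using measurable_truncated_product[OF fc h, of "{0<..<x}" x x] by simp
  have "half_conv f h x + half_conv h f x = (\<integral>y. ?L y + ?R (x - y) \<partial>lborel)"
    using Bochner_Integration.integral_add[OF L R'] R_eq by (simp add: half_conv_def set_lebesgue_integral_def)
  also have "\<dots> = conv f h x"
    unfolding conv_def set_lebesgue_integral_def
    by (rule integral_cong_AE[OF borel_measurable_integrable[OF Bochner_Integration.integrable_add[OF L R']] m ae])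
  finally show ?thesis ..
qed

text \<open>
  Hence smoothness away from \<open>0\<close> survives convolution, whatever the integrable singularities
  at \<open>0\<close> are.
\<close>
lemma C_k_on_conv:
  assumes f: "C_k_on k f {0<..}" "exp_integrable \<theta> f" and h: "C_k_on k h {0<..}" "exp_integrable \<theta> h"
  shows "C_k_on k (conv f h) {0<..}"
proof (rule C_k_on_cong[OF open_greaterThan])
  note li = exp_integrable_local[OF f(2)] exp_integrable_local[OF h(2)]
  show "C_k_on k (\<lambda>x. half_conv f h x + half_conv h f x) {0<..}"
    by (intro C_k_on_add C_k_on_half_conv f h li) auto
  show "half_conv f h x + half_conv h f x = conv f h x" if "x \<in> {0<..}" for x
    using that conv_eq_half_conv[OF _ _ li] C_k_on_imp_continuous_on[OF open_greaterThan f(1)]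
      C_k_on_imp_continuous_on[OF open_greaterThan h(1)] by auto
qed

lemma C_k_on_primitive:
  assumes "C_k_on k f {0<..}" "exp_integrable \<theta> f"
  shows "C_k_on (Suc k) (conv (\<lambda>_. 1) f) {0<..}"
  by (rule C_k_on_SucI[OF open_greaterThan _ assms(1)])
     (use has_derivative_primitive[OF assms(2) C_k_on_imp_continuous_on[OF open_greaterThan assms(1)]] in auto)

section \<open>Functions and primitives up to null sets\<close>

lemma exp_integrable_cong:
  assumes "\<And>x. 0 < x \<Longrightarrow> f x = h x"
  shows "exp_integrable \<theta> f \<longleftrightarrow> exp_integrable \<theta> h" "laplace f \<theta> = laplace h \<theta>"
proof -
  have "(\<lambda>x. indicator {0<..} x *\<^sub>R (exp (- \<theta> * x) * f x)) = (\<lambda>x. indicator {0<..} x *\<^sub>R (exp (- \<theta> * x) * h x))"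
    using assms by (auto simp: indicator_def)
  then show "exp_integrable \<theta> f \<longleftrightarrow> exp_integrable \<theta> h" "laplace f \<theta> = laplace h \<theta>"
    unfolding exp_integrable_def laplace_def set_integrable_def set_lebesgue_integral_def by simp_all
qed

lemma measurable_on_positive:
  assumes "continuous_on {0<..} (f :: real \<Rightarrow> real)"
  shows "(\<lambda>x. indicator {0<..} x * f x) \<in> borel_measurable borel"
  using borel_measurable_continuous_on_indicator[OF _ assms] by simp

text \<open>
  A nonempty open set is not a null set.
\<close>
lemma eq_if_AE_eq_continuous:
  fixes f h :: "real \<Rightarrow> real"
  assumes f: "continuous_on {0<..} f" and h: "continuous_on {0<..} h"
    and ae: "AE x in lborel. 0 < x \<longrightarrow> f x = h x" and x: "0 < x"
  shows "f x = h x"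
proof (rule ccontr)
  assume neq: "f x \<noteq> h x"
  let ?D = "{y. \<not> (0 < y \<longrightarrow> f y = h y)}"
  have "continuous_on {0<..} (\<lambda>y. f y - h y)" using f h by (intro continuous_intros)
  then have "open ({0<..} \<inter> (\<lambda>y. f y - h y) -` (- {0}))"
    by (rule continuous_open_preimage) auto
  also have "{0<..} \<inter> (\<lambda>y. f y - h y) -` (- {0}) = ?D" by auto
  finally have op: "open ?D" .
  then have "?D \<in> null_sets lborel" using ae by (subst (asm) AE_iff_null) auto
  then have "negligible ?D" by (auto simp: negligible_iff_null_sets intro: null_sets_completionI)
  then show False using open_not_negligible[OF op] neq x by auto
qed

lemma primitive_cong_AE:
  assumes f: "exp_integrable \<theta> f" and h: "exp_integrable \<theta> h" and ae: "AE x in lborel. 0 < x \<longrightarrow> f x = h x"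
  shows "conv (\<lambda>_. 1) f x = conv (\<lambda>_. 1) h x"
  unfolding conv_one set_lebesgue_integral_def
proof (rule integral_cong_AE)
  show "(\<lambda>y. indicator {0<..<x} y *\<^sub>R f y) \<in> borel_measurable lborel" "(\<lambda>y. indicator {0<..<x} y *\<^sub>R h y) \<in> borel_measurable lborel"
    using exp_integrable_local[OF f, of x] exp_integrable_local[OF h, of x] unfolding set_integrable_def by auto
  show "AE y in lborel. indicator {0<..<x} y *\<^sub>R f y = indicator {0<..<x} y *\<^sub>R h y"
    using ae by eventually_elim (auto simp: indicator_def)
qed

text \<open>
  Lebesgue differentiation in the easy case where the derivative of the primitive is
  known to exist and to be continuous: \<open>q\<close> and \<open>R\<close> have the same integrals over compact intervals.
\<close>
lemma deriv_primitive_AE: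
  assumes R: "exp_integrable \<theta> R"
    and d: "\<And>x. 0 < x \<Longrightarrow> (conv (\<lambda>_. 1) R has_real_derivative q x) (at x)" and q: "continuous_on {0<..} q"
  shows "AE x in lborel. 0 < x \<longrightarrow> q x = R x"
proof -
  have "AE x in lborel. indicator {1 / real (Suc k)..real (Suc k)} x * (q x - R x) = 0" for k
  proof -
    define a b where "a = 1 / real (Suc k)" and "b = real (Suc k)"
    have ab: "0 < a" "a \<le> b" by (auto simp: a_def b_def field_simps)
    have qi: "set_integrable lborel {c..b} q" if "0 < c" for c
      by (rule borel_integrable_atLeastAtMost') (use that q in \<open>auto intro: continuous_on_subset\<close>)
    have eq: "(LBINT x:{c..b}. q x) = (LBINT x:{c..b}. R x)" if "0 < c" "c \<le> b" for c
    proof -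
      have "(LBINT x:{c..b}. q x) = conv (\<lambda>_. 1) R b - conv (\<lambda>_. 1) R c"
        unfolding set_lebesgue_integral_def
      proof (rule integral_FTC_Icc)
        show "continuous_on {c..b} q" using that q by (auto intro: continuous_on_subset)
      qed (use that d in \<open>auto simp: has_real_derivative_iff_has_vector_derivative[symmetric] intro: has_field_derivative_at_within\<close>)
      then show ?thesis using primitive_diff(2)[OF R that] by simp
    qed
    have int: "integrable lborel (\<lambda>x. indicator {a..b} x * (q x - R x))"
      using set_integral_diff(1)[OF qi[OF ab(1)] primitive_diff(1)[OF R ab]] by (simp add: set_integrable_def)
    have "AE x in lborel. indicator {a..b} x * (q x - R x) = 0"
    proof (rule AE_eq_0_if_tail_integrals_eq_0[OF int])
      fix c
      let ?c = "max a c"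
      have "(LBINT x:{c<..}. indicator {a..b} x * (q x - R x)) = (LBINT x:{?c..b}. q x - R x)"
        unfolding set_lebesgue_integral_def
      proof (rule integral_cong_AE)
        have "(\<lambda>x. indicator {a..b} x * (q x - R x)) \<in> borel_measurable lborel" using int by (rule borel_measurable_integrable)
        then have "(\<lambda>x. indicator {c..} x * (indicator {a..b} x * (q x - R x))) \<in> borel_measurable lborel"
             "(\<lambda>x. indicator {c<..} x *\<^sub>R (indicator {a..b} x * (q x - R x))) \<in> borel_measurable lborel" by auto
        moreover have "(\<lambda>x. indicator {c..} x * (indicator {a..b} x * (q x - R x))) = (\<lambda>x. indicator {?c..b} x *\<^sub>R (q x - R x))"
          by (auto simp: fun_eq_iff indicator_def)
        ultimately show "(\<lambda>x. indicator {c<..} x *\<^sub>R (indicator {a..b} x * (q x - R x))) \<in> borel_measurable lborel"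
          "(\<lambda>x. indicator {?c..b} x *\<^sub>R (q x - R x)) \<in> borel_measurable lborel" by simp_all
        show "AE x in lborel. indicator {c<..} x *\<^sub>R (indicator {a..b} x * (q x - R x)) = indicator {?c..b} x *\<^sub>R (q x - R x)"
          using AE_lborel_singleton[of c] by eventually_elim (auto simp: indicator_def)
      qed
      also have "\<dots> = 0"
      proof (cases "?c \<le> b")
        case True
        have c0: "0 < ?c" using ab by auto
        show ?thesis using set_integral_diff(2)[OF qi[OF c0] primitive_diff(1)[OF R c0 True]] eq[OF c0 True] by simp
      qed (simp add: set_lebesgue_integral_def)
      finally show "(LBINT x:{c<..}. indicator {a..b} x * (q x - R x)) = 0" .
    qed
    then show ?thesis by (simp add: a_def b_def)
  qed
  then have "AE x in lborel. \<forall>k. indicator {1 / real (Suc k)..real (Suc k)} x * (q x - R x) = 0"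
    unfolding AE_all_countable by blast
  then show ?thesis
  proof eventually_elim
    fix x :: real assume z: "\<forall>k. indicator {1 / real (Suc k)..real (Suc k)} x * (q x - R x) = 0"
    show "0 < x \<longrightarrow> q x = R x"
    proof
      assume x: "0 < x"
      obtain k where k: "max x (1 / x) \<le> real k" using real_arch_simple by blast
      then have "1 / x \<le> real (Suc k)" "x \<le> real (Suc k)" by auto
      moreover from this have "1 / real (Suc k) \<le> x" using x by (simp add: field_simps)
      ultimately show "q x = R x" using spec[OF z, of k] by (simp add: indicator_def)
    qed
  qed
qed

text \<open>
  A derivative is a pointwise limit of difference quotients.
\<close>
lemma measurable_deriv:
  assumes "g differentiable_on {0<..}"
  shows "(\<lambda>x::real. indicator {0<..} x * deriv g x) \<in> borel_measurable borel"
proof -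
  define G where "G x = indicator {0<..} x * g x" for x
  have [measurable]: "G \<in> borel_measurable borel"
    using measurable_on_positive[OF differentiable_imp_continuous_on[OF assms]] by (simp add: G_def[abs_def])
  show ?thesis
  proof (rule borel_measurable_LIMSEQ_real)
    fix x :: real
    show "(\<lambda>n. indicator {0<..} x * ((G (x + inverse (real (Suc n))) - G x) / inverse (real (Suc n)))) \<longlonglongrightarrow> indicator {0<..} x * deriv g x"
    proof (cases "0 < x")
      case True
      have "(g has_real_derivative deriv g x) (at x)"
        using has_real_derivative_deriv[OF _ assms] True by simp
      then have "((\<lambda>h. (g (x + h) - g x) / h) \<longlongrightarrow> deriv g x) (at 0)" unfolding DERIV_def .
      moreover have "filterlim (\<lambda>n. inverse (real (Suc n))) (at 0) sequentially"
        unfolding filterlim_at using LIMSEQ_inverse_real_of_nat by simp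
      ultimately have "(\<lambda>n. (g (x + inverse (real (Suc n))) - g x) / inverse (real (Suc n))) \<longlonglongrightarrow> deriv g x"
        by (rule filterlim_compose)
      then show ?thesis using True by (simp add: G_def add_pos_pos)
    qed simp
  qed measurable
qed

section \<open>Smoothness of renewal densities\<close>

text \<open>
  A decreasing kernel for the renewal equation \<open>U = g + g * U\<close>, together with an exponent at which
  the Neumann series converges.
\<close>
locale renewal_kernel =
  fixes g :: "real \<Rightarrow> real" and \<theta>0 :: real
  assumes differentiable: "g differentiable_on {0<..}"
    and deriv_le_0: "\<And>x. 0 < x \<Longrightarrow> deriv g x \<le> 0"
    and nonneg: "\<And>x. 0 < x \<Longrightarrow> 0 \<le> g x"
    and pos: "0 < \<theta>0"
    and integrable: "exp_integrable \<theta>0 g"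
    and laplace_less_1: "laplace g \<theta>0 < 1"
begin

text \<open>
  In the application \<open>g\<close> is the tail of a measure up to an additive and a multiplicative
  constant, and \<open>p x\<close> is proportional to \<open>x\<close> times its density. Note that \<open>(x g)' = g - p\<close>.
\<close>
definition p :: "real \<Rightarrow> real" where "p x = - x * deriv g x"

lemma has_deriv: "0 < x \<Longrightarrow> (g has_real_derivative deriv g x) (at x)"
  using has_real_derivative_deriv[OF _ differentiable] by simp

lemma continuous: "continuous_on {0<..} g"
  by (rule differentiable_imp_continuous_on[OF differentiable])

lemma antimono: "0 < x \<Longrightarrow> x \<le> y \<Longrightarrow> g y \<le> g x"
  using DERIV_nonpos_imp_nonincreasing[of x y g] has_deriv deriv_le_0 by (meson less_le_trans)

lemma p_nonneg: "0 < x \<Longrightarrow> 0 \<le> p x"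
  using deriv_le_0[of x] by (simp add: p_def mult_nonneg_nonpos)

lemma p_measurable: "(\<lambda>x. indicator {0<..} x * p x) \<in> borel_measurable borel"
proof -
  have "(\<lambda>x. - x * (indicator {0<..} x * deriv g x)) \<in> borel_measurable borel"
    using measurable_deriv[OF differentiable] by measurable
  then show ?thesis by (simp add: p_def mult.left_commute)
qed

lemma p_truncated_measurable: "(\<lambda>y. indicator {0<..<b} y * p y) \<in> borel_measurable borel"
proof -
  have "(\<lambda>y. indicator {..<b} y * (indicator {0<..} y * p y)) \<in> borel_measurable borel"
    using p_measurable by simp
  also have "(\<lambda>y. indicator {..<b} y * (indicator {0<..} y * p y)) = (\<lambda>y. indicator {0<..<b} y * p y)"
    by (auto simp: fun_eq_iff indicator_def)
  finally show ?thesis .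
qed

text \<open>
  Tonelli after writing \<open>p y\<close> as the integral of \<open>- g' y\<close> over \<open>0 < z < y\<close>.
\<close>
lemma nn_integral_p:
  assumes w: "w \<in> borel_measurable borel"
  shows "(\<integral>\<^sup>+y. w y * ennreal (indicator {0<..<x} y * p y) \<partial>lborel)
    = (\<integral>\<^sup>+z. indicator {0<..<x} z * (\<integral>\<^sup>+y. w y * ennreal (- deriv g y) * indicator {z<..<x} y \<partial>lborel) \<partial>lborel)"
proof -
  define D where "D y = indicator {0<..} y * - deriv g y" for y
  have [measurable]: "D \<in> borel_measurable borel"
    using measurable_deriv[OF differentiable] by (simp add: D_def[abs_def])
  note [measurable] = w
  have "(\<integral>\<^sup>+y. w y * ennreal (indicator {0<..<x} y * p y) \<partial>lborel)
      = (\<integral>\<^sup>+y. (\<integral>\<^sup>+z. w y * ennreal (D y) * (if 0 < z \<and> z < y \<and> y < x then 1 else 0) \<partial>lborel) \<partial>lborel)"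
  proof (rule nn_integral_cong)
    fix y :: real
    show "w y * ennreal (indicator {0<..<x} y * p y)
      = (\<integral>\<^sup>+z. w y * ennreal (D y) * (if 0 < z \<and> z < y \<and> y < x then 1 else 0) \<partial>lborel)"
    proof (cases "0 < y \<and> y < x")
      case True
      have "(\<integral>\<^sup>+z. w y * ennreal (D y) * (if 0 < z \<and> z < y \<and> y < x then 1 else 0) \<partial>lborel)
         = (\<integral>\<^sup>+z. w y * ennreal (D y) * indicator {0<..<y} z \<partial>lborel)"
        using True by (intro nn_integral_cong) (auto simp: indicator_def)
      also have "\<dots> = w y * ennreal (D y) * ennreal y"
        using True by (simp add: nn_integral_cmult_indicator)
      also have "\<dots> = w y * ennreal (p y)"
      proof -
        have "p y = - deriv g y * y" by (simp add: p_def)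
        then have "ennreal (p y) = ennreal (- deriv g y) * ennreal y"
          using True deriv_le_0[of y] by (simp only:) (rule ennreal_mult, auto)
        then show ?thesis using True by (simp add: D_def mult.assoc)
      qed
      finally show ?thesis using True by simp
    next
      case False
      then have "(if 0 < z \<and> z < y \<and> y < x then 1 else 0) = (0::ennreal)" for z by auto
      then show ?thesis using False by auto
    qed
  qed
  also have "\<dots> = (\<integral>\<^sup>+z. (\<integral>\<^sup>+y. w y * ennreal (D y) * (if 0 < z \<and> z < y \<and> y < x then 1 else 0) \<partial>lborel) \<partial>lborel)"
    by (rule lborel_pair.Fubini'[symmetric]) measurable
  also have "\<dots> = (\<integral>\<^sup>+z. indicator {0<..<x} z * (\<integral>\<^sup>+y. w y * ennreal (- deriv g y) * indicator {z<..<x} y \<partial>lborel) \<partial>lborel)"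
  proof (rule nn_integral_cong)
    fix z :: real
    show "(\<integral>\<^sup>+y. w y * ennreal (D y) * (if 0 < z \<and> z < y \<and> y < x then 1 else 0) \<partial>lborel)
      = indicator {0<..<x} z * (\<integral>\<^sup>+y. w y * ennreal (- deriv g y) * indicator {z<..<x} y \<partial>lborel)"
    proof (cases "0 < z \<and> z < x")
      case True
      then have "(\<integral>\<^sup>+y. w y * ennreal (D y) * (if 0 < z \<and> z < y \<and> y < x then 1 else 0) \<partial>lborel)
        = (\<integral>\<^sup>+y. w y * ennreal (- deriv g y) * indicator {z<..<x} y \<partial>lborel)"
        by (intro nn_integral_cong) (auto simp: D_def indicator_def)
      then show ?thesis using True by simp
    next
      case False
      then have "(if 0 < z \<and> z < y \<and> y < x then 1 else 0) = (0::ennreal)" for y by auto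
      then show ?thesis using False by (simp add: indicator_def)
    qed
  qed
  finally show ?thesis .
qed

lemma nn_integral_neg_deriv:
  assumes "0 < z" "z \<le> x"
  shows "(\<integral>\<^sup>+y. ennreal (- deriv g y) * indicator {z<..<x} y \<partial>lborel) = ennreal (g z - g x)"
proof -
  define D where "D y = indicator {0<..} y * - deriv g y" for y
  have [measurable]: "D \<in> borel_measurable borel"
    using measurable_deriv[OF differentiable] by (simp add: D_def[abs_def])
  have "(\<integral>\<^sup>+y. ennreal (- deriv g y) * indicator {z<..<x} y \<partial>lborel) = (\<integral>\<^sup>+y. ennreal (D y) * indicator {z..x} y \<partial>lborel)"
  proof (rule nn_integral_cong_AE)
    show "AE y in lborel. ennreal (- deriv g y) * indicator {z<..<x} y = ennreal (D y) * indicator {z..x} y"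
      using AE_lborel_singleton[of z] AE_lborel_singleton[of x]
      by eventually_elim (use assms in \<open>auto simp: indicator_def D_def\<close>)
  qed
  also have "\<dots> = ennreal (- g x - - g z)"
  proof (rule nn_integral_FTC_Icc)
    show "((\<lambda>y. - g y) has_real_derivative D y) (at y)" if "y \<in> {z..x}" for y
      using DERIV_minus[OF has_deriv[of y]] that assms by (simp add: D_def)
    show "0 \<le> D y" if "y \<in> {z..x}" for y
      using that assms deriv_le_0[of y] by (simp add: D_def)
  qed (use assms in auto)
  finally show ?thesis by simp
qed

lemma integral_p:
  assumes x: "0 < x"
  shows "set_integrable lborel {0<..<x} p" "x * g x = (LBINT y:{0<..<x}. g y) - (LBINT y:{0<..<x}. p y)"
proof -
  have gi: "set_integrable lborel {0<..<x} g" by (rule exp_integrable_local[OF integrable])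
  have ci: "set_integrable lborel {0<..<x} (\<lambda>_. g x)"
    unfolding set_integrable_def using x by (intro integrable_scaleR_left integrable_real_indicator) auto
  have di: "set_integrable lborel {0<..<x} (\<lambda>y. g y - g x)" by (rule set_integral_diff(1)[OF gi ci])
  have "(\<integral>\<^sup>+y. ennreal (indicator {0<..<x} y * p y) \<partial>lborel)
      = (\<integral>\<^sup>+z. indicator {0<..<x} z * (\<integral>\<^sup>+y. ennreal (- deriv g y) * indicator {z<..<x} y \<partial>lborel) \<partial>lborel)"
    using nn_integral_p[of "\<lambda>_. 1" x] by simp
  also have "\<dots> = (\<integral>\<^sup>+z. ennreal (indicator {0<..<x} z *\<^sub>R (g z - g x)) \<partial>lborel)"
    by (intro nn_integral_cong) (simp add: nn_integral_neg_deriv split: split_indicator)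
  also have "\<dots> = ennreal (LBINT y:{0<..<x}. g y - g x)"
    unfolding set_lebesgue_integral_def
    using di antimono by (intro nn_integral_eq_integral) (auto simp: set_integrable_def indicator_def)
  finally have nn: "(\<integral>\<^sup>+y. ennreal (indicator {0<..<x} y *\<^sub>R p y) \<partial>lborel) = ennreal (LBINT y:{0<..<x}. g y - g x)" by simp
  have "has_bochner_integral lborel (\<lambda>y. indicator {0<..<x} y *\<^sub>R p y) (LBINT y:{0<..<x}. g y - g x)"
  proof (rule has_bochner_integral_nn_integral[OF _ _ _ nn])
    show "(\<lambda>y. indicator {0<..<x} y *\<^sub>R p y) \<in> borel_measurable lborel"
      using p_truncated_measurable by simp
    show "0 \<le> (LBINT y:{0<..<x}. g y - g x)"
      unfolding set_lebesgue_integral_def using antimono by (intro integral_nonneg_AE AE_I2) (auto simp: indicator_def)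
  qed (auto simp: indicator_def p_nonneg)
  then have *: "set_integrable lborel {0<..<x} p" "(LBINT y:{0<..<x}. p y) = (LBINT y:{0<..<x}. g y - g x)"
    by (auto simp: has_bochner_integral_iff set_integrable_def set_lebesgue_integral_def)
  show "set_integrable lborel {0<..<x} p" by fact
  have "(LBINT y:{0<..<x}. g x) = x * g x" using x by (simp add: set_lebesgue_integral_def)
  then show "x * g x = (LBINT y:{0<..<x}. g y) - (LBINT y:{0<..<x}. p y)"
    using *(2) set_integral_diff(2)[OF gi ci] by simp
qed

text \<open>
  For fixed \<open>z\<close> the mass of \<open>- g'\<close> beyond \<open>z\<close> is at most \<open>g z\<close>,
  so after Tonelli the integral of \<open>p\<close> is dominated by that of \<open>g\<close>, with the same weight.
\<close>
lemma p_integrable: "exp_integrable \<theta>0 p"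
proof -
  let ?F = "\<lambda>N y. ennreal (exp (- \<theta>0 * y)) * ennreal (indicator {0<..<real N} y * p y)"
  define C where "C = (\<integral>\<^sup>+z. ennreal (indicator {0<..} z *\<^sub>R (exp (- \<theta>0 * z) * g z)) \<partial>lborel)"
  have C: "C < \<infinity>"
    using integrable nonneg unfolding C_def exp_integrable_def set_integrable_def
    by (subst nn_integral_eq_integral) (auto simp: indicator_def)
  note [measurable] = p_truncated_measurable
  have Fm: "?F N \<in> borel_measurable lborel" for N by measurable
  have bound: "(\<integral>\<^sup>+y. ?F N y \<partial>lborel) \<le> C" for N
  proof -
    have "(\<integral>\<^sup>+y. ?F N y \<partial>lborel) = (\<integral>\<^sup>+z. indicator {0<..<real N} z *
        (\<integral>\<^sup>+y. ennreal (exp (- \<theta>0 * y)) * ennreal (- deriv g y) * indicator {z<..<real N} y \<partial>lborel) \<partial>lborel)"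
      by (rule nn_integral_p) simp
    also have "\<dots> \<le> C"
      unfolding C_def
    proof (rule nn_integral_mono)
      fix z :: real
      show "indicator {0<..<real N} z * (\<integral>\<^sup>+y. ennreal (exp (- \<theta>0 * y)) * ennreal (- deriv g y) * indicator {z<..<real N} y \<partial>lborel)
        \<le> ennreal (indicator {0<..} z *\<^sub>R (exp (- \<theta>0 * z) * g z))"
      proof (cases "0 < z \<and> z < real N")
        case True
        define D where "D y = indicator {0<..} y * - deriv g y" for y
        have [measurable]: "D \<in> borel_measurable borel"
          using measurable_deriv[OF differentiable] by (simp add: D_def[abs_def])
        have "(\<integral>\<^sup>+y. ennreal (exp (- \<theta>0 * y)) * ennreal (- deriv g y) * indicator {z<..<real N} y \<partial>lborel)
          \<le> (\<integral>\<^sup>+y. ennreal (exp (- \<theta>0 * z)) * (ennreal (D y) * indicator {z<..<real N} y) \<partial>lborel)"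
        proof (rule nn_integral_mono)
          fix y :: real
          show "ennreal (exp (- \<theta>0 * y)) * ennreal (- deriv g y) * indicator {z<..<real N} y
            \<le> ennreal (exp (- \<theta>0 * z)) * (ennreal (D y) * indicator {z<..<real N} y)"
          proof (cases "z < y \<and> y < real N")
            case y: True
            then have "exp (- \<theta>0 * y) \<le> exp (- \<theta>0 * z)" using pos by simp
            then show ?thesis using y True by (auto simp: D_def intro!: mult_right_mono ennreal_leI)
          qed auto
        qed
        also have "\<dots> = ennreal (exp (- \<theta>0 * z)) * (\<integral>\<^sup>+y. ennreal (D y) * indicator {z<..<real N} y \<partial>lborel)"
          by (rule nn_integral_cmult) measurable
        also have "(\<integral>\<^sup>+y. ennreal (D y) * indicator {z<..<real N} y \<partial>lborel) = (\<integral>\<^sup>+y. ennreal (- deriv g y) * indicator {z<..<real N} y \<partial>lborel)"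
          using True by (intro nn_integral_cong) (auto simp: D_def indicator_def)
        also have "\<dots> = ennreal (g z - g (real N))" using True by (intro nn_integral_neg_deriv) auto
        also have "ennreal (exp (- \<theta>0 * z)) * \<dots> \<le> ennreal (exp (- \<theta>0 * z)) * ennreal (g z)"
          using True nonneg[of "real N"] by (intro mult_left_mono ennreal_leI) auto
        finally show ?thesis using True by (simp add: ennreal_mult')
      qed auto
    qed
    finally show ?thesis .
  qed
  have "(\<integral>\<^sup>+y. (SUP N. ?F N y) \<partial>lborel) = (SUP N. \<integral>\<^sup>+y. ?F N y \<partial>lborel)"
  proof (rule nn_integral_monotone_convergence_SUP)
    show "incseq ?F"
      by (auto simp: incseq_def le_fun_def indicator_def p_nonneg intro!: mult_left_mono)
  qed (rule Fm)
  also have "\<dots> \<le> C" by (rule SUP_least) (rule bound)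
  finally have fin: "(\<integral>\<^sup>+y. (SUP N. ?F N y) \<partial>lborel) < \<infinity>" using C by (rule le_less_trans)
  show ?thesis
    unfolding exp_integrable_def set_integrable_def
  proof (rule integrableI_bounded)
    have "(\<lambda>x. exp (- \<theta>0 * x) * (indicator {0<..} x * p x)) \<in> borel_measurable lborel"
      using p_measurable by simp
    then show "(\<lambda>x. indicator {0<..} x *\<^sub>R (exp (- \<theta>0 * x) * p x)) \<in> borel_measurable lborel"
      by (simp add: mult.left_commute)
    have "(\<integral>\<^sup>+x. ennreal (norm (indicator {0<..} x *\<^sub>R (exp (- \<theta>0 * x) * p x))) \<partial>lborel) \<le> (\<integral>\<^sup>+y. (SUP N. ?F N y) \<partial>lborel)"
    proof (rule nn_integral_mono)
      fix x :: real
      show "ennreal (norm (indicator {0<..} x *\<^sub>R (exp (- \<theta>0 * x) * p x))) \<le> (SUP N. ?F N x)"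
      proof (cases "0 < x")
        case True
        obtain N where N: "x < real N" using reals_Archimedean2 by blast
        have "ennreal (norm (indicator {0<..} x *\<^sub>R (exp (- \<theta>0 * x) * p x))) = ?F N x"
          using True N p_nonneg[OF True] by (simp add: abs_mult ennreal_mult')
        then show ?thesis by (metis (no_types, lifting) SUP_upper UNIV_I)
      qed simp
    qed
    then show "(\<integral>\<^sup>+x. ennreal (norm (indicator {0<..} x *\<^sub>R (exp (- \<theta>0 * x) * p x))) \<partial>lborel) < \<infinity>"
      using fin by (rule le_less_trans)
  qed
qed

text \<open>
  Although \<open>g'\<close> need not be integrable at \<open>0\<close>, the function \<open>x g(x)\<close> is the primitive of an
  integrable function and vanishes at \<open>0\<close>.
\<close>
lemma times_g_eq_primitive:
  assumes x: "0 < x"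
  shows "x * g x = conv (\<lambda>_. 1) (\<lambda>y. g y - p y) x"
  using integral_p[OF x] set_integral_diff(2)[OF exp_integrable_local[OF integrable, of x], of p]
  by (simp add: conv_one)

lemma laplace_bounds:
  assumes "\<theta>0 \<le> \<theta>"
  shows "0 \<le> laplace g \<theta>" "laplace g \<theta> < 1"
  using laplace_antimono[OF integrable nonneg assms] laplace_less_1 laplace_nonneg[where f = g] nonneg by auto

lemma laplace_times_g:
  assumes "\<theta>0 < \<theta>"
  shows "laplace (\<lambda>x. x * g x) \<theta> = (laplace g \<theta> - laplace p \<theta>) / \<theta>"
proof -
  have le: "\<theta>0 \<le> \<theta>" using assms by simp
  have i: "exp_integrable \<theta> g" "exp_integrable \<theta> p"
    using exp_integrable_mono[OF _ le] integrable p_integrable by auto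
  have "laplace (\<lambda>x. x * g x) \<theta> = laplace (conv (\<lambda>_. 1) (\<lambda>y. g y - p y)) \<theta>"
    by (rule exp_integrable_cong(2)[OF times_g_eq_primitive])
  also have "\<dots> = (laplace g \<theta> - laplace p \<theta>) / \<theta>"
    using pos assms by (simp add: conv_laplace(2) exp_integrable_diff[OF i] exp_integrable_const)
  finally show ?thesis .
qed

text \<open>
  The derivative of \<open>x U(x)\<close> for a renewal density \<open>U\<close>. In the convolution algebra with unit \<open>\<epsilon>\<close>, it
  satisfies \<open>\<epsilon> + U = (\<epsilon> - g)\<^bsup>-1\<^esup>\<close>, and multiplication by \<open>x\<close> is a derivation; therefore
  \<open>x U = (\<epsilon> + U) * (x g) * (\<epsilon> + U)\<close>. Differentiating \<open>x g\<close> and using \<open>g * (\<epsilon> + U) = U\<close> gives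
  \<open>(x U)' = U * (\<epsilon> + U) - p * (\<epsilon> + U) * (\<epsilon> + U)\<close>, which is the expression below multiplied out.
\<close>
definition deriv_times_density :: "(real \<Rightarrow> real) \<Rightarrow> real \<Rightarrow> real" where
  "deriv_times_density U x = U x + conv U U x - (p x + 2 * conv p U x + conv (conv p U) U x)"

lemma laplace_deriv_times_density:
  assumes "\<theta>0 \<le> \<theta>" "exp_integrable \<theta> U"
  shows "exp_integrable \<theta> (deriv_times_density U)"
    "laplace (deriv_times_density U) \<theta> = laplace U \<theta> * (1 + laplace U \<theta>) - laplace p \<theta> * (1 + laplace U \<theta>)\<^sup>2"
proof -
  note [simp] = assms(2) exp_integrable_mono[OF p_integrable assms(1)] exp_integrable_add exp_integrable_diff exp_integrable_cmult conv_laplace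
  have eq: "deriv_times_density U = (\<lambda>x. (U x + conv U U x) - ((p x + 2 * conv p U x) + conv (conv p U) U x))"
    by (simp add: deriv_times_density_def fun_eq_iff)
  show "exp_integrable \<theta> (deriv_times_density U)" unfolding eq by simp
  show "laplace (deriv_times_density U) \<theta> = laplace U \<theta> * (1 + laplace U \<theta>) - laplace p \<theta> * (1 + laplace U \<theta>)\<^sup>2"
    unfolding eq by (simp add: power2_eq_square algebra_simps)
qed

text \<open>
  On the transform side multiplication by \<open>x\<close> is \<open>- d/d\<theta>\<close>, applied here to \<open>G / (1 - G)\<close> with \<open>G\<close>
  the transform of \<open>g\<close>.
\<close>
lemma laplace_times_renewal_density:
  assumes U: "\<And>t. \<theta>0 \<le> t \<Longrightarrow> exp_integrable t U" "\<And>t. \<theta>0 \<le> t \<Longrightarrow> laplace U t = laplace g t / (1 - laplace g t)"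
    and \<theta>: "\<theta>0 < \<theta>"
  shows "laplace (\<lambda>x. x * U x) \<theta> = laplace (deriv_times_density U) \<theta> / \<theta>"
proof -
  let ?G = "laplace g \<theta>"
  have G: "?G < 1" using laplace_bounds \<theta> by simp
  have "((\<lambda>t. laplace g t / (1 - laplace g t)) has_real_derivative
      - laplace (\<lambda>x. x * g x) \<theta> / (1 - ?G)\<^sup>2) (at \<theta>)"
    using G by (auto intro!: derivative_eq_intros has_derivative_laplace[OF integrable \<theta>]
      simp: power2_eq_square field_simps)
  then have "(laplace U has_real_derivative - laplace (\<lambda>x. x * g x) \<theta> / (1 - ?G)\<^sup>2) (at \<theta>)"
    by (rule has_field_derivative_transform_within_open[of _ _ _ "{\<theta>0<..}"]) (use \<theta> U in auto)
  then have "laplace (\<lambda>x. x * U x) \<theta> = laplace (\<lambda>x. x * g x) \<theta> / (1 - ?G)\<^sup>2"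
    using DERIV_unique[OF _ has_derivative_laplace[OF U(1)[OF order_refl] \<theta>]] by fastforce
  also have "\<dots> = (?G - laplace p \<theta>) / (1 - ?G)\<^sup>2 / \<theta>"
    by (simp add: laplace_times_g[OF \<theta>])
  also have "(?G - laplace p \<theta>) / (1 - ?G)\<^sup>2 = laplace (deriv_times_density U) \<theta>"
  proof -
    have "1 + laplace U \<theta> = 1 / (1 - ?G)" using G U(2)[of \<theta>] \<theta> by (simp add: field_simps)
    then show ?thesis
      using G \<theta> U by (simp add: laplace_deriv_times_density power_divide diff_divide_distrib power2_eq_square)
  qed
  finally show ?thesis .
qed

text \<open>
  The Neumann series determines the renewal density only almost everywhere. The identity for
  \<open>x U(x)\<close> has a continuous right-hand side, and dividing it by \<open>x\<close> selects the continuous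
  representative, for which the identity holds at every point.
\<close>
lemma continuous_renewal_density:
  obtains U where "continuous_on {0<..} U" "\<And>t. \<theta>0 < t \<Longrightarrow> exp_integrable t U"
    "\<And>t. \<theta>0 < t \<Longrightarrow> laplace U t = laplace g t / (1 - laplace g t)"
    "\<And>x. 0 < x \<Longrightarrow> x * U x = conv (\<lambda>_. 1) (deriv_times_density U) x"
proof -
  obtain V where V: "\<And>t. \<theta>0 \<le> t \<Longrightarrow> exp_integrable t V" "\<And>t. \<theta>0 \<le> t \<Longrightarrow> laplace V t = laplace g t / (1 - laplace g t)"
    using renewal_density_exists[OF integrable nonneg laplace_less_1] by blast
  have R: "exp_integrable t (deriv_times_density V)" if "\<theta>0 \<le> t" for t using laplace_deriv_times_density(1)[OF that V(1)[OF that]] .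
  define U where "U x = conv (\<lambda>_. 1) (deriv_times_density V) x / x" for x
  have Uc: "continuous_on {0<..} U"
    unfolding U_def
    by (intro continuous_intros continuous_on_subset[OF continuous_on_primitive[OF R[OF order_refl]]]) auto
  have ae: "AE x in lborel. 0 < x \<longrightarrow> V x = U x"
  proof -
    have "AE x in lborel. 0 < x \<longrightarrow> x * V x = conv (\<lambda>_. 1) (deriv_times_density V) x"
    proof (rule laplace_inject[where \<theta> = "\<theta>0 + 1"])
      show "exp_integrable (\<theta>0 + 1) (\<lambda>x. x * V x)" by (rule exp_integrable_times_x[OF V(1)]) auto
      show "exp_integrable (\<theta>0 + 1) (conv (\<lambda>_. 1) (deriv_times_density V))"
        using pos by (intro conv_laplace exp_integrable_const R) auto
      show "laplace (\<lambda>x. x * V x) t = laplace (conv (\<lambda>_. 1) (deriv_times_density V)) t" if "\<theta>0 + 1 \<le> t" for t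
        using that pos laplace_times_renewal_density[OF V, of t] by (simp add: conv_laplace exp_integrable_const R)
    qed
    then show ?thesis by eventually_elim (auto simp: U_def field_simps)
  qed
  have Ui: "exp_integrable t U" "laplace U t = laplace V t" if "\<theta>0 \<le> t" for t
    using AE_eq_imp_exp_integrable_cong[OF V(1)[OF that] ae measurable_on_positive[OF Uc]] .
  have RU: "exp_integrable t (deriv_times_density U)" if "\<theta>0 \<le> t" for t using laplace_deriv_times_density(1)[OF that Ui(1)[OF that]] .
  have "AE x in lborel. 0 < x \<longrightarrow> deriv_times_density V x = deriv_times_density U x"
    by (rule laplace_inject[OF R[OF order_refl] RU[OF order_refl]]) (simp add: laplace_deriv_times_density V Ui)
  then have "conv (\<lambda>_. 1) (deriv_times_density V) x = conv (\<lambda>_. 1) (deriv_times_density U) x" for x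
    by (rule primitive_cong_AE[OF R[OF order_refl] RU[OF order_refl]])
  then have "x * U x = conv (\<lambda>_. 1) (deriv_times_density U) x" if "0 < x" for x using that by (simp add: U_def)
  then show ?thesis using that[of U] Uc Ui V by simp
qed

text \<open>
  Both directions are bootstraps. If \<open>g\<close> is \<open>C\<^sup>n\<close>, then \<open>p\<close> is \<open>C\<^bsup>n-1\<^esup>\<close>, and as long as \<open>m < n\<close> a \<open>C\<^sup>m\<close> density
  \<open>U\<close> makes \<open>(x U)'\<close> of class \<open>C\<^sup>m\<close>, hence \<open>U\<close> of class \<open>C\<^bsup>m+1\<^esup>\<close>.
  
  Conversely the roles of \<open>g\<close> and \<open>- U\<close> are exchanged. With \<open>s = x U'\<close>, which is \<open>C\<^bsup>n-1\<^esup>\<close> and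
  integrable at \<open>0\<close>, one solves for \<open>p = g * g - s * (\<epsilon> - g) * (\<epsilon> - g)\<close>, so that \<open>(x g)' = g - p\<close> is
  \<open>C\<^sup>m\<close> whenever \<open>g\<close> is.
\<close>
lemma renewal_density_smooth_iff:
  assumes Uc: "continuous_on {0<..} U" and Ui: "\<And>t. \<theta>0 < t \<Longrightarrow> exp_integrable t U"
    and Ul: "\<And>t. \<theta>0 < t \<Longrightarrow> laplace U t = laplace g t / (1 - laplace g t)"
    and xU: "\<And>x. 0 < x \<Longrightarrow> x * U x = conv (\<lambda>_. 1) (deriv_times_density U) x"
  shows "C_k_on n U {0<..} \<longleftrightarrow> C_k_on n g {0<..}"
proof
  note S = open_greaterThan[of "0::real"]
  define \<theta> where "\<theta> = \<theta>0 + 1"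
  have \<theta>: "\<theta>0 < \<theta>" "\<theta>0 \<le> \<theta>" by (auto simp: \<theta>_def)
  note pi = exp_integrable_mono[OF p_integrable \<theta>(2)] and gi = exp_integrable_mono[OF integrable \<theta>(2)]
  note U\<theta> = Ui[OF \<theta>(1)]
  note Ri = laplace_deriv_times_density(1)[OF \<theta>(2) U\<theta>]
  have divide: "C_k_on k f {0<..}" if "C_k_on k (\<lambda>x. x * f x) {0<..}" for k f
    by (rule C_k_on_cong[OF S _ C_k_on_mult[OF S C_k_on_inverse that]]) auto
  {
    assume g: "C_k_on n g {0<..}"
    have "C_k_on m U {0<..}" if "m \<le> n" for m
      using that
    proof (induction m)
      case 0
      show ?case using Uc by (simp add: C_k_on_0)
    next
      case (Suc m)
      then have U: "C_k_on m U {0<..}" by simp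
      have "C_k_on m (deriv g) {0<..}" using C_k_on_SucD(2)[OF S C_k_on_le[OF S g Suc.prems]] .
      then have p: "C_k_on m p {0<..}"
        unfolding p_def using C_k_on_mult[OF S C_k_on_cmult[OF S C_k_on_ident[OF S], of m "- 1"]] by simp
      have "C_k_on m (deriv_times_density U) {0<..}"
        unfolding deriv_times_density_def using p U
        by (intro C_k_on_add C_k_on_diff C_k_on_cmult S C_k_on_conv[where \<theta> = \<theta>] conv_laplace(1) pi U\<theta>)
      from C_k_on_primitive[OF this Ri] have "C_k_on (Suc m) (\<lambda>x. x * U x) {0<..}"
        by (rule C_k_on_cong[OF S, rotated]) (use xU in auto)
      then show ?case by (rule divide)
    qed
    then show "C_k_on n U {0<..}" by simp
  }
  {
    assume U: "C_k_on n U {0<..}"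
    show "C_k_on n g {0<..}"
    proof (cases n)
      case 0
      then show ?thesis using continuous by (simp add: C_k_on_0)
    next
      case (Suc k)
      have xUs: "C_k_on (Suc k) (\<lambda>x. x * U x) {0<..}" using C_k_on_mult[OF S C_k_on_ident[OF S] U] Suc by simp
      have Q: "C_k_on (Suc k) (conv (\<lambda>_. 1) (deriv_times_density U)) {0<..}" by (rule C_k_on_cong[OF S _ xUs]) (use xU in auto)
      \<comment> \<open>\<open>p\<close> is not known to be continuous here, so \<open>(x U)' = q\<close> is matched with its formula only
        almost everywhere; this suffices for the transforms.\<close>
      define q where "q = deriv (conv (\<lambda>_. 1) (deriv_times_density U))"
      \<comment> \<open>On \<open>(0,\<infinity>)\<close> this is \<open>x U'(x)\<close>.\<close>
      define s where "s x = q x - U x" for x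
      have q: "C_k_on k q {0<..}" using C_k_on_SucD(2)[OF S Q] by (simp add: q_def)
      have s: "C_k_on k s {0<..}" unfolding s_def
        using C_k_on_lower[OF S, of k U] U Suc by (intro C_k_on_diff S q) auto
      have qR: "AE x in lborel. 0 < x \<longrightarrow> deriv_times_density U x = q x"
        using deriv_primitive_AE[OF Ri _ C_k_on_imp_continuous_on[OF S q]] C_k_on_SucD(1)[OF S Q]
        by (auto simp: q_def elim!: eventually_mono)
      have qi: "exp_integrable t q" "laplace q t = laplace (deriv_times_density U) t" if "\<theta>0 < t" for t
        using AE_eq_imp_exp_integrable_cong[OF laplace_deriv_times_density(1)[OF less_imp_le[OF that] Ui[OF that]] qR
           measurable_on_positive[OF C_k_on_imp_continuous_on[OF S q]]] .
      have si: "exp_integrable t s" if "\<theta>0 < t" for t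
        unfolding s_def by (intro exp_integrable_diff qi Ui that)
      have sl: "laplace s t = ((laplace g t)\<^sup>2 - laplace p t) / (1 - laplace g t)\<^sup>2" if t: "\<theta>0 < t" for t
      proof -
        let ?G = "laplace g t" and ?P = "laplace p t"
        have G: "?G < 1" using laplace_bounds t by simp
        have "laplace s t = laplace (deriv_times_density U) t - laplace U t"
          unfolding s_def using qi[OF t] by (simp add: exp_integrable_diff Ui[OF t])
        also have "\<dots> = (laplace U t)\<^sup>2 - ?P * (1 + laplace U t)\<^sup>2"
          unfolding laplace_deriv_times_density(2)[OF less_imp_le[OF t] Ui[OF t]] by (simp add: power2_eq_square algebra_simps)
        also have "1 + laplace U t = 1 / (1 - ?G)" using G Ul[OF t] by (simp add: field_simps)
        also have "(laplace U t)\<^sup>2 - ?P * (1 / (1 - ?G))\<^sup>2 = (?G\<^sup>2 - ?P) / (1 - ?G)\<^sup>2"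
          unfolding Ul[OF t] by (simp add: power_divide diff_divide_distrib)
        finally show ?thesis .
      qed
      define T where "T x = conv g g x - s x + 2 * conv s g x - conv (conv s g) g x" for x
      have Ti: "exp_integrable t T" "laplace T t = (laplace g t)\<^sup>2 - laplace s t * (1 - laplace g t)\<^sup>2" if t: "\<theta>0 < t" for t
      proof -
        note [simp] = si[OF t] exp_integrable_mono[OF integrable less_imp_le[OF t]]
          exp_integrable_add exp_integrable_diff exp_integrable_cmult conv_laplace
        show "exp_integrable t T" unfolding T_def by simp
        show "laplace T t = (laplace g t)\<^sup>2 - laplace s t * (1 - laplace g t)\<^sup>2"
          unfolding T_def by (simp add: power2_eq_square algebra_simps)
      qed
      have "AE x in lborel. 0 < x \<longrightarrow> p x = T x"
      proof (rule laplace_inject[OF pi Ti(1)[OF \<theta>(1)]])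
        fix t assume "\<theta> \<le> t"
        then have t: "\<theta>0 < t" using \<theta> by simp
        have "laplace g t < 1" using laplace_bounds t by simp
        then show "laplace p t = laplace T t" by (simp add: Ti[OF t] sl[OF t])
      qed
      then have "AE x in lborel. 0 < x \<longrightarrow> g x - p x = g x - T x" by eventually_elim auto
      then have "conv (\<lambda>_. 1) (\<lambda>y. g y - p y) x = conv (\<lambda>_. 1) (\<lambda>y. g y - T y) x" for x
        by (intro primitive_cong_AE[where \<theta> = \<theta>] exp_integrable_diff gi pi Ti(1)[OF \<theta>(1)])
      then have xg: "x * g x = conv (\<lambda>_. 1) (\<lambda>y. g y - T y) x" if "0 < x" for x
        using times_g_eq_primitive[OF that] by simp
      have "C_k_on m g {0<..}" if "m \<le> Suc k" for m
        using that
      proof (induction m)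
        case 0
        show ?case using continuous by (simp add: C_k_on_0)
      next
        case (Suc m)
        then have g: "C_k_on m g {0<..}" and sm: "C_k_on m s {0<..}" using C_k_on_le[OF S s, of m] by auto
        have "C_k_on m (\<lambda>y. g y - T y) {0<..}"
          unfolding T_def using g sm
          by (intro C_k_on_add C_k_on_diff C_k_on_cmult S C_k_on_conv[where \<theta> = \<theta>] conv_laplace(1) gi si \<theta>(1))
        from C_k_on_primitive[OF this exp_integrable_diff(1)[OF gi Ti(1)[OF \<theta>(1)]]]
        have "C_k_on (Suc m) (\<lambda>x. x * g x) {0<..}"
          by (rule C_k_on_cong[OF S, rotated]) (use xg in auto)
        then show ?case by (rule divide)
      qed
      then show ?thesis using Suc by simp
    qed
  }
qed

text \<open>
  The renewal function \<open>c (1 + \<integral>\<^sub>0\<^sup>x U)\<close> has the given transform, so it is \<open>W\<close>, and its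
  derivative is \<open>c U\<close>.
\<close>
theorem renewal_function_smooth_iff:
  assumes W: "continuous_on {0..} W" and c: "c \<noteq> 0"
    and Wi: "\<And>t. \<theta>1 < t \<Longrightarrow> exp_integrable t W"
    and Wl: "\<And>t. \<theta>1 < t \<Longrightarrow> \<theta>0 < t \<Longrightarrow> laplace W t = c / (t * (1 - laplace g t))"
  shows "C_k_on (n + 1) W {0<..} \<longleftrightarrow> C_k_on n g {0<..}"
proof -
  note S = open_greaterThan[of "0::real"]
  obtain U where Uc: "continuous_on {0<..} U" and Ui: "\<And>t. \<theta>0 < t \<Longrightarrow> exp_integrable t U"
    and Ul: "\<And>t. \<theta>0 < t \<Longrightarrow> laplace U t = laplace g t / (1 - laplace g t)"
    and xU: "\<And>x. 0 < x \<Longrightarrow> x * U x = conv (\<lambda>_. 1) (deriv_times_density U) x"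
    using continuous_renewal_density by blast
  define \<theta> where "\<theta> = max \<theta>0 \<theta>1 + 1"
  have \<theta>: "\<theta>0 < \<theta>" "\<theta>1 < \<theta>" by (auto simp: \<theta>_def)
  define V where "V x = c * (1 + conv (\<lambda>_. 1) U x)" for x
  have Vi: "exp_integrable t V" "laplace V t = c * (1 / t + laplace U t / t)" if "\<theta>0 < t" for t
  proof -
    note [simp] = Ui[OF that] exp_integrable_add exp_integrable_cmult conv_laplace exp_integrable_const
    have "0 < t" using that pos by simp
    then show "exp_integrable t V" "laplace V t = c * (1 / t + laplace U t / t)" unfolding V_def by simp_all
  qed
  have ae: "AE x in lborel. 0 < x \<longrightarrow> W x = V x"
  proof (rule laplace_inject[OF Wi[OF \<theta>(2)] Vi(1)[OF \<theta>(1)]])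
    fix t assume "\<theta> \<le> t"
    then have t: "\<theta>0 < t" "\<theta>1 < t" "0 < t" using \<theta> pos by auto
    have "laplace g t < 1" using laplace_bounds t by simp
    then show "laplace W t = laplace V t"
      using t by (simp add: Wl[OF t(2,1)] Vi(2)[OF t(1)] Ul[OF t(1)] field_simps)
  qed
  have eq: "W x = V x" if "0 < x" for x
  proof (rule eq_if_AE_eq_continuous[OF _ _ ae that])
    show "continuous_on {0<..} W" by (rule continuous_on_subset[OF W]) auto
    show "continuous_on {0<..} V"
      unfolding V_def by (intro continuous_intros continuous_on_subset[OF continuous_on_primitive[OF Ui[OF \<theta>(1)]]]) auto
  qed
  have "(V has_real_derivative c * U x) (at x)" if "0 < x" for x
    unfolding V_def using has_derivative_primitive[OF Ui[OF \<theta>(1)] Uc that]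
    by (auto intro!: derivative_eq_intros)
  then have dW: "(W has_real_derivative c * U x) (at x)" if "x \<in> {0<..}" for x
    by (rule has_field_derivative_transform_within_open[OF _ S that]) (use that eq in auto)
  have "C_k_on (n + 1) W {0<..} \<longleftrightarrow> C_k_on n U {0<..}"
  proof
    assume "C_k_on (n + 1) W {0<..}"
    then have "C_k_on n (deriv W) {0<..}" using C_k_on_SucD(2)[OF S] by simp
    from C_k_on_cmult[OF S this, of "1 / c"] show "C_k_on n U {0<..}"
      by (rule C_k_on_cong[OF S, rotated]) (use c DERIV_imp_deriv[OF dW] in auto)
  next
    assume "C_k_on n U {0<..}"
    then show "C_k_on (n + 1) W {0<..}"
      using C_k_on_SucI[OF S dW C_k_on_cmult[OF S, of n U c]] by simp
  qed
  also have "\<dots> \<longleftrightarrow> C_k_on n g {0<..}"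
    by (rule renewal_density_smooth_iff[OF Uc Ui Ul xU])
  finally show ?thesis .
qed

end

section \<open>Tails of Levy measures\<close>

lemma emeasure_tail_finite:
  assumes \<nu>: "levy_measure \<nu>" and x: "0 < x"
  shows "emeasure \<nu> {..<- x} < \<infinity>"
proof -
  have [measurable_cong]: "sets \<nu> = sets borel" using \<nu> by (simp add: levy_measure_def)
  define c where "c = min 1 (x\<^sup>2)"
  have c: "0 < c" using x by (simp add: c_def)
  have "ennreal c * emeasure \<nu> {..<- x} = (\<integral>\<^sup>+y. ennreal c * indicator {..<- x} y \<partial>\<nu>)"
    by (simp add: nn_integral_cmult_indicator)
  also have "\<dots> \<le> (\<integral>\<^sup>+y\<in>{..<0}. ennreal (min 1 (y\<^sup>2)) \<partial>\<nu>)"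
  proof (rule nn_integral_mono)
    fix y
    show "ennreal c * indicator {..<- x} y \<le> ennreal (min 1 (y\<^sup>2)) * indicator {..<0} y"
    proof (cases "y < - x")
      case True
      then have "x\<^sup>2 \<le> y\<^sup>2" using x by (intro abs_le_square_iff[THEN iffD1]) auto
      then have "c \<le> min 1 (y\<^sup>2)" unfolding c_def by (rule min.mono[OF order_refl])
      then show ?thesis using True x by (simp add: ennreal_leI)
    qed simp
  qed
  also have "\<dots> < \<infinity>" using \<nu> by (simp add: levy_measure_def)
  finally have "ennreal c * emeasure \<nu> {..<- x} < \<infinity>" .
  then show ?thesis using c by (auto simp: ennreal_mult_less_top)
qed

lemma sigma_finite_levy_measure:
  assumes \<nu>: "levy_measure \<nu>"
  shows "sigma_finite_measure \<nu>"
proof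
  have s: "sets \<nu> = sets borel" using \<nu> by (simp add: levy_measure_def)
  then have sp: "space \<nu> = UNIV" by (metis sets_eq_imp_space_eq space_borel)
  let ?A = "insert {0..} (range (\<lambda>k::nat. {..<- (1 / real (Suc k))}))"
  show "\<exists>A. countable A \<and> A \<subseteq> sets \<nu> \<and> \<Union> A = space \<nu> \<and> (\<forall>a\<in>A. emeasure \<nu> a \<noteq> \<infinity>)"
  proof (intro exI[of _ ?A] conjI)
    show "\<Union> ?A = space \<nu>"
    proof -
      have "x \<in> \<Union> ?A" for x :: real
      proof (cases "0 \<le> x")
        case False
        then obtain k where "1 / real (Suc k) < - x" using nat_approx_posE[of "- x"] by auto
        then have "x \<in> {..<- (1 / real (Suc k))}" by simp
        then show ?thesis by blast
      qed simp
      then show ?thesis using sp by auto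
    qed
    show "\<forall>a\<in>?A. emeasure \<nu> a \<noteq> \<infinity>"
      using \<nu> emeasure_tail_finite[OF \<nu>] by (auto simp: levy_measure_def less_top)
  qed (auto simp: s)
qed

lemma levy_tail_nonneg: "0 \<le> levy_tail \<nu> x"
  by (simp add: levy_tail_def)

lemma levy_tail_antimono:
  assumes \<nu>: "levy_measure \<nu>" and "0 < x" "x \<le> y"
  shows "levy_tail \<nu> y \<le> levy_tail \<nu> x"
  unfolding levy_tail_def
proof (rule measure_mono_fmeasurable)
  show "{..<- x} \<in> fmeasurable \<nu>"
    using emeasure_tail_finite[OF \<nu> assms(2)] \<nu> by (intro fmeasurableI) (auto simp: levy_measure_def)
qed (use assms in \<open>auto simp: levy_measure_def\<close>)

lemma deriv_levy_tail_nonpos: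
  assumes \<nu>: "levy_measure \<nu>" and d: "levy_tail \<nu> differentiable_on {0<..}" and x: "0 < x"
  shows "deriv (levy_tail \<nu>) x \<le> 0"
proof -
  have "(levy_tail \<nu> has_real_derivative deriv (levy_tail \<nu>) x) (at x)"
    using has_real_derivative_deriv[OF _ d] x by simp
  from DERIV_minus[OF this] have "0 \<le> - deriv (levy_tail \<nu>) x"
    by (intro mono_on_imp_deriv_nonneg[of "{0<..}" "\<lambda>x. - levy_tail \<nu> x"])
       (use x in \<open>auto intro!: mono_onI levy_tail_antimono[OF \<nu>] simp: interior_open\<close>)
  then show ?thesis by simp
qed

lemma exp_integrable_powr:
  assumes "\<beta> < 1"
  shows "exp_integrable 1 (\<lambda>x. x powr - \<beta>)"
proof -
  have "(\<lambda>t. t powr ((1 - \<beta>) - 1) / exp t) integrable_on {0..}"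
    using Gamma_integral_real[of "1 - \<beta>"] assms by (auto simp: integrable_on_def)
  then have "(\<lambda>t. t powr - \<beta> / exp t) absolutely_integrable_on {0..}"
    by (intro nonnegative_absolutely_integrable_1) auto
  then have "(\<lambda>t. t powr - \<beta> / exp t) absolutely_integrable_on {0<..}"
    by (rule set_integrable_subset) auto
  moreover have "(\<lambda>x. indicator {0<..} x *\<^sub>R (x powr - \<beta> / exp x)) \<in> borel_measurable borel" for x :: real
    by measurable
  ultimately have "integrable lborel (\<lambda>x. indicator {0<..} x *\<^sub>R (x powr - \<beta> / exp x))"
    unfolding set_integrable_def by (subst (asm) integrable_completion) auto
  then show ?thesis
    unfolding exp_integrable_def set_integrable_def by (simp add: exp_minus field_simps)
qed

text \<open>
  Integrating the bound on the density gives \<open>O(x\<^bsup>-\<beta>\<^esup>)\<close> for the tail near \<open>0\<close>, with \<open>\<beta> < 1\<close>. This is the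
  integrability of \<open>min 1 \<bar>x\<bar>\<close> for the Levy measure in another guise.
\<close>
lemma levy_tail_exp_integrable:
  assumes \<nu>: "levy_measure \<nu>" and d: "levy_tail \<nu> differentiable_on {0<..}"
    and bound: "\<exists>\<alpha><1. \<exists>C>0. \<forall>\<^sub>F x in at_right 0. - deriv (levy_tail \<nu>) x \<le> C * x powr (- 1 - \<alpha>)"
  shows "exp_integrable 1 (levy_tail \<nu>)"
proof -
  let ?T = "levy_tail \<nu>"
  obtain \<alpha> C where \<alpha>: "\<alpha> < 1" and C: "0 < C"
    and ev: "\<forall>\<^sub>F x in at_right 0. - deriv ?T x \<le> C * x powr (- 1 - \<alpha>)"
    using bound by blast
  obtain b0 where b0: "0 < b0" "\<And>x. 0 < x \<Longrightarrow> x < b0 \<Longrightarrow> - deriv ?T x \<le> C * x powr (- 1 - \<alpha>)"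
    using ev unfolding eventually_at_right_field by auto
  \<comment> \<open>On \<open>(0,1]\<close> the bound only weakens when the exponent grows, and for \<open>\<beta> > 0\<close> the power
    \<open>x\<^bsup>-1-\<beta>\<^esup>\<close> has the antiderivative \<open>- x\<^bsup>-\<beta>\<^esup> / \<beta>\<close>.\<close>
  define \<beta> where "\<beta> = max \<alpha> (1 / 2)"
  have \<beta>: "0 < \<beta>" "\<beta> < 1" "\<alpha> \<le> \<beta>" using \<alpha> by (auto simp: \<beta>_def)
  define b where "b = min (b0 / 2) 1"
  have b: "0 < b" "b < b0" "b \<le> 1" using b0 by (auto simp: b_def)
  have near: "?T x \<le> C / \<beta> * x powr - \<beta> + ?T b" if x: "0 < x" "x \<le> b" for x
  proof -
    define h where "h y = ?T y - C / \<beta> * y powr - \<beta>" for y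
    have "h x \<le> h b"
    proof (rule DERIV_nonneg_imp_nondecreasing[OF x(2)])
      fix y assume y: "x \<le> y" "y \<le> b"
      then have y0: "0 < y" using x by simp
      have T: "(?T has_real_derivative deriv ?T y) (at y)"
        using has_real_derivative_deriv[OF _ d] y0 by simp
      have P: "((\<lambda>y. y powr - \<beta>) has_real_derivative - \<beta> * y powr (- \<beta> - 1)) (at y)"
        by (rule has_real_derivative_powr[OF y0])
      have "(h has_real_derivative deriv ?T y - C / \<beta> * (- \<beta> * y powr (- \<beta> - 1))) (at y)"
        unfolding h_def by (intro DERIV_diff T DERIV_cmult P)
      moreover have "0 \<le> deriv ?T y - C / \<beta> * (- \<beta> * y powr (- \<beta> - 1))"
      proof -
        have "- deriv ?T y \<le> C * y powr (- 1 - \<alpha>)" using b0(2)[OF y0] y b by simp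
        also have "\<dots> \<le> C * y powr (- \<beta> - 1)"
          using C y y0 b \<beta> by (intro mult_left_mono powr_mono') auto
        finally show ?thesis using \<beta> by simp
      qed
      ultimately show "\<exists>z. (h has_real_derivative z) (at y) \<and> 0 \<le> z" by blast
    qed
    moreover have "0 \<le> C / \<beta> * b powr - \<beta>" using C \<beta> by simp
    ultimately show ?thesis by (simp add: h_def)
  qed
  have all: "?T x \<le> C / \<beta> * x powr - \<beta> + ?T b" if x: "0 < x" for x
  proof (cases "x \<le> b")
    case False
    then have "?T x \<le> ?T b" by (intro levy_tail_antimono[OF \<nu> b(1)]) simp
    moreover have "0 \<le> C / \<beta> * x powr - \<beta>" using C \<beta> by simp
    ultimately show ?thesis by linarith
  qed (use near x in auto)
  have i: "exp_integrable 1 (\<lambda>x. C / \<beta> * x powr - \<beta> + ?T b)"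
    by (intro exp_integrable_add exp_integrable_cmult exp_integrable_powr exp_integrable_const) (use \<beta> in auto)
  show ?thesis
  proof (rule exp_integrable_bound[OF i, where c = 1])
    show "(\<lambda>x. indicator {0<..} x * ?T x) \<in> borel_measurable borel"
      by (rule measurable_on_positive[OF differentiable_imp_continuous_on[OF d]])
    show "exp (- 1 * x) * \<bar>?T x\<bar> \<le> 1 * (exp (- 1 * x) * \<bar>C / \<beta> * x powr - \<beta> + ?T b\<bar>)" if "0 < x" for x
      using all[OF that] levy_tail_nonneg[of \<nu> x] by (simp add: mult_left_mono)
  qed
qed

text \<open>
  Tonelli for the representation of \<open>1 - e\<^bsup>\<theta>y\<^esup>\<close> as the integral of \<open>\<theta> e\<^bsup>-\<theta>x\<^esup>\<close> over \<open>0 < x < - y\<close>.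
\<close>
lemma laplace_levy_tail:
  assumes \<nu>: "levy_measure \<nu>" and i: "exp_integrable \<theta> (levy_tail \<nu>)" and \<theta>: "0 < \<theta>"
  shows "set_integrable \<nu> {..<0} (\<lambda>y. 1 - exp (\<theta> * y))"
    "(LINT y:{..<0}|\<nu>. 1 - exp (\<theta> * y)) = \<theta> * laplace (levy_tail \<nu>) \<theta>"
proof -
  interpret \<nu>: sigma_finite_measure \<nu> by (rule sigma_finite_levy_measure[OF \<nu>])
  interpret pair_sigma_finite \<nu> lborel ..
  have s[measurable_cong]: "sets \<nu> = sets borel" using \<nu> by (simp add: levy_measure_def)
  define k :: "real \<Rightarrow> real \<Rightarrow> ennreal" where "k x y = ennreal (\<theta> * exp (- \<theta> * x)) * (if 0 < x \<and> x < - y then 1 else 0)" for x y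
  have inner1: "(\<integral>\<^sup>+y. k x y \<partial>\<nu>) = ennreal (indicator {0<..} x *\<^sub>R (\<theta> * (exp (- \<theta> * x) * levy_tail \<nu> x)))" for x
  proof (cases "0 < x")
    case True
    have "(\<integral>\<^sup>+y. k x y \<partial>\<nu>) = (\<integral>\<^sup>+y. ennreal (\<theta> * exp (- \<theta> * x)) * indicator {..<- x} y \<partial>\<nu>)"
      using True by (intro nn_integral_cong) (auto simp: k_def indicator_def)
    also have "\<dots> = ennreal (\<theta> * exp (- \<theta> * x)) * emeasure \<nu> {..<- x}"
      by (simp add: nn_integral_cmult_indicator)
    also have "emeasure \<nu> {..<- x} = ennreal (levy_tail \<nu> x)"
      unfolding levy_tail_def using emeasure_tail_finite[OF \<nu> True] by (intro emeasure_eq_ennreal_measure) (simp add: less_top)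
    finally show ?thesis using True \<theta> by (simp add: ennreal_mult'[symmetric] mult.assoc)
  qed (simp add: k_def)
  have inner2: "(\<integral>\<^sup>+x. k x y \<partial>lborel) = ennreal (indicator {..<0} y *\<^sub>R (1 - exp (\<theta> * y)))" for y
  proof (cases "y < 0")
    case True
    have "(\<integral>\<^sup>+x. k x y \<partial>lborel) = (\<integral>\<^sup>+x. ennreal (\<theta> * exp (- \<theta> * x)) * indicator {0..- y} x \<partial>lborel)"
    proof (rule nn_integral_cong_AE)
      show "AE x in lborel. k x y = ennreal (\<theta> * exp (- \<theta> * x)) * indicator {0..- y} x"
        using AE_lborel_singleton[of 0] AE_lborel_singleton[of "- y"]
        by eventually_elim (auto simp: k_def indicator_def)
    qed
    also have "\<dots> = ennreal (- exp (- \<theta> * - y) - - exp (- \<theta> * 0))"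
      by (rule nn_integral_FTC_Icc) (use \<theta> True in \<open>auto intro!: derivative_eq_intros\<close>)
    finally show ?thesis using True by simp
  next
    case False
    then have "k x y = 0" for x by (auto simp: k_def)
    then show ?thesis using False by simp
  qed
  have "(\<integral>\<^sup>+y. ennreal (indicator {..<0} y *\<^sub>R (1 - exp (\<theta> * y))) \<partial>\<nu>) = (\<integral>\<^sup>+y. (\<integral>\<^sup>+x. k x y \<partial>lborel) \<partial>\<nu>)"
    by (simp add: inner2)
  also have "\<dots> = (\<integral>\<^sup>+x. (\<integral>\<^sup>+y. k x y \<partial>\<nu>) \<partial>lborel)"
    by (rule Fubini'[symmetric]) (unfold k_def, measurable)
  also have "\<dots> = (\<integral>\<^sup>+x. ennreal (\<theta> * (indicator {0<..} x *\<^sub>R (exp (- \<theta> * x) * levy_tail \<nu> x))) \<partial>lborel)"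
    by (simp add: inner1 mult.left_commute)
  also have "\<dots> = ennreal (\<theta> * laplace (levy_tail \<nu>) \<theta>)"
    unfolding laplace_def set_lebesgue_integral_def
    by (subst nn_integral_eq_integral)
       (use i \<theta> levy_tail_nonneg in \<open>auto simp: exp_integrable_def set_integrable_def\<close>)
  finally have nn: "(\<integral>\<^sup>+y. ennreal (indicator {..<0} y *\<^sub>R (1 - exp (\<theta> * y))) \<partial>\<nu>) = ennreal (\<theta> * laplace (levy_tail \<nu>) \<theta>)" .
  have "has_bochner_integral \<nu> (\<lambda>y. indicator {..<0} y *\<^sub>R (1 - exp (\<theta> * y))) (\<theta> * laplace (levy_tail \<nu>) \<theta>)"
  proof (rule has_bochner_integral_nn_integral[OF _ _ _ nn])
    show "0 \<le> \<theta> * laplace (levy_tail \<nu>) \<theta>"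
      using \<theta> laplace_nonneg[of "levy_tail \<nu>"] levy_tail_nonneg by simp
    show "AE y in \<nu>. 0 \<le> indicator {..<0} y *\<^sub>R (1 - exp (\<theta> * y))"
      using \<theta> by (intro AE_I2) (auto simp: indicator_def mult_nonneg_nonpos)
  qed measurable
  then show "set_integrable \<nu> {..<0} (\<lambda>y. 1 - exp (\<theta> * y))"
    "(LINT y:{..<0}|\<nu>. 1 - exp (\<theta> * y)) = \<theta> * laplace (levy_tail \<nu>) \<theta>"
    by (auto simp: has_bochner_integral_iff set_integrable_def set_lebesgue_integral_def)
qed

text \<open>
  Once \<open>1 - e\<^sup>x\<close> is integrable, so is the compensator \<open>x\<close> on \<open>(-1,0)\<close>; it can be split off, and its
  integral only changes the linear coefficient.
\<close>
lemma laplace_exponent_via_tail: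
  assumes lk: "levy_khintchine \<psi> a \<sigma> \<nu>" and i: "exp_integrable 1 (levy_tail \<nu>)"
  obtains \<delta> where "\<And>\<theta>. 1 \<le> \<theta> \<Longrightarrow> \<psi> \<theta> = \<delta> * \<theta> + 1 / 2 * \<sigma>\<^sup>2 * \<theta>\<^sup>2 - \<theta> * laplace (levy_tail \<nu>) \<theta>"
proof -
  have \<nu>: "levy_measure \<nu>" using lk by (simp add: levy_khintchine_def)
  have s[measurable_cong]: "sets \<nu> = sets borel" using \<nu> by (simp add: levy_measure_def)
  let ?t = "\<lambda>x::real. x * indicator {-1<..} x"
  have ti: "set_integrable \<nu> {..<0} ?t"
    unfolding set_integrable_def
  proof (rule Bochner_Integration.integrable_bound)
    show "integrable \<nu> (\<lambda>x. exp 1 * (indicator {..<0} x *\<^sub>R (1 - exp (1 * x))))"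
      using laplace_levy_tail(1)[OF \<nu> i] by (simp add: set_integrable_def)
    show "(\<lambda>x. indicator {..<0} x *\<^sub>R ?t x) \<in> borel_measurable \<nu>" by measurable
    show "AE x in \<nu>. norm (indicator {..<0} x *\<^sub>R ?t x) \<le> norm (exp 1 * (indicator {..<0} x *\<^sub>R (1 - exp (1 * x))))"
    proof (rule AE_I2)
      fix x :: real
      show "norm (indicator {..<0} x *\<^sub>R ?t x) \<le> norm (exp 1 * (indicator {..<0} x *\<^sub>R (1 - exp (1 * x))))"
      proof (cases "-1 < x \<and> x < 0")
        case True
        have "1 + (- x) \<le> exp (- x)" by (rule exp_ge_add_one_self)
        then have "- x \<le> exp (- x) * (1 - exp x)" by (simp add: right_diff_distrib exp_add[symmetric])
        also have "\<dots> \<le> exp 1 * (1 - exp x)" using True by (intro mult_right_mono) auto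
        finally show ?thesis using True by (simp add: abs_mult)
      qed (auto simp: indicator_def)
    qed
  qed
  define m where "m = (LINT x:{..<0}|\<nu>. ?t x)"
  show ?thesis
  proof (rule that[of "a - m"])
    fix \<theta> :: real assume \<theta>: "1 \<le> \<theta>"
    note e = laplace_levy_tail[OF \<nu> exp_integrable_mono[OF i \<theta>]]
    have ti': "set_integrable \<nu> {..<0} (\<lambda>x. \<theta> * ?t x)" using ti by (rule set_integrable_mult_right)
    have "(LINT x:{..<0}|\<nu>. exp (\<theta> * x) - 1 - \<theta> * x * indicator {-1<..} x)
       = (LINT x:{..<0}|\<nu>. - ((1 - exp (\<theta> * x)) + \<theta> * ?t x))"
      by (rule set_lebesgue_integral_cong) (auto simp: s algebra_simps)
    also have "\<dots> = - (LINT x:{..<0}|\<nu>. (1 - exp (\<theta> * x)) + \<theta> * ?t x)"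
      unfolding set_lebesgue_integral_def by (simp only: scaleR_minus_right integral_minus)
    also have "\<dots> = - (\<theta> * laplace (levy_tail \<nu>) \<theta> + \<theta> * m)"
      using \<theta> e by (subst set_integral_add(2)[OF e(1) ti']) (auto simp: m_def)
    finally show "\<psi> \<theta> = (a - m) * \<theta> + 1 / 2 * \<sigma>\<^sup>2 * \<theta>\<^sup>2 - \<theta> * laplace (levy_tail \<nu>) \<theta>"
      using lk \<theta> by (simp add: levy_khintchine_def algebra_simps)
  qed
qed

section \<open>Laplace exponents of processes of bounded variation\<close>

text \<open>
  A combination of \<open>e\<^sup>x - 1\<close> and \<open>e\<^bsup>2x\<^esup> - 1\<close> that is bounded above and of order \<open>\<bar>x\<bar>\<close> at \<open>0\<close>, but whose
  second-order coefficient \<open>6 - 4\<close> is still positive, so that it detects a Gaussian part. With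
  \<open>y = e\<^sup>x\<close> the left-hand side is \<open>(y - 1) (5 - y)\<close>, and \<open>25/4\<close> is the maximum of \<open>y (5 - y)\<close>.
\<close>
lemma exp_combination_le:
  fixes x :: real
  shows "6 * (exp x - 1) - (exp (2 * x) - 1) \<le> 25 / 4 * (1 - exp (- \<bar>x\<bar>))"
proof -
  define y where "y = exp x"
  have y: "0 < y" by (simp add: y_def)
  have sq: "exp (2 * x) = y\<^sup>2" unfolding y_def by (rule exp_double)
  have *: "6 * (exp x - 1) - (exp (2 * x) - 1) = (y - 1) * (5 - y)"
    unfolding sq y_def[symmetric] by (simp add: power2_eq_square algebra_simps)
  show ?thesis
  proof (cases "0 \<le> x")
    case True
    then have y1: "1 \<le> y" by (simp add: y_def)
    have "0 \<le> (y - 5 / 2)\<^sup>2" by simp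
    then have "y * (5 - y) \<le> 25 / 4" by (simp add: power2_eq_square algebra_simps)
    then have "5 - y \<le> 25 / 4 / y" using y by (simp add: field_simps)
    then have "(y - 1) * (5 - y) \<le> (y - 1) * (25 / 4 / y)" using y1 by (intro mult_left_mono) auto
    also have "\<dots> = 25 / 4 * (1 - exp (- \<bar>x\<bar>))" using True y by (simp add: exp_minus y_def[symmetric] field_simps)
    finally show ?thesis using * by simp
  next
    case False
    then have "y < 1" by (simp add: y_def)
    then have "(y - 1) * (5 - y) \<le> 0" by (intro mult_nonpos_nonneg) auto
    moreover have "0 \<le> 25 / 4 * (1 - exp (- \<bar>x\<bar>))" by simp
    ultimately show ?thesis using * by linarith
  qed
qed

context spectrally_negative_levy
begin

lemma measurable_increment:
  assumes "0 \<le> s" "0 \<le> t"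
  shows "(\<lambda>\<omega>. X s \<omega> - X t \<omega>) \<in> borel_measurable M"
  using random_variable_X assms by measurable

lemma expectation_increment:
  assumes "0 \<le> s" "0 \<le> t" and [measurable]: "f \<in> borel_measurable borel"
  shows "expectation (\<lambda>\<omega>. f (X (s + t) \<omega> - X s \<omega>)) = (expectation (\<lambda>\<omega>. f (X t \<omega>)) :: real)"
proof -
  have [measurable]: "X t \<in> borel_measurable M" "(\<lambda>\<omega>. X (s + t) \<omega> - X s \<omega>) \<in> borel_measurable M"
    using assms random_variable_X measurable_increment[of "s + t" s] by auto
  have "expectation (\<lambda>\<omega>. f (X (s + t) \<omega> - X s \<omega>)) = (\<integral>x. f x \<partial>distr M borel (\<lambda>\<omega>. X (s + t) \<omega> - X s \<omega>))"
    by (subst integral_distr) auto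
  also have "\<dots> = expectation (\<lambda>\<omega>. f (X t \<omega>))"
    unfolding stationary_increments[OF assms(1,2)] by (subst integral_distr) auto
  finally show ?thesis .
qed

text \<open>
  The variation on \<open>[0,1]\<close> along the uniform grid of mesh \<open>1/N\<close>: a sum of \<open>N\<close> independent copies
  of \<open>\<bar>X\<^bsub>1/N\<^esub>\<bar>\<close>.
\<close>
definition grid_variation :: "nat \<Rightarrow> 'a \<Rightarrow> real" where
  "grid_variation N \<omega> = (\<Sum>i<N. \<bar>X (real (Suc i) / real N) \<omega> - X (real i / real N) \<omega>\<bar>)"

lemma measurable_grid_variation [measurable]: "grid_variation N \<in> borel_measurable M"
  unfolding grid_variation_def using measurable_increment by measurable

lemma grid_variation_bounded:
  assumes "bounded_variation_on (\<lambda>t. X t \<omega>) {0..1}"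
  shows "\<exists>B. \<forall>N\<ge>1. grid_variation N \<omega> \<le> B"
proof -
  obtain B where B: "\<And>(ts :: nat \<Rightarrow> real) n. mono ts \<Longrightarrow> range ts \<subseteq> {0..1} \<Longrightarrow>
      (\<Sum>i<n. \<bar>X (ts (Suc i)) \<omega> - X (ts i) \<omega>\<bar>) \<le> B"
    using assms unfolding bounded_variation_on_def by blast
  have "grid_variation N \<omega> \<le> B" if N: "1 \<le> N" for N
  proof -
    \<comment> \<open>The partition has to stay in \<open>[0,1]\<close> for all indices, hence the truncation.\<close>
    define ts where "ts i = min 1 (real i / real N)" for i :: nat
    have "(\<Sum>i<N. \<bar>X (ts (Suc i)) \<omega> - X (ts i) \<omega>\<bar>) \<le> B"
    proof (rule B)
      show "mono ts"
        unfolding mono_def ts_def by (intro allI impI min.mono divide_right_mono) auto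
      show "range ts \<subseteq> {0..1}" by (auto simp: ts_def)
    qed
    moreover have "ts i = real i / real N" if "i \<le> N" for i
      using that N by (auto simp: ts_def min_def field_simps)
    ultimately show ?thesis by (simp add: grid_variation_def Suc_le_eq)
  qed
  then show ?thesis by blast
qed

lemma grid_variation_bounded_in_probability:
  assumes "bounded_variation_paths M X"
  obtains K :: nat where "1 / 2 < prob {\<omega> \<in> space M. \<forall>N\<ge>1. grid_variation N \<omega> \<le> real K}"
proof -
  define E where "E K = {\<omega> \<in> space M. \<forall>N\<ge>1. grid_variation N \<omega> \<le> real K}" for K :: nat
  have [measurable]: "E K \<in> events" for K unfolding E_def by measurable
  have "AE \<omega> in M. \<omega> \<in> (\<Union>K. E K)"
  proof -
    have "AE \<omega> in M. \<forall>T\<ge>0. bounded_variation_on (\<lambda>t. X t \<omega>) {0..T}"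
      using assms by (simp add: bounded_variation_paths_def)
    with AE_space show ?thesis
    proof eventually_elim
      fix \<omega> assume \<omega>: "\<omega> \<in> space M" and bv: "\<forall>T\<ge>0. bounded_variation_on (\<lambda>t. X t \<omega>) {0..T}"
      have "bounded_variation_on (\<lambda>t. X t \<omega>) {0..1}" using bv by simp
      then obtain B where B: "\<forall>N\<ge>1. grid_variation N \<omega> \<le> B" using grid_variation_bounded by blast
      obtain K where "B \<le> real K" using real_arch_simple by blast
      then have "\<omega> \<in> E K" using B \<omega> by (fastforce simp: E_def)
      then show "\<omega> \<in> (\<Union>K. E K)" by blast
    qed
  qed
  then have "prob (\<Union>K. E K) = 1" by (intro prob_eq_1[THEN iffD2]) auto
  moreover have "(\<lambda>K. prob (E K)) \<longlonglongrightarrow> prob (\<Union>K. E K)"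
    by (rule finite_Lim_measure_incseq) (fastforce simp: E_def incseq_def)+
  ultimately have "\<forall>\<^sub>F K in sequentially. 1 / 2 < prob (E K)"
    by (intro order_tendstoD(1)[of _ "prob (\<Union>K. E K)"]) auto
  then obtain K where "1 / 2 < prob (E K)" by (auto simp: eventually_sequentially)
  then show ?thesis using that by (simp add: E_def)
qed

lemma expectation_exp_grid_variation:
  assumes N: "1 \<le> N" and \<theta>: "0 \<le> \<theta>"
  shows "expectation (\<lambda>\<omega>. exp (- \<theta> * grid_variation N \<omega>)) = expectation (\<lambda>\<omega>. exp (- \<theta> * \<bar>X (1 / real N) \<omega>\<bar>)) ^ N"
proof -
  define ts where "ts i = real i / real N" for i :: nat
  define Y where "Y i \<omega> = exp (- \<theta> * \<bar>X (ts (Suc i)) \<omega> - X (ts i) \<omega>\<bar>)" for i \<omega>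
  have ts: "mono ts" "0 \<le> ts 0" "0 \<le> ts i" for i
    by (auto simp: ts_def mono_def intro!: divide_right_mono)
  have "indep_vars (\<lambda>_. borel) (\<lambda>i \<omega>. X (ts (Suc i)) \<omega> - X (ts i) \<omega>) {..<N}"
    by (rule independent_increments[OF ts(1,2)])
  from indep_vars_compose2[OF this, of "\<lambda>_ x. exp (- \<theta> * \<bar>x\<bar>)" "\<lambda>_. borel"]
  have indep: "indep_vars (\<lambda>_. borel) Y {..<N}" by (simp add: Y_def[abs_def])
  have Yi: "integrable M (Y i)" for i
  proof (rule integrable_const_bound[of _ 1])
    show "Y i \<in> borel_measurable M"
      unfolding Y_def using measurable_increment[OF ts(3) ts(3), of "Suc i" i] by measurable
    show "AE \<omega> in M. norm (Y i \<omega>) \<le> 1" using \<theta> by (auto simp: Y_def)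
  qed
  have EY: "expectation (Y i) = expectation (\<lambda>\<omega>. exp (- \<theta> * \<bar>X (1 / real N) \<omega>\<bar>))" for i
  proof -
    have "ts (Suc i) = ts i + 1 / real N" by (simp add: ts_def add_divide_distrib)
    then show ?thesis
      using expectation_increment[OF ts(3)[of i], of "1 / real N" "\<lambda>x. exp (- \<theta> * \<bar>x\<bar>)"] by (simp add: Y_def[abs_def])
  qed
  have "exp (- \<theta> * grid_variation N \<omega>) = (\<Prod>i<N. Y i \<omega>)" for \<omega>
    by (simp add: grid_variation_def Y_def ts_def exp_sum[symmetric] sum_distrib_left sum_negf)
  then show ?thesis
    using indep_vars_lebesgue_integral[OF _ indep Yi] by (simp add: EY)
qed

text \<open>
  Let \<open>m\<close> be the expectation of \<open>e\<^bsup>-\<theta>\<bar>X\<bar>\<^esup>\<close> with \<open>X\<close> taken at time \<open>1/N\<close>. Its \<open>N\<close>-th power is the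
  expectation of \<open>e\<^bsup>-\<theta>V\<^esup>\<close> for the grid variation \<open>V\<close>, and this is at least \<open>e\<^bsup>-\<theta>K\<^esup> / 2\<close> if \<open>V \<le> K\<close> with
  probability at least \<open>1/2\<close>, uniformly in \<open>N\<close>. Taking logarithms bounds \<open>N (1 - m)\<close> linearly in \<open>\<theta>\<close>.
\<close>
lemma expectation_exp_abs_small_time:
  assumes "bounded_variation_paths M X"
  obtains K where "\<And>\<theta> N. 0 \<le> \<theta> \<Longrightarrow> 1 \<le> N \<Longrightarrow>
    real N * (1 - expectation (\<lambda>\<omega>. exp (- \<theta> * \<bar>X (1 / real N) \<omega>\<bar>))) \<le> \<theta> * K + ln 2"
proof -
  obtain K :: nat where K: "1 / 2 < prob {\<omega> \<in> space M. \<forall>N\<ge>1. grid_variation N \<omega> \<le> real K}"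
    using grid_variation_bounded_in_probability[OF assms] .
  define E where "E = {\<omega> \<in> space M. \<forall>N\<ge>1. grid_variation N \<omega> \<le> real K}"
  have [measurable]: "E \<in> events" unfolding E_def by measurable
  show ?thesis
  proof (rule that[of "real K"])
    fix \<theta> :: real and N :: nat assume \<theta>: "0 \<le> \<theta>" and N: "1 \<le> N"
    define m where "m = expectation (\<lambda>\<omega>. exp (- \<theta> * \<bar>X (1 / real N) \<omega>\<bar>))"
    have "exp (- \<theta> * real K) * prob E = expectation (\<lambda>\<omega>. exp (- \<theta> * real K) * indicator E \<omega>)" by simp
    also have "\<dots> \<le> expectation (\<lambda>\<omega>. exp (- \<theta> * grid_variation N \<omega>))"
    proof (rule integral_mono)
      show "integrable M (\<lambda>\<omega>. exp (- \<theta> * grid_variation N \<omega>))"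
      proof (rule integrable_const_bound[of _ 1])
        have "0 \<le> grid_variation N \<omega>" for \<omega> by (auto simp: grid_variation_def intro: sum_nonneg)
        then show "AE \<omega> in M. norm (exp (- \<theta> * grid_variation N \<omega>)) \<le> 1" using \<theta> by auto
      qed measurable
      show "exp (- \<theta> * real K) * indicator E \<omega> \<le> exp (- \<theta> * grid_variation N \<omega>)" for \<omega>
        using \<theta> N by (auto simp: E_def indicator_def intro!: mult_left_mono)
      show "integrable M (\<lambda>\<omega>. exp (- \<theta> * real K) * indicator E \<omega>)"
        by (intro integrable_mult_right integrable_real_indicator) (auto simp: less_top[symmetric])
    qed
    also have "\<dots> = m ^ N" unfolding m_def by (rule expectation_exp_grid_variation[OF N \<theta>])
    finally have "exp (- \<theta> * real K) * prob E \<le> m ^ N" .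
    moreover have "exp (- \<theta> * real K) * (1 / 2) < exp (- \<theta> * real K) * prob E"
      using K by (simp add: E_def)
    ultimately have low: "exp (- \<theta> * real K) / 2 < m ^ N" by linarith
    have "0 \<le> m" by (simp add: m_def)
    moreover have "m \<noteq> 0" using low N by (auto simp: power_0_left)
    ultimately have m: "0 < m" by simp
    have "- \<theta> * real K - ln 2 = ln (exp (- \<theta> * real K) / 2)" by (simp add: ln_div)
    also have "\<dots> \<le> ln (m ^ N)" using low by (intro ln_mono) auto
    also have "\<dots> = real N * ln m" using m by (simp add: ln_realpow)
    also have "\<dots> \<le> real N * (m - 1)" using ln_le_minus_one[OF m] by (intro mult_left_mono) auto
    finally show "real N * (1 - expectation (\<lambda>\<omega>. exp (- \<theta> * \<bar>X (1 / real N) \<omega>\<bar>))) \<le> \<theta> * real K + ln 2"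
      unfolding m_def[symmetric] by (simp add: algebra_simps)
  qed
qed

text \<open>
  \<open>\<psi>(\<theta>)\<close> is the derivative at \<open>t = 0\<close> of the expectation of \<open>e\<^bsup>\<theta>X\<^esup>\<close> at time \<open>t\<close>; the bound is the
  limit of the preceding ones along \<open>t = 1/N\<close>. Paths of bounded variation thus force at most linear
  growth of this combination, where a Gaussian part would make it quadratic.
\<close>
lemma laplace_exponent_combination_bound:
  assumes "bounded_variation_paths M X" and \<psi>: "has_laplace_exponent M X \<psi>"
  obtains K where "\<And>\<theta>. 0 \<le> \<theta> \<Longrightarrow> 6 * \<psi> \<theta> - \<psi> (2 * \<theta>) \<le> 25 / 4 * (\<theta> * K + ln 2)"
proof -
  obtain K where K: "\<And>\<theta> N. 0 \<le> \<theta> \<Longrightarrow> 1 \<le> N \<Longrightarrow>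
    real N * (1 - expectation (\<lambda>\<omega>. exp (- \<theta> * \<bar>X (1 / real N) \<omega>\<bar>))) \<le> \<theta> * K + ln 2"
    using expectation_exp_abs_small_time[OF assms(1)] by blast
  show ?thesis
  proof (rule that[of K])
    fix \<theta> :: real assume \<theta>: "0 \<le> \<theta>"
    let ?q = "\<lambda>c h. (exp (h * c) - 1) / (h::real)"
    have lim: "(\<lambda>n. ?q c (inverse (real (Suc n)))) \<longlonglongrightarrow> c" for c :: real
    proof -
      have "((\<lambda>h. exp (h * c)) has_real_derivative c) (at 0)" by (auto intro!: derivative_eq_intros)
      then have "((\<lambda>h. ?q c h) \<longlongrightarrow> c) (at 0)" unfolding DERIV_def by simp
      moreover have "filterlim (\<lambda>n. inverse (real (Suc n))) (at 0) sequentially"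
        unfolding filterlim_at using LIMSEQ_inverse_real_of_nat by simp
      ultimately show ?thesis by (rule filterlim_compose)
    qed
    have "(\<lambda>n. 6 * ?q (\<psi> \<theta>) (inverse (real (Suc n))) - ?q (\<psi> (2 * \<theta>)) (inverse (real (Suc n)))) \<longlonglongrightarrow> 6 * \<psi> \<theta> - \<psi> (2 * \<theta>)"
      by (intro tendsto_intros lim)
    then show "6 * \<psi> \<theta> - \<psi> (2 * \<theta>) \<le> 25 / 4 * (\<theta> * K + ln 2)"
    proof (rule LIMSEQ_le_const2, intro exI[of _ 0] allI impI)
      fix n :: nat
      define N where "N = Suc n"
      define t where "t = 1 / real N"
      have t: "0 < t" by (simp add: t_def N_def)
      have E: "integrable M (\<lambda>\<omega>. exp (\<theta> * X t \<omega>))" "expectation (\<lambda>\<omega>. exp (\<theta> * X t \<omega>)) = exp (t * \<psi> \<theta>)"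
        "integrable M (\<lambda>\<omega>. exp (2 * \<theta> * X t \<omega>))" "expectation (\<lambda>\<omega>. exp (2 * \<theta> * X t \<omega>)) = exp (t * \<psi> (2 * \<theta>))"
        using \<psi> \<theta> t by (auto simp: has_laplace_exponent_def)
      have [measurable]: "X t \<in> borel_measurable M" using random_variable_X t by simp
      have ia: "integrable M (\<lambda>\<omega>. exp (- \<theta> * \<bar>X t \<omega>\<bar>))"
        by (rule integrable_const_bound[of _ 1]) (use \<theta> in auto)
      have "6 * (exp (t * \<psi> \<theta>) - 1) - (exp (t * \<psi> (2 * \<theta>)) - 1)
         = expectation (\<lambda>\<omega>. 6 * (exp (\<theta> * X t \<omega>) - 1) - (exp (2 * \<theta> * X t \<omega>) - 1))"
        using E by (simp add: prob_space)
      also have "\<dots> \<le> expectation (\<lambda>\<omega>. 25 / 4 * (1 - exp (- \<theta> * \<bar>X t \<omega>\<bar>)))"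
      proof (rule integral_mono)
        fix \<omega>
        show "6 * (exp (\<theta> * X t \<omega>) - 1) - (exp (2 * \<theta> * X t \<omega>) - 1) \<le> 25 / 4 * (1 - exp (- \<theta> * \<bar>X t \<omega>\<bar>))"
          using exp_combination_le[of "\<theta> * X t \<omega>"] \<theta> by (simp add: abs_mult mult.assoc)
      qed (use E ia in auto)
      also have "\<dots> = 25 / 4 * (1 - expectation (\<lambda>\<omega>. exp (- \<theta> * \<bar>X t \<omega>\<bar>)))"
        using ia by (simp add: prob_space)
      finally have "real N * (6 * (exp (t * \<psi> \<theta>) - 1) - (exp (t * \<psi> (2 * \<theta>)) - 1))
         \<le> real N * (25 / 4 * (1 - expectation (\<lambda>\<omega>. exp (- \<theta> * \<bar>X t \<omega>\<bar>))))"
        by (rule mult_left_mono) simp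
      also have "\<dots> = 25 / 4 * (real N * (1 - expectation (\<lambda>\<omega>. exp (- \<theta> * \<bar>X t \<omega>\<bar>))))" by simp
      also have "\<dots> \<le> 25 / 4 * (\<theta> * K + ln 2)"
        unfolding t_def by (rule mult_left_mono[OF K[OF \<theta>]]) (auto simp: N_def)
      finally show "6 * ?q (\<psi> \<theta>) (inverse (real (Suc n))) - ?q (\<psi> (2 * \<theta>)) (inverse (real (Suc n))) \<le> 25 / 4 * (\<theta> * K + ln 2)"
        by (simp add: t_def N_def inverse_eq_divide algebra_simps)
    qed
  qed
qed

text \<open>
  Markov's inequality with exponent \<open>n\<close>: the moments \<open>E e\<^bsup>nX\<^esup>\<close> are at most \<open>1\<close>, while positive values taken
  with positive probability would make them grow without bound.
\<close>
lemma AE_nonpos_if_laplace_exponent_nonpos: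
  assumes \<psi>: "has_laplace_exponent M X \<psi>" and nonpos: "\<And>\<theta>. 1 \<le> \<theta> \<Longrightarrow> \<psi> \<theta> \<le> 0" and t: "0 \<le> t"
  shows "AE \<omega> in M. X t \<omega> \<le> 0"
proof -
  have [measurable]: "X t \<in> borel_measurable M" using random_variable_X t by simp
  have "AE \<omega> in M. \<not> 1 / real (Suc k) \<le> X t \<omega>" for k
  proof -
    define e where "e = 1 / real (Suc k)"
    have e: "0 < e" by (simp add: e_def)
    let ?A = "{\<omega> \<in> space M. e \<le> X t \<omega>}"
    have le: "prob ?A \<le> exp (- e) ^ n" if n: "1 \<le> n" for n :: nat
    proof -
      have i: "integrable M (\<lambda>\<omega>. exp (real n * X t \<omega>))" "expectation (\<lambda>\<omega>. exp (real n * X t \<omega>)) = exp (t * \<psi> (real n))"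
        using \<psi> t by (auto simp: has_laplace_exponent_def)
      have "exp (real n * e) * prob ?A = expectation (\<lambda>\<omega>. exp (real n * e) * indicator ?A \<omega>)" by simp
      also have "\<dots> \<le> expectation (\<lambda>\<omega>. exp (real n * X t \<omega>))"
      proof (rule integral_mono)
        show "integrable M (\<lambda>\<omega>. exp (real n * e) * indicator ?A \<omega>)"
          by (intro integrable_mult_right integrable_real_indicator) (auto simp: less_top[symmetric])
        show "exp (real n * e) * indicator ?A \<omega> \<le> exp (real n * X t \<omega>)" for \<omega>
          by (auto simp: indicator_def intro!: mult_left_mono)
      qed (rule i)
      also have "\<dots> \<le> 1" using i nonpos[of "real n"] n t by (simp add: mult_nonneg_nonpos)
      finally have "prob ?A \<le> 1 / exp (real n * e)" by (simp add: field_simps)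
      also have "\<dots> = exp (- e) ^ n" by (simp add: exp_of_nat_mult[symmetric] exp_minus field_simps)
      finally show ?thesis .
    qed
    have "(\<lambda>n. exp (- e) ^ n) \<longlonglongrightarrow> 0" using e by (intro LIMSEQ_realpow_zero) auto
    then have "prob ?A \<le> 0" by (rule LIMSEQ_le_const) (use le in auto)
    then have "prob ?A = 0" by (simp add: measure_le_0_iff)
    then have "AE \<omega> in M. \<omega> \<notin> ?A" by (intro prob_eq_0[THEN iffD1]) auto
    with AE_space show ?thesis by eventually_elim (simp add: e_def)
  qed
  then have "AE \<omega> in M. \<forall>k. \<not> 1 / real (Suc k) \<le> X t \<omega>" unfolding AE_all_countable by blast
  then show ?thesis
  proof eventually_elim
    fix \<omega> assume *: "\<forall>k. \<not> 1 / real (Suc k) \<le> X t \<omega>"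
    show "X t \<omega> \<le> 0"
    proof (rule ccontr)
      assume "\<not> X t \<omega> \<le> 0"
      then obtain k where "1 / real (Suc k) < X t \<omega>" using nat_approx_posE[of "X t \<omega>"] by auto
      then show False using * by (meson less_imp_le)
    qed
  qed
qed

text \<open>
  By stationarity all increments are nonpositive almost surely, simultaneously at all rational
  times, and right-continuity transfers this to all real times.
\<close>
lemma AE_antimono_if_nonpos:
  assumes nonpos: "\<And>t. 0 \<le> t \<Longrightarrow> AE \<omega> in M. X t \<omega> \<le> 0"
  shows "AE \<omega> in M. antimono_on {0..} (\<lambda>t. X t \<omega>)"
proof -
  have incr: "AE \<omega> in M. X (s + t) \<omega> - X s \<omega> \<le> 0" if "0 \<le> s" "0 \<le> t" for s t
  proof -
    have [measurable]: "X t \<in> borel_measurable M" "(\<lambda>\<omega>. X (s + t) \<omega> - X s \<omega>) \<in> borel_measurable M"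
      using that random_variable_X measurable_increment[of "s + t" s] by auto
    have "AE x in distr M borel (X t). x \<le> 0" using nonpos[OF that(2)] by (subst AE_distr_iff) auto
    then have "AE x in distr M borel (\<lambda>\<omega>. X (s + t) \<omega> - X s \<omega>). x \<le> 0"
      unfolding stationary_increments[OF that] .
    then show ?thesis by (subst (asm) AE_distr_iff) auto
  qed
  have "AE \<omega> in M. 0 \<le> r \<longrightarrow> r \<le> s \<longrightarrow> X (of_rat s) \<omega> \<le> X (of_rat r) \<omega>" for r s :: rat
  proof (cases "0 \<le> r \<and> r \<le> s")
    case True
    have "AE \<omega> in M. X (of_rat r + of_rat (s - r)) \<omega> - X (of_rat r) \<omega> \<le> 0"
      using True by (intro incr) auto
    then show ?thesis by (simp add: of_rat_add[symmetric])
  qed auto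
  then have "AE \<omega> in M. \<forall>r s. 0 \<le> r \<longrightarrow> r \<le> s \<longrightarrow> X (of_rat s) \<omega> \<le> X (of_rat r) \<omega>"
    unfolding AE_all_countable by blast
  with right_continuous show ?thesis
  proof eventually_elim
    fix \<omega>
    assume rc: "\<forall>t\<ge>0. continuous (at_right t) (\<lambda>s. X s \<omega>)"
      and rat: "\<forall>r s. 0 \<le> r \<longrightarrow> r \<le> s \<longrightarrow> X (of_rat s) \<omega> \<le> X (of_rat r) \<omega>"
    show "antimono_on {0..} (\<lambda>t. X t \<omega>)"
    proof (rule monotone_onI)
      fix u v :: real assume uv: "u \<in> {0..}" "v \<in> {0..}" "u \<le> v"
      show "X v \<omega> \<le> X u \<omega>"
      proof (rule ccontr)
        assume "\<not> X v \<omega> \<le> X u \<omega>"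
        then have less: "X u \<omega> < X v \<omega>" by simp
        with uv have uv': "u < v" by (cases "u = v") auto
        obtain c where c: "X u \<omega> < c" "c < X v \<omega>" using dense[OF less] by blast
        have "((\<lambda>s. X s \<omega>) \<longlongrightarrow> X u \<omega>) (at_right u)" "((\<lambda>s. X s \<omega>) \<longlongrightarrow> X v \<omega>) (at_right v)"
          using rc uv by (auto simp: continuous_within)
        then have "\<forall>\<^sub>F r in at_right u. X r \<omega> < c" "\<forall>\<^sub>F s in at_right v. c < X s \<omega>"
          using c by (auto intro: order_tendstoD)
        then obtain b b' where b: "u < b" "\<And>r. u < r \<Longrightarrow> r < b \<Longrightarrow> X r \<omega> < c"
          and b': "v < b'" "\<And>s. v < s \<Longrightarrow> s < b' \<Longrightarrow> c < X s \<omega>"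
          unfolding eventually_at_right_field by blast
        obtain r :: rat where r: "u < of_rat r" "of_rat r < min b v"
          using of_rat_dense[of u "min b v"] b uv' by auto
        obtain s :: rat where s: "v < of_rat s" "of_rat s < b'"
          using of_rat_dense[of v b'] b' by auto
        have "(0::real) < of_rat r" by (rule le_less_trans[of 0 u]) (use r uv in auto)
        moreover have "(of_rat r :: real) < of_rat s" by (rule less_trans[of _ v]) (use r s in auto)
        ultimately have "0 \<le> r" "r \<le> s" by (simp_all add: of_rat_less)
        then have "X (of_rat s) \<omega> \<le> X (of_rat r) \<omega>" using rat by blast
        moreover have "X (of_rat r) \<omega> < c" using b(2) r by simp
        moreover have "c < X (of_rat s) \<omega>" using b'(2) s by simp
        ultimately show False by simp
      qed
    qed
  qed
qed

lemma ex_laplace_exponent_pos: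
  assumes "has_laplace_exponent M X \<psi>"
  shows "\<exists>\<theta>\<ge>1. 0 < \<psi> \<theta>"
proof (rule ccontr)
  assume "\<not> (\<exists>\<theta>\<ge>1. 0 < \<psi> \<theta>)"
  then have "\<psi> \<theta> \<le> 0" if "1 \<le> \<theta>" for \<theta> using that by (auto simp: not_less)
  then have "AE \<omega> in M. antimono_on {0..} (\<lambda>t. X t \<omega>)"
    by (intro AE_antimono_if_nonpos AE_nonpos_if_laplace_exponent_nonpos[OF assms])
  then show False using not_monotone_decreasing by simp
qed

text \<open>
  A Gaussian part would make \<open>6 \<psi>(\<theta>) - \<psi>(2\<theta>)\<close> grow quadratically, contradicting bounded
  variation; a drift \<open>\<delta> \<le> 0\<close> would make \<open>\<psi>\<close> nonpositive and the paths decreasing.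
\<close>
lemma laplace_exponent_bounded_variation:
  assumes \<psi>: "has_laplace_exponent M X \<psi>" and lk: "levy_khintchine \<psi> a \<sigma> \<nu>"
    and bv: "bounded_variation_paths M X" and i: "exp_integrable 1 (levy_tail \<nu>)"
  obtains \<delta> where "0 < \<delta>" "\<And>\<theta>. 1 \<le> \<theta> \<Longrightarrow> \<psi> \<theta> = \<theta> * (\<delta> - laplace (levy_tail \<nu>) \<theta>)"
proof -
  let ?L = "laplace (levy_tail \<nu>)"
  obtain \<delta> where \<delta>: "\<And>\<theta>. 1 \<le> \<theta> \<Longrightarrow> \<psi> \<theta> = \<delta> * \<theta> + 1 / 2 * \<sigma>\<^sup>2 * \<theta>\<^sup>2 - \<theta> * ?L \<theta>"
    using laplace_exponent_via_tail[OF lk i] by blast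
  obtain K where K: "\<And>\<theta>. 0 \<le> \<theta> \<Longrightarrow> 6 * \<psi> \<theta> - \<psi> (2 * \<theta>) \<le> 25 / 4 * (\<theta> * K + ln 2)"
    using laplace_exponent_combination_bound[OF bv \<psi>] by blast
  have L: "0 \<le> ?L \<theta>" for \<theta> using levy_tail_nonneg by (intro laplace_nonneg) auto
  have L1: "?L \<theta> \<le> ?L 1" if "1 \<le> \<theta>" for \<theta>
    using levy_tail_nonneg by (intro laplace_antimono[OF i _ that]) auto
  define B where "B = 25 / 4 * K + 25 / 4 * ln 2 - 4 * \<delta> + 6 * ?L 1"
  have bound: "\<sigma>\<^sup>2 * \<theta> \<le> B" if \<theta>: "1 \<le> \<theta>" for \<theta>
  proof -
    have "6 * \<psi> \<theta> - \<psi> (2 * \<theta>) = \<theta> * (4 * \<delta> + \<sigma>\<^sup>2 * \<theta> - 6 * ?L \<theta> + 2 * ?L (2 * \<theta>))"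
      using \<delta>[OF \<theta>] \<delta>[of "2 * \<theta>"] \<theta> by (simp add: power2_eq_square algebra_simps)
    moreover have "25 / 4 * (\<theta> * K + ln 2) \<le> \<theta> * (25 / 4 * K + 25 / 4 * ln 2)"
    proof -
      have "ln 2 \<le> \<theta> * ln 2" using \<theta> by simp
      then show ?thesis by (simp add: algebra_simps)
    qed
    ultimately have "\<theta> * (4 * \<delta> + \<sigma>\<^sup>2 * \<theta> - 6 * ?L \<theta> + 2 * ?L (2 * \<theta>)) \<le> \<theta> * (25 / 4 * K + 25 / 4 * ln 2)"
      using K[of \<theta>] \<theta> by linarith
    then have "4 * \<delta> + \<sigma>\<^sup>2 * \<theta> - 6 * ?L \<theta> + 2 * ?L (2 * \<theta>) \<le> 25 / 4 * K + 25 / 4 * ln 2"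
      using \<theta> by (simp add: mult_le_cancel_left_pos)
    then show ?thesis using L[of "2 * \<theta>"] L1[OF \<theta>] unfolding B_def by linarith
  qed
  have "\<sigma>\<^sup>2 = 0"
  proof (rule ccontr)
    assume "\<sigma>\<^sup>2 \<noteq> 0"
    then have pos: "0 < \<sigma>\<^sup>2" by simp
    define \<theta> where "\<theta> = max 1 ((\<bar>B\<bar> + 1) / \<sigma>\<^sup>2)"
    have "\<bar>B\<bar> + 1 = \<sigma>\<^sup>2 * ((\<bar>B\<bar> + 1) / \<sigma>\<^sup>2)" using pos by simp
    also have "\<dots> \<le> \<sigma>\<^sup>2 * \<theta>" using pos by (intro mult_left_mono) (auto simp: \<theta>_def)
    also have "\<dots> \<le> B" by (rule bound) (simp add: \<theta>_def)
    finally show False by linarith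
  qed
  then have form: "\<psi> \<theta> = \<theta> * (\<delta> - ?L \<theta>)" if "1 \<le> \<theta>" for \<theta>
    using \<delta>[OF that] by (simp add: algebra_simps)
  moreover have "0 < \<delta>"
  proof -
    obtain \<theta> where \<theta>: "1 \<le> \<theta>" "0 < \<psi> \<theta>" using ex_laplace_exponent_pos[OF \<psi>] by blast
    then have "0 < \<delta> - ?L \<theta>" using form[of \<theta>] by (simp add: zero_less_mult_iff)
    then show ?thesis using L[of \<theta>] by simp
  qed
  ultimately show ?thesis using that by blast
qed

end

section \<open>Smoothness of scale functions\<close>

theorem theorem3:
  fixes M :: "'a measure" and X :: "real \<Rightarrow> 'a \<Rightarrow> real"
    and \<psi> W :: "real \<Rightarrow> real" and a \<sigma> q :: real and \<nu> :: "real measure" and n :: nat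
  assumes "spectrally_negative_levy M X"
    and "has_laplace_exponent M X \<psi>"
    and "levy_khintchine \<psi> a \<sigma> \<nu>"
    and "bounded_variation_paths M X"
    and "levy_tail \<nu> differentiable_on {0<..}"
    and "\<exists>\<alpha><1. \<exists>C>0. \<forall>\<^sub>F x in at_right 0. - deriv (levy_tail \<nu>) x \<le> C * x powr (- 1 - \<alpha>)"
    and "0 \<le> q"
    and "is_scale_function \<psi> q W"
    and "1 \<le> n"
  shows "C_k_on (n + 1) W {0<..} \<longleftrightarrow> C_k_on n (levy_tail \<nu>) {0<..}"
proof -
  interpret spectrally_negative_levy M X by fact
  note S = open_greaterThan[of "0::real"]
  let ?T = "levy_tail \<nu>"
  have \<nu>: "levy_measure \<nu>" using assms(3) by (simp add: levy_khintchine_def)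
  have Ti: "exp_integrable 1 ?T" by (rule levy_tail_exp_integrable[OF \<nu> assms(5,6)])
  obtain \<delta> where \<delta>: "0 < \<delta>" and \<psi>: "\<And>\<theta>. 1 \<le> \<theta> \<Longrightarrow> \<psi> \<theta> = \<theta> * (\<delta> - laplace ?T \<theta>)"
    using laplace_exponent_bounded_variation[OF assms(2,3,4) Ti] by blast
  \<comment> \<open>With this kernel \<open>\<psi>(\<theta>) - q = \<delta> \<theta> (1 - G(\<theta>))\<close>, where \<open>G\<close> is the transform of \<open>g\<close>.\<close>
  define g where "g x = 1 / \<delta> * (?T x + q)" for x
  have gi: "exp_integrable \<theta> g" and gl: "laplace g \<theta> = 1 / \<delta> * (laplace ?T \<theta> + q / \<theta>)" if "1 \<le> \<theta>" for \<theta>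
  proof -
    have c: "exp_integrable \<theta> (\<lambda>_. q)" "laplace (\<lambda>_. q) \<theta> = q / \<theta>"
      using that by (auto intro: exp_integrable_const)
    note s = exp_integrable_add[OF exp_integrable_mono[OF Ti that] c(1)]
    note m = exp_integrable_cmult[OF s(1), of "1 / \<delta>"]
    show "exp_integrable \<theta> g" unfolding g_def by (rule m(1))
    show "laplace g \<theta> = 1 / \<delta> * (laplace ?T \<theta> + q / \<theta>)" unfolding g_def m(2) s(2) c(2) ..
  qed
  have "\<forall>\<^sub>F \<theta> in at_top. laplace g \<theta> < 1"
    by (rule order_tendstoD(2)[OF laplace_tendsto_0[OF gi]]) auto
  then have "\<forall>\<^sub>F \<theta> in at_top. 1 \<le> \<theta> \<and> laplace g \<theta> < 1"
    using eventually_ge_at_top[of "1::real"] by eventually_elim simp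
  then obtain \<theta>0 where "\<forall>\<theta>\<ge>\<theta>0. 1 \<le> \<theta> \<and> laplace g \<theta> < 1"
    unfolding eventually_at_top_linorder by blast
  then have \<theta>0: "1 \<le> \<theta>0" "laplace g \<theta>0 < 1" by simp_all
  have Td: "(?T has_real_derivative deriv ?T x) (at x)" if "0 < x" for x
    using has_real_derivative_deriv[OF S assms(5)] that by simp
  have gd: "(g has_real_derivative 1 / \<delta> * deriv ?T x) (at x)" if "0 < x" for x
    unfolding g_def using Td[OF that] \<delta> by (auto intro!: derivative_eq_intros)
  interpret renewal_kernel g \<theta>0
  proof
    show "g differentiable_on {0<..}"
      using gd by (auto simp: differentiable_on_def real_differentiable_def intro: has_field_derivative_at_within)
    show "deriv g x \<le> 0" if "0 < x" for x
      using deriv_levy_tail_nonpos[OF \<nu> assms(5) that] \<delta>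
      by (simp add: DERIV_imp_deriv[OF gd[OF that]] divide_nonpos_pos)
    show "0 \<le> g x" for x using levy_tail_nonneg[of \<nu> x] assms(7) \<delta> by (simp add: g_def)
  qed (use \<theta>0 gi in auto)
  have W: "continuous_on {0..} W"
    and Wint: "\<And>t. largest_root \<psi> q < t \<Longrightarrow> set_integrable lborel {0..} (\<lambda>x. exp (- t * x) * W x)"
    and Wlap: "\<And>t. largest_root \<psi> q < t \<Longrightarrow> (LBINT x:{0..}. exp (- t * x) * W x) = 1 / (\<psi> t - q)"
    using assms(8) by (auto simp: is_scale_function_def)
  have Wi: "exp_integrable t W" if "largest_root \<psi> q < t" for t
    unfolding exp_integrable_def by (rule set_integrable_subset[OF Wint[OF that]]) auto
  have Wl: "laplace W t = (1 / \<delta>) / (t * (1 - laplace g t))" if t: "largest_root \<psi> q < t" "\<theta>0 < t" for t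
  proof -
    have "laplace W t = (LBINT x:{0..}. exp (- t * x) * W x)"
      unfolding laplace_def
    proof (rule set_integral_cong_set)
      show "AE x in lborel. (x \<in> {0..}) = (x \<in> {0::real<..})"
        using AE_lborel_singleton[of 0] by eventually_elim auto
    qed (use Wint[OF t(1)] Wi[OF t(1)] in \<open>auto simp: exp_integrable_def set_integrable_def set_borel_measurable_def\<close>)
    also have "\<dots> = 1 / (\<psi> t - q)" by (rule Wlap[OF t(1)])
    also have "\<psi> t - q = \<delta> * (t * (1 - laplace g t))"
      using t \<theta>0 \<delta> \<psi>[of t] gl[of t] by (simp add: field_simps)
    finally show ?thesis by simp
  qed
  have "C_k_on (n + 1) W {0<..} \<longleftrightarrow> C_k_on n g {0<..}"
    by (rule renewal_function_smooth_iff[OF W _ Wi Wl]) (use \<delta> in auto)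
  also have "\<dots> \<longleftrightarrow> C_k_on n ?T {0<..}"
  proof
    assume "C_k_on n g {0<..}"
    then have "C_k_on n (\<lambda>x. \<delta> * g x - q) {0<..}" by (intro C_k_on_diff C_k_on_cmult C_k_on_const S)
    then show "C_k_on n ?T {0<..}" using \<delta> by (simp add: g_def)
  next
    assume "C_k_on n ?T {0<..}"
    then show "C_k_on n g {0<..}" unfolding g_def by (intro C_k_on_add C_k_on_cmult C_k_on_const S)
  qed
  finally show ?thesis .
qed

end
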